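(* Let $P\subset\mathbb{R}^k$ be the closure of a domain with piecewise smooth boundary, regarded as a flat plate in $\mathbb{R}^{k+1}$ (last coordinate equal to $0$). Suppose that the principal curvatures of $\partial P$ are uniformly bounded and that, for the radii $r>0$ considered, the hypersurface $\mathcal{N}=\mathcal{N}(r)\subset\mathbb{R}^{k+1}$ bounding the set of points at distance no greater than $r$ from $P$ has a continuous and piecewise smooth unit normal vector field. Let a $(k+1)$-dimensional ball of radius $r$ with rotationally symmetric mass distribution and moment of inertia parameter $\eta\in[0,1)$ (independent of $r$) roll without slipping on $P$. In the limit as the radius of the rolling ball goes to $0$, the velocity components of the ball immediately before and immediately after rounding the edge of the flat plate $P$ at a boundary point $x$ are related by the linear map $$\Pi_x\mathcal{S}\Pi_x\mapsto\Pi_x\mathcal{S}\Pi_x,\qquad \mathbf{n}(x)\mapsto-\mathbf{n}(x),\qquad \begin{pmatrix}\bar u\\ W\end{pmatrix}\mapsto\begin{pmatrix}c&s\\ s&-c\end{pmatrix}\begin{pmatrix}\bar u\\ W\end{pmatrix},$$ where $s=\sin(\pi\eta)$ and $c=\cos(\pi\eta)$.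
   Context: Here $x$ is a point of the smooth part of $\partial P$; $\mathbf{n}(x)\in\mathbb{R}^k$ is the unit normal vector to $\partial P$ at $x$ pointing into $P$; and $\Pi_x$ is the orthogonal projection onto the tangent space $T_x(\partial P)$. $\mathbb{R}^k$ is identified with $\mathbb{R}^k\times\{0\}\subset\mathbb{R}^{k+1}$. The entry $\mathbf{n}(x)\mapsto-\mathbf{n}(x)$ means that the component of the center velocity normal to $\partial P$ changes sign; in the $2\times2$ block matrix, $c$ and $s$ multiply the identity map of $T_x(\partial P)$. Rolling motion: the ball stays in contact with $P$ and rolls on it without slipping (the point of the ball in contact with $P$ has zero velocity), with no forces other than those enforcing the constraints. Its center moves on $\mathcal{N}$, which consists of two flat sheets (parallel copies of $P$ at distance $2r$ from each other) and a curved part around the edge $\partial P$ (half of the boundary of the tube of radius $r$ about $\partial P$). "Rounding the edge" means moving along the curved part from one flat sheet to the other. Velocities: $u$ is the velocity of the center of the ball, tangent to $\mathcal{N}$ (so that it lies in $\mathbb{R}^k$ just before and just after rounding the edge), and $U\in\mathfrak{so}(k+1)$ (the skew-symmetric matrices) is the ball's angular velocity matrix. With $\Pi^{\mathcal{N}}$ the orthogonal projection from $\mathbb{R}^{k+1}$ onto the tangent space of $\mathcal{N}$ at the ball's center, define $S=\Pi^{\mathcal{N}}U\Pi^{\mathcal{N}}$; the tangential spin is $\mathcal{S}=r\eta S$, a skew-symmetric linear map of that tangent space. At $x\in\partial P$ put $\bar u=\Pi_xu$ and $W=\mathcal{S}\,\mathbf{n}(x)$, which is tangent to $\partial P$ because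 $\mathcal{S}$ is skew-symmetric. Equations of motion on $\mathcal{N}$: $\frac{\nabla u}{dt}=-\eta\,\mathcal{S}\,\mathbb{S}u$ and $\frac{\nabla\mathcal{S}}{dt}=\eta\,(\mathbb{S}u)\wedge u$, where $u$ is the time derivative of the center position, $\nabla$ is the Levi-Civita connection of $\mathcal{N}$ with the metric induced from $\mathbb{R}^{k+1}$, $\mathbb{S}v=-D_v\nu$ is the shape operator with respect to the unit normal $\nu$ of $\mathcal{N}$ pointing away from $P$, and $(a\wedge b)v=(a\cdot v)b-(b\cdot v)a$. Moment of inertia parameter: $\eta=\gamma/\sqrt{1+\gamma^2}$, where $\gamma\ge0$ is determined by the kinetic energy of the ball being $\tfrac12 m\left(|u|^2+\tfrac{r^2\gamma^2}{2}\mathrm{Tr}(UU^{\top})\right)$, with $m$ its total mass; $\gamma$ and $\eta$ do not depend on $r$.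
   Formalization: With n(x) pointing into P the printed matrix is wrong (on a half-plane its off-diagonal entries are -s); here n(x) points out of P, where the printed matrix holds. In the limit the incoming center velocity must cross the edge transversally (no grazing). *)

theory Defs
  imports "HOL-Analysis.Analysis"
begin

section \<open>Smoothness\<close>

primrec C_on :: "nat \<Rightarrow> ('a::real_normed_vector \<Rightarrow> 'b::real_normed_vector) \<Rightarrow> 'a set \<Rightarrow> bool" where
  "C_on 0 f V \<longleftrightarrow> continuous_on V f"
| "C_on (Suc m) f V \<longleftrightarrow>
     (\<forall>x\<in>V. f differentiable (at x)) \<and> (\<forall>v. C_on m (\<lambda>x. frechet_derivative f (at x) v) V)"

text \<open>Used for open \<open>V\<close> only.\<close>

definition smooth_on :: "('a::real_normed_vector \<Rightarrow> 'b::real_normed_vector) \<Rightarrow> 'a set \<Rightarrow> bool" where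
  "smooth_on f V \<longleftrightarrow> (\<forall>m. C_on m f V)"

definition defining_function :: "('a::real_normed_vector \<Rightarrow> real) \<Rightarrow> 'a set \<Rightarrow> bool" where
  "defining_function \<phi> V \<longleftrightarrow>
     smooth_on \<phi> V \<and> (\<forall>y\<in>V. \<exists>v. frechet_derivative \<phi> (at y) v \<noteq> 0)"

text \<open>The points near which \<open>M\<close> is a smooth hypersurface.\<close>

definition smooth_part :: "'a::real_normed_vector set \<Rightarrow> 'a set" where
  "smooth_part M =
     {x \<in> M. \<exists>V \<phi>. open V \<and> x \<in> V \<and> defining_function \<phi> V \<and> M \<inter> V = {y \<in> V. \<phi> y = 0}}"

text \<open>Locally the boundary lies in the union of finitely many smooth hypersurfaces, and its
  singular points are limits of smooth ones.\<close>

definition piecewise_smooth_boundary :: "'a::real_normed_vector set \<Rightarrow> bool" where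
  "piecewise_smooth_boundary P \<longleftrightarrow>
     (\<forall>x \<in> frontier P. \<exists>V \<Phi>. open V \<and> x \<in> V \<and> finite \<Phi> \<and>
        (\<forall>\<phi>\<in>\<Phi>. defining_function \<phi> V) \<and>
        frontier P \<inter> V \<subseteq> (\<Union>\<phi>\<in>\<Phi>. {y \<in> V. \<phi> y = 0})) \<and>
     frontier P \<subseteq> closure (smooth_part (frontier P))"

text \<open>Locally \<open>M\<close> is the union of finitely many relatively closed pieces, on each of which \<open>f\<close> is
  the restriction of a smooth map.\<close>

definition piecewise_smooth_on ::
    "'a::real_normed_vector set \<Rightarrow> ('a \<Rightarrow> 'b::real_normed_vector) \<Rightarrow> bool" where
  "piecewise_smooth_on M f \<longleftrightarrow>
     (\<forall>p\<in>M. \<exists>V \<A>. open V \<and> p \<in> V \<and> finite \<A> \<and> M \<inter> V = \<Union>\<A> \<and>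
        (\<forall>A\<in>\<A>. closedin (top_of_set V) A \<and>
           (\<exists>G g. open G \<and> A \<subseteq> G \<and> smooth_on g G \<and> (\<forall>q\<in>A. f q = g q))))"

section \<open>Hypersurfaces in Euclidean space\<close>

definition tangent_space :: "'a::euclidean_space set \<Rightarrow> 'a \<Rightarrow> 'a set" where
  "tangent_space M p =
     {v. \<exists>g. g 0 = p \<and> (\<forall>\<^sub>F t in at (0::real). g t \<in> M) \<and> (g has_vector_derivative v) (at 0)}"

definition unit_normal :: "'a::euclidean_space set \<Rightarrow> 'a \<Rightarrow> 'a \<Rightarrow> bool" where
  "unit_normal M p w \<longleftrightarrow> p \<in> M \<and> norm w = 1 \<and> tangent_space M p = {v. v \<bullet> w = 0}"

definition outward_unit_normal :: "'a::euclidean_space set \<Rightarrow> 'a \<Rightarrow> 'a \<Rightarrow> bool" where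
  "outward_unit_normal B p w \<longleftrightarrow>
     unit_normal (frontier B) p w \<and> (\<forall>\<^sub>F t in at_right 0. p + t *\<^sub>R w \<notin> B)"

text \<open>The derivative of \<open>\<nu>\<close> within \<open>M\<close> is determined on tangent vectors only, and
  \<open>shape_operator\<close> is only applied to these.\<close>

definition shape_operator :: "'a::euclidean_space set \<Rightarrow> ('a \<Rightarrow> 'a) \<Rightarrow> 'a \<Rightarrow> 'a \<Rightarrow> 'a" where
  "shape_operator M \<nu> p v = - frechet_derivative \<nu> (at p within M) v"

text \<open>Both choices of the local normal field are allowed, so principal curvatures are defined up
  to sign; only their absolute values matter below.\<close>

definition principal_curvature :: "'a::euclidean_space set \<Rightarrow> 'a \<Rightarrow> real \<Rightarrow> bool" where
  "principal_curvature M p \<kappa> \<longleftrightarrow>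
     (\<exists>V \<nu> v. open V \<and> p \<in> V \<and> continuous_on (M \<inter> V) \<nu> \<and> (\<forall>q \<in> M \<inter> V. unit_normal M q (\<nu> q)) \<and>
        \<nu> differentiable (at p within M) \<and>
        v \<in> tangent_space M p \<and> v \<noteq> 0 \<and> shape_operator M \<nu> p v = \<kappa> *\<^sub>R v)"

definition bounded_principal_curvatures :: "'a::euclidean_space set \<Rightarrow> bool" where
  "bounded_principal_curvatures M \<longleftrightarrow>
     (\<exists>B. \<forall>p \<in> smooth_part M. \<forall>\<kappa>. principal_curvature M p \<kappa> \<longrightarrow> \<bar>\<kappa>\<bar> \<le> B)"

section \<open>Linear maps\<close>

text \<open>For a unit vector \<open>w\<close>, the orthogonal projection onto the orthogonal complement of \<open>w\<close>.\<close>

definition proj_perp :: "'a::euclidean_space \<Rightarrow> 'a \<Rightarrow>\<^sub>L 'a" where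
  "proj_perp w = id_blinfun - (blinfun_scaleR_left w o\<^sub>L blinfun_inner_left w)"

lemma proj_perp_apply: "blinfun_apply (proj_perp w) v = v - (v \<bullet> w) *\<^sub>R w"
  by (simp add: proj_perp_def blinfun.diff_left)

definition wedge :: "'a::euclidean_space \<Rightarrow> 'a \<Rightarrow> 'a \<Rightarrow>\<^sub>L 'a" where
  "wedge a b = (blinfun_scaleR_left b o\<^sub>L blinfun_inner_left a)
             - (blinfun_scaleR_left a o\<^sub>L blinfun_inner_left b)"

lemma wedge_apply: "blinfun_apply (wedge a b) v = (a \<bullet> v) *\<^sub>R b - (b \<bullet> v) *\<^sub>R a"
  by (simp add: wedge_def blinfun.diff_left inner_commute)

definition skew :: "('a::euclidean_space \<Rightarrow>\<^sub>L 'a) \<Rightarrow> bool" where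
  "skew A \<longleftrightarrow> (\<forall>v w. A v \<bullet> w = - (v \<bullet> A w))"

text \<open>If \<open>A\<close> maps the hyperplane \<open>snd p = 0\<close> to itself, this is its restriction to that
  hyperplane, under the identification of \<open>y\<close> with \<open>(y, 0)\<close>.\<close>

definition plate_restrict ::
    "(('a::euclidean_space \<times> real) \<Rightarrow>\<^sub>L ('a \<times> real)) \<Rightarrow> ('a \<Rightarrow>\<^sub>L 'a)" where
  "plate_restrict A = fst_blinfun o\<^sub>L A o\<^sub>L Blinfun (\<lambda>y. (y, 0))"

lemma plate_restrict_apply: "blinfun_apply (plate_restrict A) y = fst (A (y, 0))"
proof -
  have "bounded_linear (\<lambda>y::'a. (y, 0::real))"
    by (intro bounded_linear_Pair bounded_linear_ident bounded_linear_zero)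
  then show ?thesis
    by (simp add: plate_restrict_def bounded_linear_Blinfun_apply)
qed

section \<open>Rolling on a flat plate\<close>

text \<open>A set \<open>P\<close> in \<open>'a\<close> is viewed as the plate \<open>P \<times> {0}\<close> in \<open>'a \<times> real\<close>, which carries the
  Euclidean inner product.\<close>

definition plate_nbhd :: "'a::euclidean_space set \<Rightarrow> real \<Rightarrow> ('a \<times> real) set" where
  "plate_nbhd P r = {p. infdist p (P \<times> {0}) \<le> r}"

definition center_surface :: "'a::euclidean_space set \<Rightarrow> real \<Rightarrow> ('a \<times> real) set" where
  "center_surface P r = frontier (plate_nbhd P r)"

definition curved_part :: "'a::euclidean_space set \<Rightarrow> real \<Rightarrow> ('a \<times> real) set" where
  "curved_part P r = center_surface P r - (P \<times> {r} \<union> P \<times> {- r})"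

text \<open>The unit normal field of the center surface pointing away from the plate.\<close>

definition piecewise_smooth_normal_field ::
    "'a::euclidean_space set \<Rightarrow> real \<Rightarrow> ('a \<times> real \<Rightarrow> 'a \<times> real) \<Rightarrow> bool" where
  "piecewise_smooth_normal_field P r \<nu> \<longleftrightarrow>
     (\<forall>p \<in> center_surface P r. outward_unit_normal (plate_nbhd P r) p (\<nu> p)) \<and>
     continuous_on (center_surface P r) \<nu> \<and> piecewise_smooth_on (center_surface P r) \<nu>"

text \<open>The linear map \<open>r \<eta> \<Pi> U \<Pi>\<close> of the tangent space orthogonal to \<open>w\<close>, extended by \<open>0\<close> to the
  normal direction.\<close>

definition tangential_spin ::
    "real \<Rightarrow> real \<Rightarrow> 'b::euclidean_space \<Rightarrow> ('b \<Rightarrow>\<^sub>L 'b) \<Rightarrow> ('b \<Rightarrow>\<^sub>L 'b)" where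
  "tangential_spin r \<eta> w U = (r * \<eta>) *\<^sub>R (proj_perp w o\<^sub>L U o\<^sub>L proj_perp w)"

text \<open>A motion on the time interval \<open>T\<close> with center \<open>a\<close>, center velocity \<open>u\<close> and angular velocity
  \<open>U\<close>; the material point at position \<open>p\<close> has velocity \<open>u + U (p - a)\<close>, and the contact point is
  \<open>a - r \<nu>(a)\<close>. The equations of motion are imposed wherever the shape operator of the center
  surface exists; where the curvature jumps (between a flat sheet and the curved part) only
  continuity of \<open>u\<close> and \<open>U\<close> is required. The Levi-Civita derivative along \<open>a\<close> of a tangent field
  is the tangential projection of its ordinary derivative; by the Leibniz rule, that of a field
  \<open>S\<close> of endomorphisms of the tangent spaces, extended by \<open>0\<close> to the normals, is \<open>\<Pi> S' \<Pi>\<close>.\<close>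

definition rolling_motion ::
    "'a::euclidean_space set \<Rightarrow> real \<Rightarrow> real \<Rightarrow> ('a \<times> real \<Rightarrow> 'a \<times> real) \<Rightarrow> real set \<Rightarrow>
     (real \<Rightarrow> 'a \<times> real) \<Rightarrow> (real \<Rightarrow> 'a \<times> real) \<Rightarrow> (real \<Rightarrow> (('a \<times> real) \<Rightarrow>\<^sub>L ('a \<times> real))) \<Rightarrow> bool" where
  "rolling_motion P r \<eta> \<nu> T a u U \<longleftrightarrow>
     is_interval T \<and>
     (\<forall>t\<in>T. a t \<in> center_surface P r) \<and>
     (\<forall>t\<in>T. (a has_vector_derivative u t) (at t within T)) \<and>
     continuous_on T u \<and> continuous_on T U \<and>
     (\<forall>t\<in>T. skew (U t)) \<and>
     (\<forall>t\<in>T. u t + U t ((a t - r *\<^sub>R \<nu> (a t)) - a t) = 0) \<and>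
     (\<forall>t\<in>T. \<nu> differentiable (at (a t) within center_surface P r) \<longrightarrow>
        (let \<S> = (\<lambda>\<tau>. tangential_spin r \<eta> (\<nu> (a \<tau>)) (U \<tau>));
             Pr = proj_perp (\<nu> (a t));
             Su = shape_operator (center_surface P r) \<nu> (a t) (u t)
         in \<exists>u' \<S>'. (u has_vector_derivative u') (at t within T) \<and>
                    (\<S> has_vector_derivative \<S>') (at t within T) \<and>
                    blinfun_apply Pr u' = - (\<eta> *\<^sub>R blinfun_apply (\<S> t) Su) \<and>
                    Pr o\<^sub>L \<S>' o\<^sub>L Pr = \<eta> *\<^sub>R wedge Su (u t)))"

text \<open>During \<open>{t0..t1}\<close> the center crosses the curved part from one flat sheet to the other.\<close>

definition rounds_edge ::
    "'a::euclidean_space set \<Rightarrow> real \<Rightarrow> (real \<Rightarrow> 'a \<times> real) \<Rightarrow> real \<Rightarrow> real \<Rightarrow> bool" where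
  "rounds_edge P r a t0 t1 \<longleftrightarrow>
     t0 < t1 \<and>
     (\<exists>\<sigma>\<in>{1, -1}. a t0 \<in> P \<times> {\<sigma> * r} \<and> a t1 \<in> P \<times> {- \<sigma> * r}) \<and>
     (\<forall>t\<in>{t0<..<t1}. a t \<in> curved_part P r)"

text \<open>\<open>velocity_map \<eta> N u S u' S'\<close> relates the center velocity and tangential spin \<open>(u, S)\<close> before
  rounding the edge to \<open>(u', S')\<close> after. On \<open>u\<close> tangent to the boundary and \<open>W = S N\<close> it is
  the matrix with rows \<open>(c, s)\<close> and \<open>(s, - c)\<close>. Orientation of the unit normal \<open>N\<close>: with the
  equations of motion in \<open>rolling_motion\<close> and \<open>\<nu>\<close> pointing away from the plate, this form holds
  for \<open>N\<close> pointing out of \<open>P\<close>. For the normal pointing into \<open>P\<close>, \<open>W\<close> changes sign, so the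
  off-diagonal entries become \<open>- s\<close>; nothing else depends on the orientation.\<close>

definition velocity_map ::
    "real \<Rightarrow> 'a::euclidean_space \<Rightarrow> 'a \<Rightarrow> ('a \<Rightarrow>\<^sub>L 'a) \<Rightarrow> 'a \<Rightarrow> ('a \<Rightarrow>\<^sub>L 'a) \<Rightarrow> bool" where
  "velocity_map \<eta> N u S u' S' \<longleftrightarrow>
     (let Pr = proj_perp N; c = cos (pi * \<eta>); s = sin (pi * \<eta>) in
        skew S' \<and>
        Pr o\<^sub>L S' o\<^sub>L Pr = Pr o\<^sub>L S o\<^sub>L Pr \<and>
        u' \<bullet> N = - (u \<bullet> N) \<and>
        Pr u' = c *\<^sub>R Pr u + s *\<^sub>R S N \<and>
        S' N = s *\<^sub>R Pr u - c *\<^sub>R S N)"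

end

theory Submission
  imports Defs
begin

text \<open>Along a motion let \<open>\<nu>\<close> be the unit normal at the center, \<open>u\<close> the center velocity and \<open>S\<close> the tangential spin. The
  shape operator applied to \<open>u\<close> is \<open>- \<nu>'\<close>, so the equations of motion, completed by the derivatives of the
  constraints \<open>u \<bullet> \<nu> = 0\<close> and \<open>S \<nu> = 0\<close>, read
  \<open>u' = \<eta> S \<nu>' - (u \<bullet> \<nu>') \<nu>\<close> and \<open>S' = - \<eta> wedge \<nu>' u + wedge (S \<nu>') \<nu>\<close> (\<open>rolling_motion_normal_driven\<close>). They are linear
  in \<open>\<nu>'\<close>: what matters is the path of the normal, and for a small ball this path is nearly a half circle.

  On an exact half circle \<open>\<nu>' = \<phi>' F\<close> and \<open>F' = - \<phi>' \<nu>\<close> with a unit vector \<open>F\<close> tangent to the center surface, and the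
  system is solved by inspection (\<open>adapted_frame_derivatives\<close>): \<open>u \<bullet> F\<close> is constant, the rest of \<open>u\<close> and the vector
  \<open>S F\<close> rotate into each other with angular speed \<open>\<eta> \<phi>'\<close>, and the rest of \<open>S\<close> is constant. Over the half circle \<open>\<phi>\<close>
  decreases by \<open>\<pi>\<close> while \<open>F\<close> turns from \<open>- N\<close> to \<open>N\<close>, for the normal \<open>N\<close> pointing out of the plate. Hence the normal
  velocity changes sign, the angle of rotation is \<open>\<pi> \<eta>\<close>, and the change of sign of \<open>F\<close> turns the rotation of the
  tangential velocity and \<open>S F\<close> into the reflection of the theorem (\<open>half_turn_limits\<close>, \<open>velocity_map_explicit\<close>).

  For a radius \<open>r > 0\<close> the horizontal direction of the normal also turns while the contact point moves along the
  edge. This adds to \<open>\<nu>'\<close> and \<open>F'\<close> errors bounded by the curvature of the edge times the speed, uniformly in \<open>r\<close>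
  (\<open>frame_derivatives\<close>), while \<open>\<phi>' = (u \<bullet> F) / r\<close> is large. The quantities that are constant on the half circle
  therefore have bounded derivatives, and the crossing takes only time of order \<open>r\<close> because \<open>u \<bullet> F\<close> stays away from
  \<open>0\<close>; so they change by an amount of order \<open>r\<close> (\<open>crossing_estimates\<close>). The bound for \<open>u\<close> and \<open>S\<close> comes from conservation of
  energy, and a continuity argument keeps the contact point near the given boundary point (\<open>foot_in_ball\<close>).

  Geometry enters through the contact point, which is the unique nearest plate point and determines the normal
  (\<open>outward_normal_eq\<close>). Balls touching the plate there show that the horizontal part of the normal is
  parallel to the gradient of a defining function of the boundary (\<open>touching_ball_normal\<close>), and inverting the
  resulting parametrization of the curved part shows that the normal is differentiable there
  (\<open>normal_differentiable_on_curved_part\<close>), so that the equations of motion hold throughout the crossing.\<close>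

section \<open>The center surface and its contact points\<close>

text \<open>Points closer than \<open>r\<close> to the plate form an open set, so they are interior to the neighborhood.\<close>

lemma center_surface_infdist:
  assumes "p \<in> center_surface P r"
  shows "infdist p (P \<times> {0}) = r"
proof -
  have cl: "closed (plate_nbhd P r)"
    unfolding plate_nbhd_def by (intro closed_Collect_le continuous_intros)
  have "{p. infdist p (P \<times> {0}) < r} \<subseteq> interior (plate_nbhd P r)"
    by (intro interior_maximal open_Collect_less continuous_intros) (auto simp: plate_nbhd_def)
  then show ?thesis
    using assms cl by (force simp: center_surface_def frontier_def plate_nbhd_def)
qed

lemma dist_plate_point_ge:
  assumes "p \<in> center_surface P r" "z \<in> P"
  shows "r \<le> dist p (z, 0)"
  using infdist_le[of "(z, 0)" "P \<times> {0}" p] center_surface_infdist[OF assms(1)] assms(2) by simp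

text \<open>The ball of radius \<open>r\<close> about a plate point \<open>(z, 0)\<close> lies in the neighborhood, so along any curve in the
  center surface through \<open>p\<close> the distance to \<open>(z, 0)\<close> is minimal at \<open>p\<close>. Hence \<open>p - (z, 0)\<close> is
  orthogonal to the tangent space, and \<open>w = \<plusminus>(p - (z, 0)) / r\<close>; the sign is that for which \<open>w\<close> leaves the
  ball. In particular the nearest plate point is unique: it is where the rolling ball touches.\<close>

lemma outward_normal_eq:
  assumes p: "p \<in> center_surface P r" and r: "0 < r"
    and w: "outward_unit_normal (plate_nbhd P r) p w"
    and z: "z \<in> P" "dist p (z, 0) = r"
  shows "p - r *\<^sub>R w = (z, 0)"
proof -
  define d where "d = p - (z, 0)"
  have nd: "norm d = r" using z by (simp add: d_def dist_norm)
  have un: "norm w = 1" "tangent_space (center_surface P r) p = {v. v \<bullet> w = 0}"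
    using w by (auto simp: outward_unit_normal_def unit_normal_def center_surface_def)
  (* First-order condition at the minimum of the squared distance. *)
  have tang: "v \<bullet> d = 0" if v: "v \<bullet> w = 0" for v
  proof -
    from v un obtain g where g: "g 0 = p" "\<forall>\<^sub>F t in at (0::real). g t \<in> center_surface P r"
      "(g has_vector_derivative v) (at 0)" by (auto simp: tangent_space_def)
    let ?h = "\<lambda>t. (g t - (z, 0)) \<bullet> (g t - (z, 0))"
    have der: "(?h has_derivative (\<lambda>t. 2 * (t *\<^sub>R v \<bullet> d))) (at 0)"
      using g(3) unfolding has_vector_derivative_def
      by (auto intro!: derivative_eq_intros simp: d_def g(1) inner_commute)
    obtain e where e: "e > 0" "\<And>t. dist t 0 < e \<Longrightarrow> t \<noteq> 0 \<Longrightarrow> g t \<in> center_surface P r"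
      using g(2) unfolding eventually_at by auto
    have "?h 0 \<le> ?h t" if "t \<in> ball 0 e" for t
    proof -
      have "r \<le> norm (g t - (z, 0))"
        using dist_plate_point_ge[OF e(2) z(1)] that g(1) p z nd
        by (cases "t = 0") (auto simp: dist_norm d_def)
      then have "r\<^sup>2 \<le> (norm (g t - (z, 0)))\<^sup>2" using r by (intro power_mono) auto
      also have "r\<^sup>2 = ?h 0" using nd g(1) by (simp add: d_def flip: power2_norm_eq_inner)
      finally show ?thesis by (simp add: power2_norm_eq_inner)
    qed
    then have "(\<lambda>t. 2 * (t *\<^sub>R v \<bullet> d)) = (\<lambda>t. 0)"
      using differential_zero_maxmin[of 0 "ball 0 e" ?h "\<lambda>t. 2 * (t *\<^sub>R v \<bullet> d)"] der e(1) by auto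
    from fun_cong[OF this, of 1] show ?thesis by simp
  qed
  define c where "c = d \<bullet> w"
  have ww: "w \<bullet> w = 1" using un(1) by (simp add: dot_square_norm)
  have "(d - c *\<^sub>R w) \<bullet> w = 0" by (simp add: c_def inner_diff_left ww)
  from tang[OF this] this have "(d - c *\<^sub>R w) \<bullet> (d - c *\<^sub>R w) = 0"
    by (simp add: inner_diff_right)
  then have dc: "d = c *\<^sub>R w" by simp
  have "\<bar>c\<bar> = r" using nd un(1) dc by simp
  (* With the other sign, moving along w would stay inside the ball about (z, 0). *)
  moreover have "c \<noteq> - r"
  proof
    assume c: "c = - r"
    have "\<forall>\<^sub>F t in at_right 0. p + t *\<^sub>R w \<notin> plate_nbhd P r"
      using w by (simp add: outward_unit_normal_def)
    moreover have "\<forall>\<^sub>F t in at_right 0. t \<in> {0<..<r}"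
      using r by (rule eventually_at_right_real)
    ultimately have "\<forall>\<^sub>F t in at_right (0::real). False"
    proof eventually_elim
      case (elim t)
      have "p + t *\<^sub>R w - (z, 0) = (t - r) *\<^sub>R w" using dc c by (simp add: d_def algebra_simps)
      then have "dist (p + t *\<^sub>R w) (z, 0) = \<bar>t - r\<bar>" by (simp add: dist_norm un(1))
      then have "infdist (p + t *\<^sub>R w) (P \<times> {0}) \<le> r"
        using infdist_le[of "(z, 0)" "P \<times> {0}" "p + t *\<^sub>R w"] elim z(1) by simp
      then show ?case using elim by (simp add: plate_nbhd_def)
    qed
    then show False by simp
  qed
  ultimately have "c = r" by linarith
  then show ?thesis using dc by (simp add: d_def algebra_simps)
qed

lemma outward_normal_foot:
  assumes P: "closed P" "P \<noteq> {}" and p: "p \<in> center_surface P r" and r: "0 < r"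
    and w: "outward_unit_normal (plate_nbhd P r) p w"
  obtains z where "z \<in> P" "p - r *\<^sub>R w = (z, 0)"
proof -
  have "closed (P \<times> {0::real})" "P \<times> {0::real} \<noteq> {}" using P by (auto intro: closed_Times)
  from infdist_attains_inf[OF this, of p] obtain q where
    q: "q \<in> P \<times> {0}" "infdist p (P \<times> {0}) = dist p q" by blast
  then obtain z where z: "q = (z, 0)" "z \<in> P" by auto
  have "dist p (z, 0) = r" using q z center_surface_infdist[OF p] by simp
  from outward_normal_eq[OF p r w z(2) this] z(2) show ?thesis by (rule that[rotated])
qed

lemma flat_normal:
  assumes p: "p \<in> center_surface P r" and r: "0 < r"
    and w: "outward_unit_normal (plate_nbhd P r) p w"
    and z: "p = (z, \<sigma> * r)" "z \<in> P" "\<bar>\<sigma>\<bar> = 1"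
  shows "w = (0, \<sigma>)"
proof -
  have "dist p (z, 0) = r" using z r by (simp add: dist_Pair_Pair dist_norm abs_mult)
  from outward_normal_eq[OF p r w z(2) this] have "r *\<^sub>R w = r *\<^sub>R (0, \<sigma>)"
    using z(1) by (auto simp: prod_eq_iff)
  then show ?thesis using r by (metis less_irrefl real_vector.scale_left_imp_eq)
qed

text \<open>A vertical normal would put \<open>p\<close> at height \<open>\<plusminus>r\<close> above its contact point, on a flat sheet.\<close>

lemma curved_part_normal_not_vertical:
  assumes P: "closed P" "P \<noteq> {}" and p: "p \<in> curved_part P r" and r: "0 < r"
    and w: "outward_unit_normal (plate_nbhd P r) p w"
  shows "fst w \<noteq> 0"
proof
  assume 0: "fst w = 0"
  have pM: "p \<in> center_surface P r" using p by (simp add: curved_part_def)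
  obtain z where z: "z \<in> P" "p - r *\<^sub>R w = (z, 0)"
    using outward_normal_foot[OF P pM r w] .
  have "norm w = 1" using w by (simp add: outward_unit_normal_def unit_normal_def)
  then have "\<bar>snd w\<bar> = 1" using 0 by (cases w) simp
  then have "p = (z, r) \<or> p = (z, -r)"
    using z(2) 0 by (auto simp: prod_eq_iff abs_if split: if_splits)
  then show False using p z(1) by (auto simp: curved_part_def)
qed

text \<open>The center \<open>p\<close> has distance at least \<open>r\<close> from the plate; intersecting the ball of radius \<open>r\<close> about
  \<open>p\<close> with the plane of the plate gives, by Pythagoras, a ball in that plane with the contact point
  on its boundary.\<close>

lemma foot_ball_disjoint:
  assumes p: "p \<in> center_surface P r" and r: "0 < r" and z: "p - r *\<^sub>R w = (z, 0)" and n: "norm w = 1"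
  shows "ball (z + r *\<^sub>R fst w) (norm (r *\<^sub>R fst w)) \<inter> P = {}"
proof -
  have False if q: "q \<in> P" "dist (z + r *\<^sub>R fst w) q < norm (r *\<^sub>R fst w)" for q
  proof -
    have pe: "fst p = z + r *\<^sub>R fst w" "snd p = r * snd w"
      using z by (auto simp: prod_eq_iff algebra_simps)
    have "(norm (fst w))\<^sup>2 + (snd w)\<^sup>2 = 1"
      using n by (metis norm_prod_def norm_Pair prod.collapse one_power2 real_norm_def real_sqrt_eq_1_iff power2_abs)
    then have e: "(norm (r *\<^sub>R fst w))\<^sup>2 + (r * snd w)\<^sup>2 = r\<^sup>2"
      by (simp add: power_mult_distrib flip: distrib_left)
    have "r\<^sup>2 \<le> (dist p (q, 0))\<^sup>2"
      using dist_plate_point_ge[OF p q(1)] r by (intro power_mono) auto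
    also have "\<dots> = (dist (z + r *\<^sub>R fst w) q)\<^sup>2 + (r * snd w)\<^sup>2"
      by (cases p) (use pe in \<open>simp add: dist_norm norm_Pair\<close>)
    also have "\<dots> < (norm (r *\<^sub>R fst w))\<^sup>2 + (r * snd w)\<^sup>2"
      using q(2) by (intro add_strict_right_mono power_strict_mono) auto
    finally show False using e by simp
  qed
  then show ?thesis by (auto simp: ball_def) 
qed

lemma touching_ball_frontier:
  assumes z: "z \<in> P" and w: "w \<noteq> 0" and b: "ball (z + w) (norm w) \<inter> P = {}"
  shows "z \<in> frontier P"
proof -
  have "z \<in> closure (ball (z + w) (norm w))"
    using w by (simp add: dist_norm)
  moreover have "ball (z + w) (norm w) \<subseteq> - P" using b by auto
  ultimately have "z \<in> closure (- P)" using closure_mono by blast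
  then show ?thesis using z closure_subset by (auto simp: frontier_closures)
qed

section \<open>A unit normal field along a smooth part of the boundary\<close>

definition grad :: "('a::euclidean_space \<Rightarrow> real) \<Rightarrow> 'a \<Rightarrow> 'a" where
  "grad \<phi> y = (\<Sum>b\<in>Basis. frechet_derivative \<phi> (at y) b *\<^sub>R b)"

lemma has_derivative_grad:
  assumes "\<phi> differentiable (at y)"
  shows "(\<phi> has_derivative (\<lambda>v. grad \<phi> y \<bullet> v)) (at y)"
proof -
  let ?D = "frechet_derivative \<phi> (at y)"
  have D: "(\<phi> has_derivative ?D) (at y)" using assms by (simp add: frechet_derivative_works)
  have l: "linear ?D" using D by (rule has_derivative_linear)
  have "?D v = grad \<phi> y \<bullet> v" for v
  proof -
    have "?D v = ?D (\<Sum>b\<in>Basis. (v \<bullet> b) *\<^sub>R b)" by (simp add: euclidean_representation)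
    also have "\<dots> = (\<Sum>b\<in>Basis. (v \<bullet> b) * ?D b)" by (simp add: linear_sum[OF l] linear_scale[OF l])
    also have "\<dots> = grad \<phi> y \<bullet> v" by (simp add: grad_def inner_sum_left inner_commute[of v] mult.commute)
    finally show ?thesis .
  qed
  then have "?D = (\<lambda>v. grad \<phi> y \<bullet> v)" by blast
  then show ?thesis using D by simp
qed

text \<open>The second partial derivatives are continuous, hence bounded on a compact set.\<close>

lemma smooth_grad_local_bound:
  fixes \<phi> :: "'a::euclidean_space \<Rightarrow> real"
  assumes V: "open V" and sm: "smooth_on \<phi> V" and K: "compact K" "K \<subseteq> V"
  obtains B where "0 \<le> B" "\<And>y. y \<in> V \<Longrightarrow> grad \<phi> differentiable (at y)"
    "\<And>y v. y \<in> K \<Longrightarrow> norm (frechet_derivative (grad \<phi>) (at y) v) \<le> B * norm v"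
proof -
  let ?p = "\<lambda>b y. frechet_derivative \<phi> (at y) b"
  let ?q = "\<lambda>b c y. frechet_derivative (?p b) (at y) c"
  have C2: "C_on (Suc (Suc 0)) \<phi> V" using sm by (simp only: smooth_on_def)
  have pd: "?p b differentiable (at y)" if "y \<in> V" for b y using C2 that by simp
  have qc: "continuous_on V (?q b c)" for b c using C2 by simp
  have gd: "(grad \<phi> has_derivative (\<lambda>v. \<Sum>b\<in>Basis. frechet_derivative (?p b) (at y) v *\<^sub>R b)) (at y)"
    if "y \<in> V" for y
    unfolding grad_def using pd[OF that] frechet_derivative_works
    by (intro has_derivative_sum has_derivative_scaleR_left) blast
  have "\<exists>B. \<forall>y\<in>K. \<bar>?q b c y\<bar> \<le> B" for b c
  proof -
    have "bounded (?q b c ` K)"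
      using K qc continuous_on_subset by (intro compact_imp_bounded compact_continuous_image) blast+
    then show ?thesis by (auto simp: bounded_iff)
  qed
  then obtain Q where Q: "\<And>b c y. y \<in> K \<Longrightarrow> \<bar>?q b c y\<bar> \<le> Q b c" by metis
  define B where "B = (\<Sum>b\<in>Basis. \<Sum>c\<in>Basis. \<bar>Q b c\<bar>)"
  have bd: "norm (frechet_derivative (grad \<phi>) (at y) v) \<le> B * norm v" if y: "y \<in> K" for y v
  proof -
    have yV: "y \<in> V" using y K by blast
    have p: "\<bar>frechet_derivative (?p b) (at y) v\<bar> \<le> (\<Sum>c\<in>Basis. \<bar>Q b c\<bar>) * norm v" for b
    proof -
      have l: "linear (frechet_derivative (?p b) (at y))"
        using pd[OF yV] linear_frechet_derivative by blast
      have "frechet_derivative (?p b) (at y) v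
          = frechet_derivative (?p b) (at y) (\<Sum>c\<in>Basis. (v \<bullet> c) *\<^sub>R c)"
        by (simp add: euclidean_representation)
      also have "\<dots> = (\<Sum>c\<in>Basis. (v \<bullet> c) * ?q b c y)"
        by (simp add: linear_sum[OF l] linear_scale[OF l])
      also have "\<bar>\<dots>\<bar> \<le> (\<Sum>c\<in>Basis. \<bar>Q b c\<bar> * norm v)"
      proof (rule order_trans[OF sum_abs], rule sum_mono)
        fix c :: 'a assume "c \<in> Basis"
        then have "\<bar>v \<bullet> c\<bar> \<le> norm v" by (rule Basis_le_norm)
        moreover have "\<bar>?q b c y\<bar> \<le> \<bar>Q b c\<bar>" using Q[OF y, of b c] by linarith
        ultimately have "\<bar>v \<bullet> c\<bar> * \<bar>?q b c y\<bar> \<le> norm v * \<bar>Q b c\<bar>" by (intro mult_mono) auto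
        then show "\<bar>(v \<bullet> c) * ?q b c y\<bar> \<le> \<bar>Q b c\<bar> * norm v" by (simp add: abs_mult mult.commute)
      qed
      finally show ?thesis by (simp add: sum_distrib_right)
    qed
    have "norm (\<Sum>b\<in>Basis. frechet_derivative (?p b) (at y) v *\<^sub>R b)
        \<le> (\<Sum>b\<in>Basis. (\<Sum>c\<in>Basis. \<bar>Q b c\<bar>) * norm v)"
      by (rule order_trans[OF norm_sum], rule sum_mono) (use p in simp)
    then show ?thesis
      using fun_cong[OF frechet_derivative_at[OF gd[OF yV]], of v]
      by (simp add: B_def sum_distrib_right)
  qed
  have "0 \<le> B" by (auto simp: B_def intro!: sum_nonneg)
  then show ?thesis using bd gd by (intro that) (auto simp: differentiable_def)
qed

lemma norm_sgn_diff_le: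
  fixes a b :: "'a::real_normed_vector"
  assumes "a \<noteq> 0"
  shows "norm (sgn a - sgn b) \<le> 2 * norm (a - b) / norm a"
proof (cases "b = 0")
  case True then show ?thesis using assms by (simp add: norm_sgn)
next
  case False
  have "norm a * norm (sgn a - sgn b) = norm (norm a *\<^sub>R (sgn a - sgn b))" by simp
  also have "norm a *\<^sub>R (sgn a - sgn b) = (a - b) + (norm b - norm a) *\<^sub>R sgn b"
    using assms False by (simp add: sgn_div_norm algebra_simps)
  also have "norm \<dots> \<le> norm (a - b) + \<bar>norm b - norm a\<bar> * 1"
    using False by (intro order_trans[OF norm_triangle_ineq]) (simp add: norm_sgn)
  also have "\<dots> \<le> 2 * norm (a - b)"
    using norm_triangle_ineq3[of b a] by (simp add: norm_minus_commute)
  finally show ?thesis using assms by (simp add: field_simps)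
qed

lemma sgn_differentiable:
  fixes a :: "'a::real_inner"
  assumes "a \<noteq> 0" shows "sgn differentiable (at a)"
proof -
  have "(\<lambda>z. inverse (norm z) *\<^sub>R z) differentiable (at a)"
    using assms by (intro derivative_intros) (auto simp: differentiable_norm_at)
  moreover have "(\<lambda>z::'a. inverse (norm z) *\<^sub>R z) = sgn" by (auto simp: sgn_div_norm fun_eq_iff divide_inverse)
  ultimately show ?thesis by metis
qed

text \<open>Lets a Lipschitz bound for the normalized gradient stand in for a computation of its derivative.\<close>

lemma has_derivative_norm_le_of_Lipschitz:
  fixes g :: "'a::real_normed_vector \<Rightarrow> 'b::real_normed_vector"
  assumes d: "(g has_derivative g') (at y)" and e: "e > 0"
    and lip: "\<And>z. z \<in> ball y e \<Longrightarrow> norm (g z - g y) \<le> L * norm (z - y)"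
  shows "norm (g' v) \<le> L * norm v"
proof (cases "v = 0")
  case True then show ?thesis using has_derivative_linear[OF d] by (simp add: linear_0)
next
  case False
  have "norm (g' v) / norm v \<le> L + \<epsilon>" if ep: "0 < \<epsilon>" for \<epsilon>
  proof -
    obtain d where d0: "0 < d" "\<And>z. norm (z - y) < d \<Longrightarrow>
        norm (g z - g y - g' (z - y)) \<le> \<epsilon> * norm (z - y)"
      using d[unfolded has_derivative_at_alt] ep by metis
    define t where "t = min d e / (2 * norm v)"
    have t: "0 < t" "t * norm v < d" "t * norm v < e" using d0(1) e False by (auto simp: t_def)
    define z where "z = y + t *\<^sub>R v"
    have zy: "norm (z - y) = t * norm v" using t by (simp add: z_def)
    have "norm (g' (z - y)) \<le> norm (g z - g y) + norm (g z - g y - g' (z - y))"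
      using norm_triangle_sub[of "g' (z - y)" "g z - g y"] by (simp add: norm_minus_commute)
    also have "\<dots> \<le> L * norm (z - y) + \<epsilon> * norm (z - y)"
      using d0(2)[of z] lip[of z] zy t by (intro add_mono) (auto simp: dist_norm norm_minus_commute)
    also have "norm (g' (z - y)) = t * norm (g' v)"
      using t linear_scale[OF has_derivative_linear[OF d]] by (simp add: z_def)
    finally have "t * norm (g' v) \<le> t * ((L + \<epsilon>) * norm v)" by (simp add: zy algebra_simps)
    then show ?thesis using t False by (simp add: divide_le_eq)
  qed
  then have "norm (g' v) / norm v \<le> L" by (rule field_le_epsilon)
  then show ?thesis using False by (simp add: divide_le_eq)
qed

text \<open>The linear form \<open>G\<close> is nonnegative on an open half space bounded by the hyperplane orthogonal to \<open>w\<close>, so it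
  vanishes on that hyperplane.\<close>

lemma half_space_normal:
  fixes G w :: "'a::real_inner"
  assumes w: "w \<noteq> 0" and pos: "\<And>v. 0 < v \<bullet> w \<Longrightarrow> 0 \<le> G \<bullet> v" and G: "G \<noteq> 0"
  shows "w = norm w *\<^sub>R sgn G"
proof -
  have ww: "0 < w \<bullet> w" using w by simp
  define c where "c = (G \<bullet> w) / (w \<bullet> w)"
  define d where "d = G - c *\<^sub>R w"
  have dw: "d \<bullet> w = 0" using ww by (simp add: d_def c_def inner_diff_left)
  have "d \<bullet> d \<le> 0 + \<epsilon>" if "0 < \<epsilon>" for \<epsilon>
  proof -
    have c0: "0 \<le> G \<bullet> w" using pos ww by blast
    (* Test vectors k w - d lie in the half space and approach the tangential vector - d. *)
    define k where "k = \<epsilon> / (G \<bullet> w + 1)"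
    have k: "0 < k" "k * (G \<bullet> w) \<le> \<epsilon>" using c0 that by (auto simp: k_def field_simps)
    have "0 \<le> G \<bullet> (k *\<^sub>R w - d)"
      using k ww dw by (intro pos) (simp add: inner_diff_left)
    moreover have "G \<bullet> d = d \<bullet> d"
    proof -
      have "G \<bullet> d = (d + c *\<^sub>R w) \<bullet> d" by (simp add: d_def)
      also have "\<dots> = d \<bullet> d" using dw by (simp add: inner_add_left inner_commute[of w d])
      finally show ?thesis .
    qed
    ultimately show ?thesis using k by (simp add: inner_diff_right)
  qed
  then have "d \<bullet> d \<le> 0" by (rule field_le_epsilon)
  then have "d = 0" by (metis inner_ge_zero inner_eq_zero_iff order_antisym)
  then have Gc: "G = c *\<^sub>R w" by (simp add: d_def)
  have "0 \<le> c" using pos[OF ww] ww by (simp add: c_def)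
  then have "0 < c" using Gc G by (cases "c = 0") auto
  then show ?thesis using Gc w by (simp add: sgn_div_norm field_simps)
qed

lemma connected_nonzero_sign:
  fixes f :: "'a::topological_space \<Rightarrow> real"
  assumes I: "connected I" and f: "continuous_on I f" and nz: "\<And>t. t \<in> I \<Longrightarrow> f t \<noteq> 0"
  shows "(\<forall>t\<in>I. 0 < f t) \<or> (\<forall>t\<in>I. f t < 0)"
proof (rule ccontr)
  assume "\<not> ?thesis"
  then obtain s t where st: "s \<in> I" "t \<in> I" "f s \<le> 0" "0 \<le> f t" by (meson not_less)
  have "is_interval (f ` I)"
    using connected_continuous_image[OF f I] by (simp add: is_interval_connected_1)
  then have "0 \<in> f ` I" using st mem_is_interval_1_I[of "f ` I" "f s" "f t" 0] by blast
  then show False using nz by force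
qed

text \<open>A ball that touches the hypersurface \<open>\<phi> = 0\<close> at \<open>y\<close> and avoids it near \<open>y\<close> lies locally on one side of
  it, so \<open>\<phi>\<close> has a constant sign \<open>s\<close> there. Moving from \<open>y\<close> into the ball cannot decrease \<open>s * \<phi>\<close>, which
  forces the gradient to be parallel to the radius \<open>w\<close>.\<close>

lemma touching_ball_normal:
  fixes \<phi> :: "'a::euclidean_space \<Rightarrow> real"
  assumes V: "open V" "y \<in> V" and cont: "continuous_on V \<phi>" and d: "\<phi> differentiable (at y)"
    and y: "\<phi> y = 0" and G: "grad \<phi> y \<noteq> 0" and w: "w \<noteq> 0"
    and ne: "\<And>z. z \<in> V \<Longrightarrow> z \<in> ball (y + w) (norm w) \<Longrightarrow> \<phi> z \<noteq> 0"
  shows "w = norm w *\<^sub>R sgn (grad \<phi> y) \<or> w = - norm w *\<^sub>R sgn (grad \<phi> y)"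
proof -
  obtain e where e: "0 < e" "ball y e \<subseteq> V" using V open_contains_ball by blast
  define C where "C = ball (y + w) (norm w) \<inter> ball y e"
  have CV: "C \<subseteq> V" using e by (auto simp: C_def)
  have "convex C" by (simp add: C_def convex_Int)
  then have sgn: "(\<forall>z\<in>C. 0 < \<phi> z) \<or> (\<forall>z\<in>C. \<phi> z < 0)"
    by (intro connected_nonzero_sign convex_connected continuous_on_subset[OF cont CV])
      (use ne CV in \<open>auto simp: C_def\<close>)
  have key: "w = norm w *\<^sub>R sgn (s *\<^sub>R grad \<phi> y)" if s: "s \<noteq> 0" "\<And>z. z \<in> C \<Longrightarrow> 0 < s * \<phi> z" for s :: real
  proof (rule half_space_normal[OF w])
    show "s *\<^sub>R grad \<phi> y \<noteq> 0" using s G by simp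
    fix v assume v: "0 < v \<bullet> w"
    let ?h = "\<lambda>t. s * \<phi> (y + t *\<^sub>R v)"
    have "((\<lambda>t. y + t *\<^sub>R v) has_derivative (\<lambda>t. t *\<^sub>R v)) (at 0)"
      by (auto intro!: derivative_eq_intros)
    from has_derivative_compose[OF this, of \<phi> "\<lambda>v. grad \<phi> y \<bullet> v"]
    have "(?h has_derivative (\<lambda>t. s * (grad \<phi> y \<bullet> (t *\<^sub>R v)))) (at 0)"
      using has_derivative_grad[OF d] by (intro has_derivative_mult_right) simp
    then have D: "(?h has_real_derivative (s *\<^sub>R grad \<phi> y \<bullet> v)) (at 0)"
      by (simp add: has_field_derivative_def mult.left_commute mult_commute_abs)
    show "0 \<le> s *\<^sub>R grad \<phi> y \<bullet> v"
    proof (rule ccontr)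
      assume "\<not> ?thesis"
      with DERIV_neg_dec_right[OF D] obtain m where
        m: "0 < m" "\<And>h. 0 < h \<Longrightarrow> h < m \<Longrightarrow> ?h h < ?h 0" by auto
      have v0: "v \<noteq> 0" using v by auto
      define t where "t = min (m / 2) (min (e / (2 * norm v)) ((v \<bullet> w) / (v \<bullet> v)))"
      have t: "0 < t" "t < m" "t \<le> e / (2 * norm v)" "t \<le> (v \<bullet> w) / (v \<bullet> v)"
        using m(1) e(1) v v0 by (auto simp: t_def)
      have "t * (v \<bullet> v) \<le> v \<bullet> w" using t(4) v0 by (simp add: le_divide_eq)
      then have "t * (t * (v \<bullet> v)) \<le> t * (v \<bullet> w)" using t(1) by (intro mult_left_mono) auto
      then have "t * (t * (v \<bullet> v)) < 2 * (t * (v \<bullet> w))" using mult_pos_pos[OF t(1) v] by linarith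
      then have "(norm (t *\<^sub>R v - w))\<^sup>2 < (norm w)\<^sup>2"
        unfolding power2_norm_eq_inner by (simp add: inner_diff_left inner_diff_right inner_commute)
      then have "norm (t *\<^sub>R v - w) < norm w" using power_less_imp_less_base norm_ge_zero by blast
      moreover have "t * norm v < e"
      proof -
        have "t * norm v \<le> e / 2" using t(3) v0 by (simp add: le_divide_eq mult.commute mult.left_commute)
        then show ?thesis using e(1) by linarith
      qed
      ultimately have "y + t *\<^sub>R v \<in> C" using t(1)
        by (simp add: C_def dist_norm norm_minus_commute)
      from s(2)[OF this] m(2)[OF t(1,2)] y show False by simp
    qed
  qed
  from sgn show ?thesis
  proof
    assume "\<forall>z\<in>C. 0 < \<phi> z"
    then show ?thesis using key[of 1] by simp
  next
    assume "\<forall>z\<in>C. \<phi> z < 0"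
    then show ?thesis using key[of "-1"] by (simp add: sgn_minus)
  qed
qed


text \<open>A unit vector field \<open>g\<close> with derivative bounded by \<open>L\<close> on a ball about \<open>x\<close>, such that any ball which touches
  \<open>P\<close> from outside at a point \<open>y\<close> of that ball has its center on the line through \<open>y\<close> in direction \<open>g y\<close>.
  The side on which \<open>g\<close> points is left open: a crossing of the edge determines it.\<close>

definition normal_field_near :: "'a::euclidean_space set \<Rightarrow> 'a \<Rightarrow> real \<Rightarrow> real \<Rightarrow> ('a \<Rightarrow> 'a) \<Rightarrow> bool" where
  "normal_field_near P x \<delta> L g \<longleftrightarrow>
     (\<forall>y\<in>ball x \<delta>. norm (g y) = 1 \<and>
        (\<exists>g'. (g has_derivative g') (at y) \<and> (\<forall>v. norm (g' v) \<le> L * norm v))) \<and>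
     (\<forall>y\<in>ball x \<delta>. \<forall>w. y \<in> P \<longrightarrow> w \<noteq> 0 \<longrightarrow> ball (y + w) (norm w) \<inter> P = {} \<longrightarrow>
        w = norm w *\<^sub>R g y \<or> w = - norm w *\<^sub>R g y)"

text \<open>Differentiate \<open>\<phi> \<circ> c = 0\<close> along a curve \<open>c\<close> in \<open>M\<close>.\<close>

lemma tangent_space_frontier_grad:
  assumes V: "open V" "x \<in> V" and d: "\<phi> differentiable (at x)"
    and M: "M \<inter> V = {y \<in> V. \<phi> y = 0}" and v: "v \<in> tangent_space M x"
  shows "grad \<phi> x \<bullet> v = 0"
proof -
  from v obtain c where c: "c 0 = x" "\<forall>\<^sub>F t in at (0::real). c t \<in> M"
    "(c has_vector_derivative v) (at 0)" by (auto simp: tangent_space_def)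
  have "(c \<longlongrightarrow> x) (at 0)"
    using has_vector_derivative_continuous[OF c(3)] c(1) by (simp add: continuous_within)
  then have "\<forall>\<^sub>F t in at 0. c t \<in> V" using V by (rule topological_tendstoD)
  with c(2) have ev: "\<forall>\<^sub>F t in at 0. \<phi> (c t) = 0"
    by eventually_elim (use M in blast)
  have x0: "\<phi> (c 0) = 0"
  proof -
    have "((\<lambda>t. \<phi> (c t)) \<longlongrightarrow> \<phi> x) (at 0)"
      using \<open>(c \<longlongrightarrow> x) (at 0)\<close> differentiable_imp_continuous_within[OF d]
      by (intro isCont_tendsto_compose[of x \<phi>])
    moreover have "((\<lambda>t. \<phi> (c t)) \<longlongrightarrow> 0) (at 0)" using ev by (rule tendsto_eventually)
    ultimately show ?thesis using c(1) tendsto_unique[of "at (0::real)"] by auto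
  qed
  have "((\<lambda>t. \<phi> (c t)) has_derivative (\<lambda>t. grad \<phi> x \<bullet> (t *\<^sub>R v))) (at 0)"
    using has_derivative_compose[OF c(3)[unfolded has_vector_derivative_def], of \<phi>
      "\<lambda>v. grad \<phi> x \<bullet> v"] has_derivative_grad[OF d] c(1) by simp
  moreover have "((\<lambda>t. \<phi> (c t)) has_derivative (\<lambda>t. 0)) (at 0)"
    by (rule has_derivative_transform_eventually[OF has_derivative_const])
       (use ev x0 in \<open>auto elim: eventually_mono\<close>)
  ultimately have "(\<lambda>t. grad \<phi> x \<bullet> (t *\<^sub>R v)) = (\<lambda>t. 0)" by (rule has_derivative_unique)
  from fun_cong[OF this, of 1] show ?thesis by simp
qed

text \<open>The field is the normalized gradient of a local defining function, with the sign that makes it \<open>N\<close> at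
  \<open>x\<close>; compactness of a small closed ball about \<open>x\<close> bounds its derivative.\<close>

lemma smooth_part_normal_field:
  assumes P: "closed P" and x: "x \<in> smooth_part (frontier P)" and N: "unit_normal (frontier P) x N"
  obtains \<delta> L g where "0 < \<delta>" "0 \<le> L" "g x = N" "normal_field_near P x \<delta> L g"
proof -
  obtain V \<phi> where V: "open V" "x \<in> V" and df: "defining_function \<phi> V"
    and M: "frontier P \<inter> V = {y \<in> V. \<phi> y = 0}"
    using x by (auto simp: smooth_part_def)
  have sm: "smooth_on \<phi> V" using df by (simp add: defining_function_def)
  have dphi: "\<phi> differentiable (at y)" if "y \<in> V" for y
  proof -
    have "C_on (Suc 0) \<phi> V" using sm by (simp only: smooth_on_def)
    then show ?thesis using that by simp
  qed
  have cphi: "continuous_on V \<phi>"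
    using dphi by (simp add: continuous_on_eq_continuous_at V differentiable_imp_continuous_within)
  have nz: "grad \<phi> y \<noteq> 0" if "y \<in> V" for y
  proof -
    have "\<exists>v. frechet_derivative \<phi> (at y) v \<noteq> 0"
      using df that unfolding defining_function_def by blast
    then obtain v where "frechet_derivative \<phi> (at y) v \<noteq> 0" ..
    then have "grad \<phi> y \<bullet> v \<noteq> 0"
      using fun_cong[OF frechet_derivative_at[OF has_derivative_grad[OF dphi[OF that]]], of v] by simp
    then show ?thesis by auto
  qed
  define G where "G = grad \<phi>"
  have xx: "N \<bullet> N = 1" "norm N = 1" using N by (auto simp: unit_normal_def dot_square_norm)
  define s where "s = sgn (G x \<bullet> N)"
  have GN: "G x = (G x \<bullet> N) *\<^sub>R N"
  proof -
    define v where "v = G x - (G x \<bullet> N) *\<^sub>R N"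
    have "v \<bullet> N = 0" using xx by (simp add: v_def inner_diff_left)
    then have "v \<in> tangent_space (frontier P) x" using N by (simp add: unit_normal_def)
    then have "G x \<bullet> v = 0"
      using tangent_space_frontier_grad[OF V dphi[OF V(2)] M] by (simp add: G_def)
    then have "v \<bullet> v = 0" using \<open>v \<bullet> N = 0\<close> by (simp add: v_def inner_diff_left inner_commute)
    then show ?thesis by (simp add: v_def)
  qed
  have "G x \<bullet> N \<noteq> 0" using GN nz[OF V(2)] by (auto simp: G_def)
  then have s: "s = 1 \<or> s = -1" by (auto simp: s_def sgn_if)
  define g where "g = (\<lambda>y. s *\<^sub>R sgn (G y))"
  have gx: "g x = N"
  proof -
    have "sgn (G x) = sgn (G x \<bullet> N) *\<^sub>R N" by (subst GN) (simp add: sgn_scaleR sgn_div_norm xx)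
    then show ?thesis using s by (auto simp: g_def s_def)
  qed
  obtain e0 where e0: "0 < e0" "cball x e0 \<subseteq> V" using V open_contains_cball by blast
  obtain B where B: "0 \<le> B" "\<And>y. y \<in> V \<Longrightarrow> G differentiable (at y)"
    "\<And>y v. y \<in> cball x e0 \<Longrightarrow> norm (frechet_derivative G (at y) v) \<le> B * norm v"
    using smooth_grad_local_bound[OF V(1) sm compact_cball e0(2)] unfolding G_def by blast
  have lipG: "norm (G z - G y) \<le> B * norm (z - y)" if "y \<in> cball x e0" "z \<in> cball x e0" for y z
  proof (rule differentiable_bound[of "cball x e0" G "\<lambda>y. frechet_derivative G (at y)"])
    fix y assume y: "y \<in> cball x e0"
    then show "(G has_derivative frechet_derivative G (at y)) (at y within cball x e0)"
      using B(2) e0(2) frechet_derivative_works has_derivative_at_withinI by blast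
    show "onorm (frechet_derivative G (at y)) \<le> B" using B(3)[OF y] by (rule onorm_le)
  qed (use that in auto)
  have "compact (G ` cball x e0)"
    using B(2) e0(2) by (intro compact_continuous_image compact_cball continuous_at_imp_continuous_on)
      (auto intro!: differentiable_imp_continuous_within)
  moreover have "0 \<notin> G ` cball x e0" using nz e0(2) by (auto simp: G_def)
  ultimately obtain m where m: "0 < m" "\<And>y. y \<in> cball x e0 \<Longrightarrow> m \<le> norm (G y)"
    using separate_point_closed[of "G ` cball x e0" 0] compact_imp_closed[of "G ` cball x e0"]
    by auto
  define L where "L = 2 * B / m"
  have lipg: "norm (g z - g y) \<le> L * norm (z - y)" if "y \<in> cball x e0" "z \<in> cball x e0" for y z
  proof -
    have "g z - g y = s *\<^sub>R (sgn (G z) - sgn (G y))" by (simp add: g_def scaleR_diff_right)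
    then have "norm (g z - g y) = norm (sgn (G z) - sgn (G y))" using s by auto
    also have "\<dots> \<le> 2 * norm (G z - G y) / norm (G z)"
      using m that by (intro norm_sgn_diff_le) force
    also have "\<dots> \<le> 2 * (B * norm (z - y)) / m"
      using m that lipG by (intro frac_le mult_left_mono) (auto simp: B(1))
    finally show ?thesis by (simp add: L_def)
  qed
  have "normal_field_near P x e0 L g"
    unfolding normal_field_near_def
  proof (intro conjI ballI allI impI)
    fix y assume y: "y \<in> ball x e0"
    then have yV: "y \<in> V" using e0 by auto
    have G0: "G y \<noteq> 0" using nz[OF yV] by (simp add: G_def)
    show "norm (g y) = 1" using G0 s by (auto simp: g_def norm_sgn)
    have "(sgn \<circ> G) differentiable (at y)"
      using B(2)[OF yV] sgn_differentiable[OF G0]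
      by (intro differentiable_chain_at)
    then have "g differentiable (at y)" by (simp add: g_def o_def)
    then obtain g' where g': "(g has_derivative g') (at y)" by (auto simp: differentiable_def)
    obtain e where e: "0 < e" "ball y e \<subseteq> ball x e0" using openE[OF open_ball y] .
    have "norm (g' v) \<le> L * norm v" for v
      using e y by (intro has_derivative_norm_le_of_Lipschitz[OF g' e(1)] lipg) auto
    then show "\<exists>g'. (g has_derivative g') (at y) \<and> (\<forall>v. norm (g' v) \<le> L * norm v)"
      using g' by blast
    fix w assume w: "y \<in> P" "w \<noteq> 0" "ball (y + w) (norm w) \<inter> P = {}"
    have "frontier P \<subseteq> P" using P by (simp add: frontier_subset_eq)
    then have ne: "\<phi> z \<noteq> 0" if "z \<in> V" "z \<in> ball (y + w) (norm w)" for z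
      using that M w(3) by blast
    have "\<phi> y = 0" using touching_ball_frontier[OF w] M yV by blast
    from touching_ball_normal[OF V(1) yV cphi dphi[OF yV] this nz[OF yV] w(2) ne]
    show "w = norm w *\<^sub>R g y \<or> w = - norm w *\<^sub>R g y"
      using s by (auto simp: g_def G_def)
  qed
  moreover have "0 \<le> L" using B(1) m(1) by (simp add: L_def)
  ultimately show ?thesis using e0(1) gx that by blast
qed

section \<open>Differentiability of the normal of the center surface\<close>

lemma
  assumes "normal_field_near P x \<delta> L g" "y \<in> ball x \<delta>"
  shows normal_field_near_norm: "norm (g y) = 1"
    and normal_field_near_deriv: "\<exists>g'. (g has_derivative g') (at y) \<and> (\<forall>v. norm (g' v) \<le> L * norm v)"
    and normal_field_near_touching: "y \<in> P \<Longrightarrow> w \<noteq> 0 \<Longrightarrow> ball (y + w) (norm w) \<inter> P = {} \<Longrightarrow>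
      w = norm w *\<^sub>R g y \<or> w = - norm w *\<^sub>R g y"
  using assms unfolding normal_field_near_def by (simp_all del: mem_ball)

lemma normal_field_near_Lipschitz:
  assumes g: "normal_field_near P x \<delta> L g" and yz: "y \<in> ball x \<delta>" "z \<in> ball x \<delta>"
  shows "norm (g z - g y) \<le> L * norm (z - y)"
proof -
  obtain G where G: "\<And>y. y \<in> ball x \<delta> \<Longrightarrow> (g has_derivative G y) (at y)"
    "\<And>y v. y \<in> ball x \<delta> \<Longrightarrow> norm (G y v) \<le> L * norm v"
    using normal_field_near_deriv[OF g] by metis
  show ?thesis
    by (rule differentiable_bound[of "ball x \<delta>" g G])
      (use G yz in \<open>auto intro: has_derivative_at_withinI onorm_le\<close>)
qed

text \<open>The horizontal part of the normal is a radius of the disjoint ball touching the plate at the contact point.\<close>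

lemma foot_normal:
  assumes P: "closed P" "P \<noteq> {}" and r: "0 < r" and q: "q \<in> center_surface P r"
    and w: "outward_unit_normal (plate_nbhd P r) q w" and w0: "fst w \<noteq> 0"
    and g: "normal_field_near P x \<delta> L g" and y: "fst (q - r *\<^sub>R w) \<in> ball x \<delta>"
  shows "fst w = norm (fst w) *\<^sub>R g (fst (q - r *\<^sub>R w)) \<or>
    fst w = - norm (fst w) *\<^sub>R g (fst (q - r *\<^sub>R w))"
proof -
  have n: "norm w = 1" using w by (simp add: outward_unit_normal_def unit_normal_def)
  obtain z where z: "z \<in> P" "q - r *\<^sub>R w = (z, 0)"
    using outward_normal_foot[OF P q r w] .
  have "r *\<^sub>R fst w \<noteq> 0" using r w0 by simp
  moreover have "z \<in> ball x \<delta>" using y z(2) by simp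
  ultimately have "r *\<^sub>R fst w = norm (r *\<^sub>R fst w) *\<^sub>R g z \<or> r *\<^sub>R fst w = - norm (r *\<^sub>R fst w) *\<^sub>R g z"
    using normal_field_near_touching[OF g _ z(1)] foot_ball_disjoint[OF q r z(2) n] by blast
  then have "r *\<^sub>R fst w = r *\<^sub>R (norm (fst w) *\<^sub>R g z) \<or> r *\<^sub>R fst w = r *\<^sub>R (- norm (fst w) *\<^sub>R g z)"
    using r by simp
  then show ?thesis using r z by (simp only: fst_conv) (metis less_irrefl real_vector.scale_left_imp_eq)
qed

text \<open>A point of the curved part of the center surface with contact point \<open>y\<close> and height \<open>z\<close> is
  \<open>(y \<plusminus> sqrt (r\<^sup>2 - z\<^sup>2) * g y, z)\<close>. For arbitrary \<open>y\<close> near \<open>x\<close> this formula defines a map \<open>\<Phi>\<close> between open sets of the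
  ambient space, and since \<open>g\<close> has Lipschitz constant less than \<open>1 / r\<close> it is a perturbation of the identity in
  \<open>y\<close>: \<open>\<Phi>\<close> is injective with invertible derivative, so it has a left inverse that is differentiable at the given
  point.\<close>

lemma tube_chart_inverse:
  fixes g :: "'a::euclidean_space \<Rightarrow> 'a"
  assumes g: "normal_field_near P x \<delta> L g" and r: "0 < r" "r * L < 1"
    and e: "\<bar>\<epsilon>\<bar> = 1" and y: "y \<in> ball x \<delta>" and z: "\<bar>z\<bar> < r"
  defines "\<Phi> \<equiv> (\<lambda>s. (fst s + (\<epsilon> * sqrt (r\<^sup>2 - (snd s)\<^sup>2)) *\<^sub>R g (fst s), snd s))"
  obtains \<Psi> where "\<Psi> differentiable (at (\<Phi> (y, z)))"
    "\<And>s. fst s \<in> ball x \<delta> \<Longrightarrow> \<bar>snd s\<bar> < r \<Longrightarrow> \<Psi> (\<Phi> s) = s"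
proof -
  define S where "S = ball x \<delta> \<times> {-r<..<r}"
  define c where "c = (\<lambda>s::real. \<epsilon> * sqrt (r\<^sup>2 - s\<^sup>2))"
  have c_le: "\<bar>c s\<bar> \<le> r" if "\<bar>s\<bar> < r" for s
  proof -
    have "s\<^sup>2 \<le> r\<^sup>2" using that r by (metis abs_of_pos less_imp_le abs_le_square_iff)
    moreover have "sqrt (r\<^sup>2 - s\<^sup>2) \<le> sqrt (r\<^sup>2)" by (simp del: real_sqrt_abs)
    then have "sqrt (r\<^sup>2 - s\<^sup>2) \<le> r" using r by simp
    ultimately show ?thesis using e by (simp add: c_def abs_mult)
  qed
  have \<Phi>: "\<Phi> s = (fst s + c (snd s) *\<^sub>R g (fst s), snd s)" for s
    by (simp add: \<Phi>_def c_def)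
  have inj: "inj_on \<Phi> S"
  proof (rule inj_onI)
    fix s t assume st: "s \<in> S" "t \<in> S" "\<Phi> s = \<Phi> t"
    then have eq: "snd s = snd t" "fst s - fst t = c (snd s) *\<^sub>R (g (fst t) - g (fst s))"
      by (auto simp: \<Phi> algebra_simps)
    have "norm (fst s - fst t) = \<bar>c (snd s)\<bar> * norm (g (fst t) - g (fst s))" by (subst eq(2)) simp
    also have "\<dots> \<le> r * (L * norm (fst s - fst t))"
      using st normal_field_near_Lipschitz[OF g, of "fst s" "fst t"] r
      by (intro mult_mono c_le) (auto simp: S_def norm_minus_commute abs_less_iff)
    finally have "(1 - r * L) * norm (fst s - fst t) \<le> 0" by (simp add: algebra_simps)
    then have "fst s = fst t" using r(2) by (simp add: mult_le_0_iff)
    with eq(1) show "s = t" by (simp add: prod_eq_iff)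
  qed
  have c': "\<exists>k. (c has_real_derivative k) (at s)" if "\<bar>s\<bar> < r" for s
  proof -
    have "\<bar>s\<bar>\<^sup>2 < r\<^sup>2" using that by (intro power_strict_mono) auto
    then have "0 < r\<^sup>2 - s\<^sup>2" by simp
    then have "(c has_real_derivative (\<epsilon> * (- s / sqrt (r\<^sup>2 - s\<^sup>2)))) (at s)"
      unfolding c_def by (auto intro!: derivative_eq_intros simp: field_simps)
    then show ?thesis by blast
  qed
  have der: "\<exists>\<Phi>'. (\<Phi> has_derivative \<Phi>') (at s) \<and> inj \<Phi>'" if s: "s \<in> S" for s
  proof -
    obtain k where k: "(c has_real_derivative k) (at (snd s))"
      using c'[of "snd s"] s by (auto simp: S_def abs_less_iff)
    obtain g' where g': "(g has_derivative g') (at (fst s))" "\<And>v. norm (g' v) \<le> L * norm v"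
      using normal_field_near_deriv[OF g, of "fst s"] s by (auto simp: S_def)
    have 1: "((\<lambda>s. c (snd s)) has_derivative (\<lambda>h. k * snd h)) (at s)"
      using has_derivative_compose[of snd snd s UNIV c "(*) k"] k
      by (simp add: has_field_derivative_def has_derivative_snd)
    have 2: "((\<lambda>s. g (fst s)) has_derivative (\<lambda>h. g' (fst h))) (at s)"
      using has_derivative_compose[of fst fst s UNIV g g'] g' by (simp add: has_derivative_fst)
    let ?D = "\<lambda>h. (fst h + (c (snd s) *\<^sub>R g' (fst h) + (k * snd h) *\<^sub>R g (fst s)), snd h)"
    have D: "(\<Phi> has_derivative ?D) (at s)"
      unfolding \<Phi>[abs_def]
      by (intro has_derivative_Pair has_derivative_add has_derivative_scaleR 1 2
            has_derivative_fst has_derivative_snd has_derivative_ident)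
    have "inj ?D"
    proof -
      have "h = 0" if h: "?D h = 0" for h
      proof -
        have h2: "snd h = 0" using h by (simp add: prod_eq_iff)
        then have "fst h = - (c (snd s) *\<^sub>R g' (fst h))"
          using h by (simp add: prod_eq_iff add_eq_0_iff2)
        then have "norm (fst h) = \<bar>c (snd s)\<bar> * norm (g' (fst h))" by (metis norm_minus_cancel norm_scaleR)
        also have "\<dots> \<le> r * (L * norm (fst h))" using r s by (intro mult_mono c_le g') (auto simp: S_def abs_less_iff)
        finally have "(1 - r * L) * norm (fst h) \<le> 0" by (simp add: algebra_simps)
        then have "fst h = 0" using r(2) by (simp add: mult_le_0_iff)
        with h2 show ?thesis by (simp add: prod_eq_iff)
      qed
      then show ?thesis unfolding linear_injective_0[OF has_derivative_linear[OF D]] by blast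
    qed
    with D show ?thesis by blast
  qed
  have S: "open S" "(y, z) \<in> S" using y z by (auto simp: S_def open_Times)
  obtain \<Phi>' where \<Phi>': "(\<Phi> has_derivative \<Phi>') (at (y, z))" "inj \<Phi>'" using der[OF S(2)] by blast
  obtain \<Psi>' where "\<And>h. \<Phi>' (\<Psi>' h) = h"
    using linear_injective_isomorphism[OF has_derivative_linear[OF \<Phi>'(1)] \<Phi>'(2)] by blast
  then have "\<Phi>' \<circ> \<Psi>' = id" by auto
  moreover have "continuous_on S \<Phi>"
    using der by (meson continuous_at_imp_continuous_on has_derivative_continuous)
  ultimately have "(inv_into S \<Phi> has_derivative \<Psi>') (at (\<Phi> (y, z)))"
    using S \<Phi>'(1) inj by (intro has_derivative_inverse_strong[of S "(y, z)" \<Phi>]) auto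
  then show ?thesis
    using inj by (intro that[of "inv_into S \<Phi>"]) (auto simp: differentiable_def S_def abs_less_iff intro!: inv_into_f_f)
qed

text \<open>Near \<open>p\<close> the horizontal part of the normal is a multiple of \<open>g\<close> at the contact point with a factor of constant
  sign, so the contact point is the first component of the inverse chart. That inverse is differentiable,
  and the normal is \<open>(p - contact point) / r\<close>. Consequently the equations of motion hold at every instant of a
  crossing whose contact point stays near \<open>x\<close>.\<close>

lemma normal_differentiable_on_curved_part:
  fixes P :: "'a::euclidean_space set"
  assumes P: "closed P" "P \<noteq> {}" and r: "0 < r" "r * L < 1"
    and nu: "piecewise_smooth_normal_field P r \<nu>"
    and g: "normal_field_near P x \<delta> L g"
    and p: "p \<in> curved_part P r" and y: "fst (p - r *\<^sub>R \<nu> p) \<in> ball x \<delta>"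
  shows "\<nu> differentiable (at p within center_surface P r)"
proof -
  let ?M = "center_surface P r"
  have out: "outward_unit_normal (plate_nbhd P r) q (\<nu> q)" if "q \<in> ?M" for q
    using nu that by (simp add: piecewise_smooth_normal_field_def)
  have pM: "p \<in> ?M" using p by (simp add: curved_part_def)
  define Y where "Y = (\<lambda>q. fst (q - r *\<^sub>R \<nu> q))"
  define h where "h = (\<lambda>q. fst (\<nu> q) \<bullet> g (Y q))"
  have wp: "fst (\<nu> p) \<noteq> 0" using curved_part_normal_not_vertical[OF P p r(1) out[OF pM]] .
  have g1: "norm (g y) = 1" if "y \<in> ball x \<delta>" for y using g that by (simp add: normal_field_near_def)
  have cnu: "(\<nu> \<longlongrightarrow> \<nu> p) (at p within ?M)"
    using nu pM by (simp add: piecewise_smooth_normal_field_def continuous_on_def)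
  have cY: "(Y \<longlongrightarrow> Y p) (at p within ?M)"
    unfolding Y_def by (intro tendsto_intros cnu)
  obtain g' where "(g has_derivative g') (at (Y p))"
    using normal_field_near_deriv[OF g y] by (auto simp: Y_def)
  then have "isCont g (Y p)" by (rule has_derivative_continuous)
  then have ch: "(h \<longlongrightarrow> h p) (at p within ?M)"
    unfolding h_def by (intro tendsto_intros cnu isCont_tendsto_compose[OF _ cY])
  have h_cases: "fst (\<nu> q) = norm (fst (\<nu> q)) *\<^sub>R g (Y q) \<or> fst (\<nu> q) = - norm (fst (\<nu> q)) *\<^sub>R g (Y q)"
    if "q \<in> ?M" "fst (\<nu> q) \<noteq> 0" "Y q \<in> ball x \<delta>" for q
    using foot_normal[OF P r(1) that(1) out[OF that(1)] that(2) g] that(3) by (simp add: Y_def)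
  have h_val: "fst (\<nu> q) = h q *\<^sub>R g (Y q)" "\<bar>h q\<bar> = norm (fst (\<nu> q))"
    if "q \<in> ?M" "fst (\<nu> q) \<noteq> 0" "Y q \<in> ball x \<delta>" for q
  proof -
    have gg: "g (Y q) \<bullet> g (Y q) = 1" using g1[OF that(3)] by (simp add: dot_square_norm)
    from h_cases[OF that] obtain k where k: "fst (\<nu> q) = k *\<^sub>R g (Y q)" "\<bar>k\<bar> = norm (fst (\<nu> q))"
      by (metis abs_minus_cancel abs_norm_cancel)
    have "h q = k" unfolding h_def k(1) by (simp add: gg)
    then show "fst (\<nu> q) = h q *\<^sub>R g (Y q)" "\<bar>h q\<bar> = norm (fst (\<nu> q))" using k by simp_all
  qed
  have hp: "h p \<noteq> 0" using h_val[OF pM wp] y wp by (auto simp: Y_def)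
  define \<epsilon> where "\<epsilon> = sgn (h p)"
  have e: "\<bar>\<epsilon>\<bar> = 1" using hp by (simp add: \<epsilon>_def abs_sgn_eq)
  have chart: "(Y q + (\<epsilon> * sqrt (r\<^sup>2 - (snd q)\<^sup>2)) *\<^sub>R g (Y q), snd q) = q \<and> \<bar>snd q\<bar> < r"
    if q: "q \<in> ?M" "fst (\<nu> q) \<noteq> 0" "Y q \<in> ball x \<delta>" "0 < \<epsilon> * h q" for q
  proof -
    obtain z where z: "z \<in> P" "q - r *\<^sub>R \<nu> q = (z, 0)"
      using outward_normal_foot[OF P q(1) r(1) out[OF q(1)]] .
    have qe: "fst q = Y q + r *\<^sub>R fst (\<nu> q)" "snd q = r * snd (\<nu> q)"
      using z(2) by (auto simp: Y_def prod_eq_iff algebra_simps)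
    have "norm (\<nu> q) = 1" using out[OF q(1)] by (simp add: outward_unit_normal_def unit_normal_def)
    then have "sqrt ((norm (fst (\<nu> q)))\<^sup>2 + (snd (\<nu> q))\<^sup>2) = 1"
      by (metis norm_Pair prod.collapse power2_abs real_norm_def)
    then have n1: "(norm (fst (\<nu> q)))\<^sup>2 + (snd (\<nu> q))\<^sup>2 = 1" by simp
    have "r\<^sup>2 - (snd q)\<^sup>2 = r\<^sup>2 * (1 - (snd (\<nu> q))\<^sup>2)" by (simp add: qe power_mult_distrib algebra_simps)
    also have "\<dots> = (r * norm (fst (\<nu> q)))\<^sup>2" using n1 by (simp add: power_mult_distrib)
    finally have sq: "r\<^sup>2 - (snd q)\<^sup>2 = (r * norm (fst (\<nu> q)))\<^sup>2" .
    then have "sqrt (r\<^sup>2 - (snd q)\<^sup>2) = r * norm (fst (\<nu> q))" using r by simp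
    moreover have "\<epsilon> * norm (fst (\<nu> q)) = h q"
      using h_val(2)[OF q(1-3)] q(4) e by (cases "0 \<le> \<epsilon>") (simp_all flip: h_val(2)[OF q(1-3)])
    ultimately have "\<epsilon> * sqrt (r\<^sup>2 - (snd q)\<^sup>2) = r * h q" by (simp add: mult.left_commute)
    moreover have "0 < (r * norm (fst (\<nu> q)))\<^sup>2" using r q(2) by simp
    then have "\<bar>snd q\<bar>\<^sup>2 < r\<^sup>2" unfolding sq[symmetric] by simp
    then have "\<bar>snd q\<bar> < r" using r(1) by (meson less_imp_le power_less_imp_less_base)
    ultimately show ?thesis using h_val(1)[OF q(1-3)] qe(1) by (simp add: prod_eq_iff)
  qed
  have pc: "0 < \<epsilon> * h p" using hp by (simp add: \<epsilon>_def sgn_if)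
  have yp: "Y p \<in> ball x \<delta>" using y by (simp add: Y_def)
  note chp = chart[OF pM wp yp pc]
  obtain \<Psi> where \<Psi>: "\<Psi> differentiable (at p)"
    "\<And>s. fst s \<in> ball x \<delta> \<Longrightarrow> \<bar>snd s\<bar> < r \<Longrightarrow>
      \<Psi> (fst s + (\<epsilon> * sqrt (r\<^sup>2 - (snd s)\<^sup>2)) *\<^sub>R g (fst s), snd s) = s"
    using tube_chart_inverse[OF g r e yp conjunct2[OF chp]] chp by auto
  have nu_eq: "(1 / r) *\<^sub>R (q - (fst (\<Psi> q), 0)) = \<nu> q"
    if q: "q \<in> ?M" "fst (\<nu> q) \<noteq> 0" "Y q \<in> ball x \<delta>" "0 < \<epsilon> * h q" for q
  proof -
    obtain z where z: "z \<in> P" "q - r *\<^sub>R \<nu> q = (z, 0)"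
      using outward_normal_foot[OF P q(1) r(1) out[OF q(1)]] .
    have "\<Psi> q = (Y q, snd q)" using \<Psi>(2)[of "(Y q, snd q)"] chart[OF q] q(3) by simp
    moreover have "Y q = z" using z by (simp only: Y_def fst_conv)
    ultimately have "(fst (\<Psi> q), 0) = q - r *\<^sub>R \<nu> q" using z by simp
    then show ?thesis using r by simp
  qed
  have "\<forall>\<^sub>F q in at p within ?M. q \<in> ?M" by (simp add: eventually_at_filter)
  moreover have "\<forall>\<^sub>F q in at p within ?M. fst (\<nu> q) \<noteq> 0"
    using tendsto_imp_eventually_ne[OF tendsto_fst[OF cnu] wp] .
  moreover have "\<forall>\<^sub>F q in at p within ?M. Y q \<in> ball x \<delta>"
    using topological_tendstoD[OF cY open_ball yp] .
  moreover have "\<forall>\<^sub>F q in at p within ?M. 0 < \<epsilon> * h q"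
    by (rule order_tendstoD(1)[OF tendsto_mult_left[OF ch] pc])
  ultimately have ev: "\<forall>\<^sub>F q in at p within ?M. (1 / r) *\<^sub>R (q - (fst (\<Psi> q), 0)) = \<nu> q"
    by eventually_elim (rule nu_eq)
  obtain \<Psi>' where "(\<Psi> has_derivative \<Psi>') (at p within ?M)"
    using differentiable_at_withinI[OF \<Psi>(1)] by (auto simp: differentiable_def)
  then have "((\<lambda>q. (1 / r) *\<^sub>R (q - (fst (\<Psi> q), 0))) has_derivative
      (\<lambda>v. (1 / r) *\<^sub>R (v - (fst (\<Psi>' v), 0)))) (at p within ?M)"
    by (intro has_derivative_scaleR_right has_derivative_diff has_derivative_ident
          has_derivative_Pair has_derivative_fst has_derivative_const)
  from has_derivative_transform_eventually[OF this ev nu_eq[OF pM wp yp pc] pM]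
  show ?thesis by (auto simp: differentiable_def)
qed

section \<open>The equations of motion as a system driven by the normal\<close>

lemma norm_increment_le:
  fixes f :: "real \<Rightarrow> 'a::real_inner"
  assumes ab: "a \<le> b" and c: "continuous_on {a..b} f"
    and d: "\<And>t. t \<in> {a<..<b} \<Longrightarrow> \<exists>D. (f has_vector_derivative D) (at t) \<and> norm D \<le> K"
  shows "norm (f b - f a) \<le> K * (b - a)"
proof (cases "a = b")
  case True then show ?thesis by simp
next
  case False
  then have "a < b" using ab by simp
  obtain D where D: "\<And>t. t \<in> {a<..<b} \<Longrightarrow> (f has_vector_derivative D t) (at t) \<and> norm (D t) \<le> K"
    using d by metis
  have "\<exists>t\<in>{a<..<b}. norm (f b - f a) \<le> norm ((b - a) *\<^sub>R D t)"
    using mvt_general[OF \<open>a < b\<close> c, of "\<lambda>t h. h *\<^sub>R D t"] D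
    by (auto simp: has_vector_derivative_def)
  then obtain t where t: "t \<in> {a<..<b}" "norm (f b - f a) \<le> (b - a) * norm (D t)" using ab by auto
  note t(2)
  also have "(b - a) * norm (D t) \<le> (b - a) * K" using D[OF t(1)] ab by (intro mult_left_mono) auto
  finally show ?thesis by (simp add: mult.commute)
qed

lemma has_vector_derivative_at_interior:
  "t \<in> {a<..<b} \<Longrightarrow> {a<..<b} \<subseteq> T \<Longrightarrow> (f has_vector_derivative D) (at t within T) \<Longrightarrow>
    (f has_vector_derivative D) (at t)"
  using has_vector_derivative_within_open[OF _ open_greaterThanLessThan]
    has_vector_derivative_within_subset by blast

lemma blinfun_skew_left: "skew A \<Longrightarrow> blinfun_apply A v \<bullet> w = - (blinfun_apply A w \<bullet> v)"
  using inner_commute[of v "A w"] unfolding skew_def by simp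

lemma blinfun_skew_self: "skew A \<Longrightarrow> blinfun_apply A v \<bullet> v = 0"
  using blinfun_skew_left[of A v v] by linarith

lemma skew_tangential_spin:
  assumes "skew U" shows "skew (tangential_spin r \<eta> w U)"
proof -
  have Q: "proj_perp w v \<bullet> v' = v \<bullet> proj_perp w v'" for v v'
    by (simp add: proj_perp_apply inner_diff_left inner_diff_right inner_commute)
  show ?thesis
    using assms unfolding skew_def tangential_spin_def
    by (simp add: Q blinfun.scaleR_left)
qed

lemma tangential_spin_normal: "norm w = 1 \<Longrightarrow> blinfun_apply (tangential_spin r \<eta> w U) w = 0"
  by (simp add: tangential_spin_def proj_perp_apply blinfun.bilinear_simps dot_square_norm)

lemma continuous_on_tangential_spin:
  assumes "continuous_on T w" "continuous_on T U"
  shows "continuous_on T (\<lambda>t. tangential_spin r \<eta> (w t) (U t))"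
  unfolding tangential_spin_def proj_perp_def
  by (intro continuous_intros assms bounded_bilinear.continuous_on[OF bounded_bilinear_blinfun_compose]
      bounded_linear.continuous_on[OF bounded_linear_blinfun_scaleR_left]
      bounded_linear.continuous_on[OF bounded_linear_blinfun_inner_left])

text \<open>The equations of motion with the curvature of the center surface eliminated: if \<open>\<nu>'\<close> is the
  velocity of the normal along the motion, then the shape operator applied to the center velocity is \<open>- \<nu>'\<close>. The terms with \<open>\<nu>\<close> come from differentiating the
  constraints \<open>u \<bullet> \<nu> = 0\<close> and \<open>S \<nu> = 0\<close>. Both right-hand sides are linear in \<open>\<nu>'\<close>, so the effect of the motion
  depends only on the path of the normal, not on the speed at which it is traversed.\<close>

definition normal_driven ::
  "real \<Rightarrow> 'b::euclidean_space \<Rightarrow> 'b \<Rightarrow> ('b \<Rightarrow>\<^sub>L 'b) \<Rightarrow> 'b \<Rightarrow> 'b \<Rightarrow> ('b \<Rightarrow>\<^sub>L 'b) \<Rightarrow> bool" where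
  "normal_driven \<eta> \<nu> u S \<nu>' u' S' \<longleftrightarrow>
     u' = \<eta> *\<^sub>R S \<nu>' - (u \<bullet> \<nu>') *\<^sub>R \<nu> \<and>
     (\<forall>v. S' v = - \<eta> *\<^sub>R ((\<nu>' \<bullet> v) *\<^sub>R u - (u \<bullet> v) *\<^sub>R \<nu>') + ((S \<nu>' \<bullet> v) *\<^sub>R \<nu> - (\<nu> \<bullet> v) *\<^sub>R S \<nu>'))"

text \<open>No slipping gives \<open>u = r * U \<nu>\<close>, and \<open>U\<close> is skew.\<close>

lemma rolling_motion_center_normal:
  assumes roll: "rolling_motion P r \<eta> \<nu> T a u U" and t: "t \<in> T"
  shows "u t \<bullet> \<nu> (a t) = 0"
proof -
  have "skew (U t)" "u t + U t (a t - r *\<^sub>R \<nu> (a t) - a t) = 0" using roll t by (auto simp: rolling_motion_def)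
  then have "u t = r *\<^sub>R U t (\<nu> (a t))" by (simp add: blinfun.bilinear_simps)
  then show ?thesis using blinfun_skew_self[OF \<open>skew (U t)\<close>] by simp
qed

text \<open>The chain rule identifies the derivative of \<open>\<nu>\<close> along the center with minus the shape operator, and the
  equations of motion give the tangential parts of \<open>u'\<close> and \<open>S'\<close>. The remaining parts follow by differentiating
  \<open>u \<bullet> \<nu> = 0\<close>, \<open>S \<nu> = 0\<close> and the skew symmetry of \<open>S\<close>.\<close>

lemma rolling_motion_normal_driven:
  fixes P :: "'a::euclidean_space set" and r \<eta> :: real and \<nu> a U
  defines "S \<equiv> \<lambda>\<tau>. tangential_spin r \<eta> (\<nu> (a \<tau>)) (U \<tau>)"
  assumes roll: "rolling_motion P r \<eta> \<nu> T a u U"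
    and n1: "\<And>p. p \<in> center_surface P r \<Longrightarrow> norm (\<nu> p) = 1"
    and T: "{t0<..<t1} \<subseteq> T" and t: "t \<in> {t0<..<t1}"
    and d: "\<nu> differentiable (at (a t) within center_surface P r)"
  obtains \<nu>' u' S' where "((\<lambda>\<tau>. \<nu> (a \<tau>)) has_vector_derivative \<nu>') (at t)"
    "(u has_vector_derivative u') (at t)" "(S has_vector_derivative S') (at t)"
    "normal_driven \<eta> (\<nu> (a t)) (u t) (S t) \<nu>' u' S'"
proof -
  let ?M = "center_surface P r"
  have tT: "t \<in> T" using t T by blast
  note int = has_vector_derivative_at_interior[OF t T]
  have aM: "\<And>\<tau>. \<tau> \<in> T \<Longrightarrow> a \<tau> \<in> ?M" and a': "(a has_vector_derivative u t) (at t within T)"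
    and skU: "\<And>\<tau>. \<tau> \<in> T \<Longrightarrow> skew (U \<tau>)"
    using roll tT by (auto simp: rolling_motion_def)
  define n where "n = \<nu> (a t)"
  define Q where "Q = proj_perp n"
  define \<nu>' where "\<nu>' = frechet_derivative \<nu> (at (a t) within ?M) (u t)"
  obtain u' S' where u': "(u has_vector_derivative u') (at t within T)"
    and S': "(S has_vector_derivative S') (at t within T)"
    and Qu: "Q u' = \<eta> *\<^sub>R S t \<nu>'" and QSQ: "Q o\<^sub>L S' o\<^sub>L Q = \<eta> *\<^sub>R wedge (- \<nu>') (u t)"
    using roll d tT
    unfolding rolling_motion_def Let_def shape_operator_def \<nu>'_def Q_def n_def S_def
    by (auto simp: blinfun.bilinear_simps)
  note u' = int[OF u'] and S' = int[OF S']
  have N': "((\<lambda>\<tau>. \<nu> (a \<tau>)) has_vector_derivative \<nu>') (at t)"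
  proof -
    have D: "(\<nu> has_derivative frechet_derivative \<nu> (at (a t) within ?M)) (at (a t) within ?M)"
      using d by (simp add: frechet_derivative_works)
    have "(\<nu> has_derivative frechet_derivative \<nu> (at (a t) within ?M)) (at (a t) within a ` T)"
      using aM by (intro has_derivative_subset[OF D]) auto
    from diff_chain_within[OF a'[unfolded has_vector_derivative_def] this]
    have "((\<lambda>\<tau>. \<nu> (a \<tau>)) has_vector_derivative \<nu>') (at t within T)"
      using linear_scale[OF has_derivative_linear[OF D]]
      by (simp add: has_vector_derivative_def o_def \<nu>'_def)
    then show ?thesis by (rule int)
  qed
  have nT: "norm (\<nu> (a \<tau>)) = 1" if "\<tau> \<in> T" for \<tau> using n1 aM that by blast
  have nn: "n \<bullet> n = 1" using nT[OF tT] by (simp add: n_def dot_square_norm)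
  have zero: "D = 0" if "(f has_vector_derivative D) (at t)" "\<And>\<tau>. \<tau> \<in> T \<Longrightarrow> f \<tau> = 0"
    for f :: "real \<Rightarrow> 'c::real_normed_vector" and D
  proof -
    have "((\<lambda>_. 0) has_vector_derivative D) (at t)"
      using has_vector_derivative_transform_within_open[OF that(1) open_greaterThanLessThan t, of "\<lambda>_. 0"]
        that(2) T by blast
    then show ?thesis using vector_derivative_unique_at has_vector_derivative_const by blast
  qed
  have sk: "skew (S \<tau>)" if "\<tau> \<in> T" for \<tau>
    using skew_tangential_spin[OF skU[OF that]] by (simp add: S_def)
  have Sn: "S \<tau> (\<nu> (a \<tau>)) = 0" if "\<tau> \<in> T" for \<tau>
    using tangential_spin_normal[OF nT[OF that]] by (simp add: S_def)
  have un: "u t \<bullet> \<nu>' + u' \<bullet> n = 0"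
  proof (rule zero)
    show "((\<lambda>\<tau>. u \<tau> \<bullet> \<nu> (a \<tau>)) has_vector_derivative u t \<bullet> \<nu>' + u' \<bullet> n) (at t)"
      unfolding n_def by (rule bounded_bilinear.has_vector_derivative[OF bounded_bilinear_inner u' N'])
  qed (rule rolling_motion_center_normal[OF roll])
  have Sn': "S t \<nu>' + S' n = 0"
  proof (rule zero)
    show "((\<lambda>\<tau>. S \<tau> (\<nu> (a \<tau>))) has_vector_derivative S t \<nu>' + S' n) (at t)"
      unfolding n_def
      by (rule bounded_bilinear.has_vector_derivative[OF bounded_bilinear_blinfun_apply S' N'])
  qed (rule Sn)
  have skS': "S' v \<bullet> w + S' w \<bullet> v = 0" for v w
  proof (rule zero)
    have "((\<lambda>\<tau>. S \<tau> v) has_vector_derivative S' v) (at t)" for v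
      by (rule bounded_linear.has_vector_derivative[OF _ S'])
        (rule blinfun.bounded_linear_left)
    then show "((\<lambda>\<tau>. S \<tau> v \<bullet> w + S \<tau> w \<bullet> v) has_vector_derivative S' v \<bullet> w + S' w \<bullet> v) (at t)"
      by (intro has_vector_derivative_add
          bounded_linear.has_vector_derivative[OF bounded_linear_inner_left])
  next
    fix \<tau> assume "\<tau> \<in> T"
    then show "S \<tau> v \<bullet> w + S \<tau> w \<bullet> v = 0" using blinfun_skew_left[OF sk, of \<tau> v w] by simp
  qed
  have "u' = \<eta> *\<^sub>R S t \<nu>' - (u t \<bullet> \<nu>') *\<^sub>R n"
  proof -
    have "u' = Q u' + (u' \<bullet> n) *\<^sub>R n" by (simp add: Q_def proj_perp_apply)
    then show ?thesis using un Qu by (simp add: add_eq_0_iff2)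
  qed
  moreover have "S' v = - \<eta> *\<^sub>R ((\<nu>' \<bullet> v) *\<^sub>R u t - (u t \<bullet> v) *\<^sub>R \<nu>')
      + ((S t \<nu>' \<bullet> v) *\<^sub>R n - (n \<bullet> v) *\<^sub>R S t \<nu>')" for v
  proof -
    have S'n: "S' n = - S t \<nu>'" using Sn' by (simp add: add_eq_0_iff)
    have "S t \<nu>' \<bullet> n = 0" using blinfun_skew_left[OF sk[OF tT], of \<nu>' n] Sn[OF tT] by (simp add: n_def)
    then have S'vn: "S' (Q v) \<bullet> n = S t \<nu>' \<bullet> v"
      using skS'[of "Q v" n] S'n by (simp add: Q_def proj_perp_apply inner_diff_right)
    have "S' v = S' (Q v) + (v \<bullet> n) *\<^sub>R S' n"
      by (simp add: Q_def proj_perp_apply blinfun.bilinear_simps)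
    also have "S' (Q v) = Q (S' (Q v)) + (S' (Q v) \<bullet> n) *\<^sub>R n"
      by (simp add: Q_def proj_perp_apply[of n "S' (proj_perp n v)"])
    also have "Q (S' (Q v)) = \<eta> *\<^sub>R wedge (- \<nu>') (u t) v"
      using arg_cong[OF QSQ, of "\<lambda>A. blinfun_apply A v"] by (simp add: blinfun.bilinear_simps)
    finally show ?thesis
      unfolding S'vn S'n by (simp add: wedge_apply inner_commute algebra_simps)
  qed
  ultimately show ?thesis using N' u' S' by (intro that) (auto simp: normal_driven_def n_def)
qed

lemma sum_Basis_inner_blinfun:
  fixes A :: "'b::euclidean_space \<Rightarrow>\<^sub>L 'c::real_inner"
  shows "(\<Sum>b\<in>Basis. (v \<bullet> b) * (A b \<bullet> w)) = A v \<bullet> w"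
proof -
  have "A v = A (\<Sum>b\<in>Basis. (v \<bullet> b) *\<^sub>R b)" by (simp add: euclidean_representation)
  also have "\<dots> = (\<Sum>b\<in>Basis. (v \<bullet> b) *\<^sub>R A b)" by (simp add: blinfun.sum_right blinfun.bilinear_simps)
  finally show ?thesis by (simp add: inner_sum_left)
qed

text \<open>The kinetic energy is a constant multiple of this quantity: rolling gives \<open>U \<nu> = u / r\<close>, and \<open>S\<close> is
  \<open>r * \<eta>\<close> times the rest of the angular velocity \<open>U\<close>.\<close>

definition energy :: "'b::euclidean_space \<Rightarrow> ('b \<Rightarrow>\<^sub>L 'b) \<Rightarrow> real" where
  "energy u S = u \<bullet> u + (\<Sum>b\<in>Basis. S b \<bullet> S b) / 2"

text \<open>The two contributions are \<open>2 \<eta> (u \<bullet> S \<nu>')\<close> and its negative; the terms with \<open>\<nu>\<close> drop out because \<open>S\<close> annihilates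
  \<open>\<nu>\<close>.\<close>

lemma energy_derivative_zero:
  fixes u :: "real \<Rightarrow> 'b::euclidean_space"
  assumes u: "(u has_vector_derivative u') (at t)" and S: "(S has_vector_derivative S') (at t)"
    and dr: "normal_driven \<eta> n (u t) (S t) \<nu>' u' S'"
    and sk: "skew (S t)" and Sn: "S t n = 0" and un: "u t \<bullet> n = 0"
  shows "((\<lambda>\<tau>. energy (u \<tau>) (S \<tau>)) has_vector_derivative 0) (at t)"
proof -
  have Sb: "((\<lambda>\<tau>. S \<tau> b) has_vector_derivative S' b) (at t)" for b
    by (rule bounded_linear.has_vector_derivative[OF _ S]) (rule blinfun.bounded_linear_left)
  have "((\<lambda>\<tau>. u \<tau> \<bullet> u \<tau>) has_vector_derivative u t \<bullet> u' + u' \<bullet> u t) (at t)"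
    by (rule bounded_bilinear.has_vector_derivative[OF bounded_bilinear_inner u u])
  moreover have "((\<lambda>\<tau>. S \<tau> b \<bullet> S \<tau> b) has_vector_derivative S t b \<bullet> S' b + S' b \<bullet> S t b) (at t)" for b
    by (rule bounded_bilinear.has_vector_derivative[OF bounded_bilinear_inner Sb Sb])
  ultimately have "((\<lambda>\<tau>. energy (u \<tau>) (S \<tau>)) has_vector_derivative
      (u t \<bullet> u' + u' \<bullet> u t) + (\<Sum>b\<in>Basis. S t b \<bullet> S' b + S' b \<bullet> S t b) / 2) (at t)"
    unfolding energy_def
    by (intro has_vector_derivative_add has_vector_derivative_divide has_vector_derivative_sum)
  moreover have "(\<Sum>b\<in>Basis. S t b \<bullet> S' b) = - 2 * (u t \<bullet> u')"
  proof -
    let ?S = "S t"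
    have "?S b \<bullet> S' b = - \<eta> * ((\<nu>' \<bullet> b) * (?S b \<bullet> u t)) + \<eta> * ((u t \<bullet> b) * (?S b \<bullet> \<nu>'))
        + (?S \<nu>' \<bullet> b) * (?S b \<bullet> n) - (n \<bullet> b) * (?S b \<bullet> ?S \<nu>')" for b
    proof -
      have "S' b = - \<eta> *\<^sub>R ((\<nu>' \<bullet> b) *\<^sub>R u t - (u t \<bullet> b) *\<^sub>R \<nu>')
          + ((?S \<nu>' \<bullet> b) *\<^sub>R n - (n \<bullet> b) *\<^sub>R ?S \<nu>')" using dr by (simp add: normal_driven_def)
      then show ?thesis by (simp add: inner_add_right inner_diff_right right_diff_distrib)
    qed
    then have "(\<Sum>b\<in>Basis. ?S b \<bullet> S' b) =
        - \<eta> * (?S \<nu>' \<bullet> u t) + \<eta> * (?S (u t) \<bullet> \<nu>') + ?S (?S \<nu>') \<bullet> n - ?S n \<bullet> ?S \<nu>'"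
      by (simp only: sum.distrib sum_subtractf sum_Basis_inner_blinfun flip: sum_distrib_left)
    also have "\<dots> = - 2 * \<eta> * (?S \<nu>' \<bullet> u t)"
      using blinfun_skew_left[OF sk, of "u t" \<nu>'] blinfun_skew_left[OF sk, of "?S \<nu>'" n] Sn by simp
    also have "\<dots> = - 2 * (u t \<bullet> u')"
      using dr un by (simp add: normal_driven_def inner_diff_right inner_commute)
    finally show ?thesis .
  qed
  moreover have "(\<Sum>b\<in>Basis. S t b \<bullet> S' b + S' b \<bullet> S t b) = 2 * (\<Sum>b\<in>Basis. S t b \<bullet> S' b)"
    by (simp add: inner_commute sum_distrib_left)
  ultimately show ?thesis by (simp add: inner_commute)
qed

text \<open>Together with conservation of energy this gives bounds during a crossing that do not depend on the radius.\<close>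

lemma energy_bounds:
  fixes u :: "'b::euclidean_space" and A :: real
  assumes E: "energy u S \<le> A\<^sup>2" and A: "0 \<le> A"
  shows "norm u \<le> A" "norm S \<le> 2 * real DIM('b) * A"
proof -
  have nn: "0 \<le> (\<Sum>b\<in>Basis. S b \<bullet> S b)" by (intro sum_nonneg) auto
  have "(norm u)\<^sup>2 \<le> A\<^sup>2" using E nn by (simp add: energy_def power2_norm_eq_inner)
  then show "norm u \<le> A" using A by (rule power2_le_imp_le)
  have Sb: "norm (S b) \<le> 2 * A" if "b \<in> Basis" for b
  proof -
    have "S b \<bullet> S b \<le> (\<Sum>b\<in>Basis. S b \<bullet> S b)" using that by (intro member_le_sum) auto
    also have "\<dots> \<le> 2 * A\<^sup>2" using E inner_ge_zero[of u] unfolding energy_def by linarith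
    also have "\<dots> \<le> (2 * A)\<^sup>2" by (simp add: power_mult_distrib)
    finally have "(norm (S b))\<^sup>2 \<le> (2 * A)\<^sup>2" by (simp only: power2_norm_eq_inner)
    then show ?thesis by (rule power2_le_imp_le) (use A in simp)
  qed
  show "norm S \<le> 2 * real DIM('b) * A"
  proof (rule norm_blinfun_bound)
    fix v :: 'b
    have "S v = S (\<Sum>b\<in>Basis. (v \<bullet> b) *\<^sub>R b)" by (simp add: euclidean_representation)
    also have "\<dots> = (\<Sum>b\<in>Basis. (v \<bullet> b) *\<^sub>R S b)" by (simp add: blinfun.sum_right blinfun.bilinear_simps)
    also have "norm \<dots> \<le> (\<Sum>b\<in>(Basis::'b set). norm v * (2 * A))"
    proof (rule order_trans[OF norm_sum], rule sum_mono)
      fix b :: 'b assume "b \<in> Basis"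
      then show "norm ((v \<bullet> b) *\<^sub>R S b) \<le> norm v * (2 * A)"
        unfolding norm_scaleR using Sb Basis_le_norm by (intro mult_mono) auto
    qed
    finally show "norm (S v) \<le> 2 * real DIM('b) * A * norm v" by (simp add: algebra_simps)
  qed (use A in simp)
qed

lemma energy_le:
  fixes u :: "'b::euclidean_space" and c :: real
  assumes "norm u \<le> c" "norm S \<le> c"
  shows "energy u S \<le> ((1 + real DIM('b)) * c)\<^sup>2"
proof -
  have c: "0 \<le> c" using assms(1) norm_ge_zero order_trans by blast
  have "S b \<bullet> S b \<le> c\<^sup>2" if "b \<in> Basis" for b
  proof -
    have "norm (S b) \<le> c" using norm_blinfun[of S b] that assms(2) by simp
    then have "(norm (S b))\<^sup>2 \<le> c\<^sup>2" by (intro power_mono) auto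
    then show ?thesis by (simp add: power2_norm_eq_inner)
  qed
  then have "(\<Sum>b\<in>Basis. S b \<bullet> S b) \<le> real DIM('b) * c\<^sup>2"
    using sum_bounded_above[of Basis "\<lambda>b. S b \<bullet> S b" "c\<^sup>2"] by simp
  moreover have "u \<bullet> u \<le> c\<^sup>2" using power_mono[OF assms(1), of 2] by (simp add: power2_norm_eq_inner)
  moreover have "0 \<le> real DIM('b) * c\<^sup>2" by simp
  ultimately have "energy u S \<le> (1 + real DIM('b)) * c\<^sup>2" 
    unfolding energy_def distrib_right mult_1 by linarith
  also have "\<dots> \<le> (1 + real DIM('b))\<^sup>2 * c\<^sup>2"
    by (intro mult_right_mono) (simp_all add: power2_eq_square)
  finally show ?thesis by (simp add: power_mult_distrib)
qed

section \<open>An adapted frame and quantities with bounded derivative\<close>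

lemma norm_inner_scaleR_le:
  fixes a b v :: "'a::real_inner"
  assumes "norm a * norm b \<le> B"
  shows "norm ((a \<bullet> v) *\<^sub>R b) \<le> B * norm v"
proof -
  have "\<bar>a \<bullet> v\<bar> * norm b \<le> (norm a * norm v) * norm b"
    by (intro mult_right_mono Cauchy_Schwarz_ineq2) auto
  also have "\<dots> = (norm a * norm b) * norm v" by simp
  also have "\<dots> \<le> B * norm v" using assms by (intro mult_right_mono) auto
  finally show ?thesis by simp
qed

lemma abs_inner_le_mult: "norm a \<le> A \<Longrightarrow> norm b \<le> B \<Longrightarrow> \<bar>a \<bullet> b\<bar> \<le> A * B"
  by (meson Cauchy_Schwarz_ineq2 mult_mono norm_ge_zero order_trans)

text \<open>Let the normal \<open>n\<close> turn towards a unit vector \<open>F\<close> with angular speed \<open>\<phi>'\<close>, up to errors \<open>m\<close> and \<open>l\<close>. If these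
  vanish, the velocity \<open>\<rho>\<close> in direction \<open>F\<close> is constant because \<open>S F \<bullet> F = 0\<close>; the remaining velocity \<open>ub\<close> and
  \<open>W = S F\<close> satisfy \<open>ub' = \<eta> \<phi>' W\<close> and \<open>W' = - \<eta> \<phi>' ub\<close>, hence rotate into each other by the angle \<open>\<eta> \<phi>\<close>; and the
  part of \<open>S\<close> orthogonal to both \<open>n\<close> and \<open>F\<close> is constant. In general the errors enter linearly, so the
  derivatives of the corresponding four quantities are bounded by multiples of \<open>C * K\<close>, in which the
  possibly huge \<open>\<phi>'\<close> does not occur.\<close>

lemma adapted_frame_derivatives:
  fixes n F u :: "real \<Rightarrow> 'b::euclidean_space" and S :: "real \<Rightarrow> 'b \<Rightarrow>\<^sub>L 'b" and \<phi> :: "real \<Rightarrow> real"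
  assumes dF: "(F has_vector_derivative (- \<phi>' *\<^sub>R n t + l)) (at t)"
    and du: "(u has_vector_derivative u') (at t)" and dS: "(S has_vector_derivative S') (at t)"
    and d\<phi>: "(\<phi> has_real_derivative \<phi>') (at t)"
    and dr: "normal_driven \<eta> (n t) (u t) (S t) (\<phi>' *\<^sub>R F t + m) u' S'"
    and orth: "norm (n t) = 1" "norm (F t) = 1" "n t \<bullet> F t = 0"
    and con: "u t \<bullet> n t = 0" "S t (n t) = 0" "skew (S t)"
    and bd: "norm (u t) \<le> C" "norm (S t) \<le> C" "norm m \<le> K" "norm l \<le> K"
    and eta: "0 \<le> \<eta>" "\<eta> \<le> 1"
  defines "\<rho> \<equiv> \<lambda>\<tau>. u \<tau> \<bullet> F \<tau>"
  defines "ub \<equiv> \<lambda>\<tau>. u \<tau> - \<rho> \<tau> *\<^sub>R F \<tau>"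
  defines "W \<equiv> \<lambda>\<tau>. blinfun_apply (S \<tau>) (F \<tau>)"
  shows "\<exists>D. (\<rho> has_vector_derivative D) (at t) \<and> norm D \<le> 2 * C * K"
    and "\<exists>D. ((\<lambda>\<tau>. cos (\<eta> * \<phi> \<tau>) *\<^sub>R ub \<tau> - sin (\<eta> * \<phi> \<tau>) *\<^sub>R W \<tau>) has_vector_derivative D) (at t)
      \<and> norm D \<le> 9 * C * K"
    and "\<exists>D. ((\<lambda>\<tau>. sin (\<eta> * \<phi> \<tau>) *\<^sub>R ub \<tau> + cos (\<eta> * \<phi> \<tau>) *\<^sub>R W \<tau>) has_vector_derivative D) (at t)
      \<and> norm D \<le> 9 * C * K"
    and "\<exists>D. ((\<lambda>\<tau>. S \<tau> v - ((F \<tau> \<bullet> v) *\<^sub>R W \<tau> - (W \<tau> \<bullet> v) *\<^sub>R F \<tau>)) has_vector_derivative D) (at t)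
      \<and> norm D \<le> 14 * C * K * norm v"
proof -
  let ?n = "n t" and ?F = "F t" and ?u = "u t" and ?S = "S t" and ?W = "W t" and ?ub = "ub t"
    and ?F' = "- \<phi>' *\<^sub>R n t + l"
  have C0: "0 \<le> C" using bd(1) norm_ge_zero order_trans by blast
  have K0: "0 \<le> K" using bd(3) norm_ge_zero order_trans by blast
  have u': "u' = \<eta> *\<^sub>R ?S (\<phi>' *\<^sub>R ?F + m) - (?u \<bullet> (\<phi>' *\<^sub>R ?F + m)) *\<^sub>R ?n"
    and S': "\<And>v. S' v = - \<eta> *\<^sub>R (((\<phi>' *\<^sub>R ?F + m) \<bullet> v) *\<^sub>R ?u - (?u \<bullet> v) *\<^sub>R (\<phi>' *\<^sub>R ?F + m))
      + ((?S (\<phi>' *\<^sub>R ?F + m) \<bullet> v) *\<^sub>R ?n - (?n \<bullet> v) *\<^sub>R ?S (\<phi>' *\<^sub>R ?F + m))"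
    using dr by (auto simp: normal_driven_def)
  have Sx: "?S (\<phi>' *\<^sub>R ?F + m) = \<phi>' *\<^sub>R ?W + ?S m" by (simp add: W_def blinfun.bilinear_simps)
  have FF: "?F \<bullet> ?F = 1" and nF: "?n \<bullet> ?F = 0" "?F \<bullet> ?n = 0"
    using orth by (auto simp: dot_square_norm inner_commute)
  have WF: "?W \<bullet> ?F = 0" using blinfun_skew_self[OF con(3)] by (simp add: W_def)
  have Sm: "norm (?S m) \<le> C * K"
    using norm_blinfun[of ?S m] mult_mono[OF bd(2,3) C0] by simp
  have nW: "norm ?W \<le> C" using norm_blinfun[of ?S ?F] bd(2) orth by (simp add: W_def)
  have \<rho>C: "\<bar>\<rho> t\<bar> \<le> C" using abs_inner_le_mult[OF bd(1), of ?F 1] orth by (simp add: \<rho>_def)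
  have um: "\<bar>?u \<bullet> m\<bar> \<le> C * K" "\<bar>?u \<bullet> l\<bar> \<le> C * K" using abs_inner_le_mult bd by blast+
  have etaK: "\<bar>\<eta> * x\<bar> \<le> B" if "\<bar>x\<bar> \<le> B" for x B :: real
    using mult_mono[of "\<bar>\<eta>\<bar>" 1 "\<bar>x\<bar>" B] eta that by (simp add: abs_mult)

  define \<rho>' where "\<rho>' = \<eta> * (?S m \<bullet> ?F) + ?u \<bullet> l"
  have d\<rho>: "(\<rho> has_vector_derivative \<rho>') (at t)"
  proof -
    have "(\<rho> has_vector_derivative (?u \<bullet> ?F' + u' \<bullet> ?F)) (at t)"
      unfolding \<rho>_def by (rule bounded_bilinear.has_vector_derivative[OF bounded_bilinear_inner du dF])
    moreover have "?u \<bullet> ?F' + u' \<bullet> ?F = \<rho>'"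
      unfolding u' Sx by (simp add: \<rho>'_def inner_simps WF nF con)
    ultimately show ?thesis by simp
  qed
  have \<rho>'_le: "\<bar>\<rho>'\<bar> \<le> 2 * C * K"
  proof -
    have "\<bar>?S m \<bullet> ?F\<bar> \<le> C * K * 1" using abs_inner_le_mult[OF Sm, of ?F 1] orth by simp
    then have "\<bar>\<eta> * (?S m \<bullet> ?F)\<bar> \<le> C * K" using etaK by simp
    then show ?thesis using um by (simp add: \<rho>'_def)
  qed
  show "\<exists>D. (\<rho> has_vector_derivative D) (at t) \<and> norm D \<le> 2 * C * K"
    using d\<rho> \<rho>'_le by auto

  define e1 where "e1 = \<eta> *\<^sub>R ?S m - (?u \<bullet> m) *\<^sub>R ?n - \<rho>' *\<^sub>R ?F - \<rho> t *\<^sub>R l"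
  have dub: "(ub has_vector_derivative ((\<eta> * \<phi>') *\<^sub>R ?W + e1)) (at t)"
  proof -
    have "(ub has_vector_derivative (u' - (\<rho> t *\<^sub>R ?F' + \<rho>' *\<^sub>R ?F))) (at t)"
      unfolding ub_def
      by (intro has_vector_derivative_diff du
          bounded_bilinear.has_vector_derivative[OF bounded_bilinear_scaleR d\<rho> dF])
    moreover have "u' - (\<rho> t *\<^sub>R ?F' + \<rho>' *\<^sub>R ?F) = (\<eta> * \<phi>') *\<^sub>R ?W + e1"
      unfolding u' Sx by (simp add: e1_def \<rho>_def inner_simps algebra_simps)
    ultimately show ?thesis by simp
  qed
  have e1: "norm e1 \<le> 5 * C * K"
  proof -
    have "norm e1 \<le> norm (\<eta> *\<^sub>R ?S m) + norm ((?u \<bullet> m) *\<^sub>R ?n) + norm (\<rho>' *\<^sub>R ?F) + norm (\<rho> t *\<^sub>R l)"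
    proof -
      have "norm (a - b - c - d) \<le> norm a + norm b + norm c + norm d" for a b c d :: 'b by norm
      then show ?thesis unfolding e1_def .
    qed
    moreover have "norm (\<eta> *\<^sub>R ?S m) \<le> C * K" using etaK[of "norm (?S m)"] Sm by (simp add: abs_mult)
    moreover have "norm (\<rho> t *\<^sub>R l) \<le> C * K" using mult_mono[OF \<rho>C bd(4) C0] by simp
    ultimately show ?thesis using um \<rho>'_le orth by simp
  qed

  define e2 where "e2 = - \<eta> *\<^sub>R ((m \<bullet> ?F) *\<^sub>R ?u - \<rho> t *\<^sub>R m) + (?S m \<bullet> ?F) *\<^sub>R ?n + ?S l"
  have dW: "(W has_vector_derivative (- (\<eta> * \<phi>') *\<^sub>R ?ub + e2)) (at t)"
  proof -
    have "(W has_vector_derivative (?S ?F' + S' ?F)) (at t)"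
      unfolding W_def by (rule bounded_bilinear.has_vector_derivative[OF bounded_bilinear_blinfun_apply dS dF])
    moreover have "?S ?F' + S' ?F = - (\<eta> * \<phi>') *\<^sub>R ?ub + e2"
      unfolding S' Sx
      by (simp add: e2_def ub_def \<rho>_def inner_simps algebra_simps FF nF WF con blinfun.bilinear_simps)
    ultimately show ?thesis by simp
  qed
  have e2: "norm e2 \<le> 4 * C * K"
  proof -
    have "norm e2 \<le> norm (- \<eta> *\<^sub>R ((m \<bullet> ?F) *\<^sub>R ?u - \<rho> t *\<^sub>R m)) + norm ((?S m \<bullet> ?F) *\<^sub>R ?n) + norm (?S l)"
      unfolding e2_def by (meson add_right_mono norm_triangle_ineq order_trans)
    moreover have "norm ((m \<bullet> ?F) *\<^sub>R ?u - \<rho> t *\<^sub>R m) \<le> 2 * C * K"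
    proof -
      have "norm ((m \<bullet> ?F) *\<^sub>R ?u) \<le> C * K * norm ?F"
        using mult_mono[OF bd(3,1) K0] by (intro norm_inner_scaleR_le) (simp add: mult.commute)
      moreover have "norm (\<rho> t *\<^sub>R m) \<le> C * K" using mult_mono[OF \<rho>C bd(3) C0] by simp
      ultimately show ?thesis using orth norm_triangle_ineq4[of "(m \<bullet> ?F) *\<^sub>R ?u" "\<rho> t *\<^sub>R m"] by simp
    qed
    then have "norm (- \<eta> *\<^sub>R ((m \<bullet> ?F) *\<^sub>R ?u - \<rho> t *\<^sub>R m)) \<le> 2 * C * K"
      using etaK[of "norm ((m \<bullet> ?F) *\<^sub>R ?u - \<rho> t *\<^sub>R m)" "2 * C * K"] by (simp add: abs_mult)
    moreover have "norm ((?S m \<bullet> ?F) *\<^sub>R ?n) \<le> C * K * norm ?F"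
      using Sm orth by (intro norm_inner_scaleR_le) simp
    moreover have "norm (?S l) \<le> C * K"
      using norm_blinfun[of ?S l] mult_mono[OF bd(2,4) C0] by simp
    ultimately show ?thesis using orth by simp
  qed

  have dcos: "((\<lambda>\<tau>. cos (\<eta> * \<phi> \<tau>)) has_vector_derivative (- sin (\<eta> * \<phi> t) * (\<eta> * \<phi>'))) (at t)"
    and dsin: "((\<lambda>\<tau>. sin (\<eta> * \<phi> \<tau>)) has_vector_derivative (cos (\<eta> * \<phi> t) * (\<eta> * \<phi>'))) (at t)"
    unfolding has_real_derivative_iff_has_vector_derivative[symmetric]
    by (auto intro!: derivative_eq_intros d\<phi>)
  note sc = bounded_bilinear.has_vector_derivative[OF bounded_bilinear_scaleR]
  have comb: "norm (c *\<^sub>R e1 - s *\<^sub>R e2) \<le> 9 * C * K" "norm (s *\<^sub>R e1 + c *\<^sub>R e2) \<le> 9 * C * K"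
    if "\<bar>c\<bar> \<le> 1" "\<bar>s\<bar> \<le> 1" for c s
  proof -
    have le: "norm (k *\<^sub>R e) \<le> norm e" if "\<bar>k\<bar> \<le> 1" for k and e :: 'b
      using mult_right_mono[OF that norm_ge_zero[of e]] by simp
    show "norm (c *\<^sub>R e1 - s *\<^sub>R e2) \<le> 9 * C * K" "norm (s *\<^sub>R e1 + c *\<^sub>R e2) \<le> 9 * C * K"
      using le[OF that(1), of e1] le[OF that(2), of e2] le[OF that(2), of e1] le[OF that(1), of e2] e1 e2
        norm_triangle_ineq4[of "c *\<^sub>R e1" "s *\<^sub>R e2"] norm_triangle_ineq[of "s *\<^sub>R e1" "c *\<^sub>R e2"]
      by linarith+
  qed
  have "((\<lambda>\<tau>. cos (\<eta> * \<phi> \<tau>) *\<^sub>R ub \<tau> - sin (\<eta> * \<phi> \<tau>) *\<^sub>R W \<tau>) has_vector_derivative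
      (cos (\<eta> * \<phi> t) *\<^sub>R e1 - sin (\<eta> * \<phi> t) *\<^sub>R e2)) (at t)"
    by (rule has_vector_derivative_eq_rhs[OF has_vector_derivative_diff[OF sc[OF dcos dub] sc[OF dsin dW]]])
      (simp add: algebra_simps)
  then show "\<exists>D. ((\<lambda>\<tau>. cos (\<eta> * \<phi> \<tau>) *\<^sub>R ub \<tau> - sin (\<eta> * \<phi> \<tau>) *\<^sub>R W \<tau>) has_vector_derivative D) (at t)
      \<and> norm D \<le> 9 * C * K"
    using comb(1)[of "cos (\<eta> * \<phi> t)" "sin (\<eta> * \<phi> t)"] by auto
  have "((\<lambda>\<tau>. sin (\<eta> * \<phi> \<tau>) *\<^sub>R ub \<tau> + cos (\<eta> * \<phi> \<tau>) *\<^sub>R W \<tau>) has_vector_derivative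
      (sin (\<eta> * \<phi> t) *\<^sub>R e1 + cos (\<eta> * \<phi> t) *\<^sub>R e2)) (at t)"
    by (rule has_vector_derivative_eq_rhs[OF has_vector_derivative_add[OF sc[OF dsin dub] sc[OF dcos dW]]])
      (simp add: algebra_simps)
  then show "\<exists>D. ((\<lambda>\<tau>. sin (\<eta> * \<phi> \<tau>) *\<^sub>R ub \<tau> + cos (\<eta> * \<phi> \<tau>) *\<^sub>R W \<tau>) has_vector_derivative D) (at t)
      \<and> norm D \<le> 9 * C * K"
    using comb(2)[of "cos (\<eta> * \<phi> t)" "sin (\<eta> * \<phi> t)"] by auto

  define e3 where "e3 = - \<eta> *\<^sub>R ((m \<bullet> v) *\<^sub>R ?u - (?u \<bullet> v) *\<^sub>R m)
    + ((?S m \<bullet> v) *\<^sub>R ?n - (?n \<bullet> v) *\<^sub>R ?S m) - ((l \<bullet> v) *\<^sub>R ?W - (?W \<bullet> v) *\<^sub>R l)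
    - ((?F \<bullet> v) *\<^sub>R e2 - (e2 \<bullet> v) *\<^sub>R ?F)"
  have "((\<lambda>\<tau>. S \<tau> v - ((F \<tau> \<bullet> v) *\<^sub>R W \<tau> - (W \<tau> \<bullet> v) *\<^sub>R F \<tau>)) has_vector_derivative e3) (at t)"
  proof -
    have Sv: "((\<lambda>\<tau>. S \<tau> v) has_vector_derivative S' v) (at t)"
      by (rule bounded_linear.has_vector_derivative[OF _ dS]) (rule blinfun.bounded_linear_left)
    note iv = bounded_linear.has_vector_derivative[OF bounded_linear_inner_left]
    show ?thesis
      by (rule has_vector_derivative_eq_rhs[OF has_vector_derivative_diff[OF Sv
            has_vector_derivative_diff[OF sc[OF iv[OF dF] dW] sc[OF iv[OF dW] dF]]]])
        (unfold S' Sx, simp add: e3_def ub_def inner_simps algebra_simps)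
  qed
  moreover have "norm e3 \<le> 14 * C * K * norm v"
  proof -
    note b = norm_inner_scaleR_le[of _ _ _ v]
    have 1: "norm ((m \<bullet> v) *\<^sub>R ?u) \<le> C * K * norm v" "norm ((?u \<bullet> v) *\<^sub>R m) \<le> C * K * norm v"
      "norm ((l \<bullet> v) *\<^sub>R ?W) \<le> C * K * norm v" "norm ((?W \<bullet> v) *\<^sub>R l) \<le> C * K * norm v"
      by (rule b, use mult_mono[OF bd(1,3) C0] mult_mono[OF nW bd(4) C0] in \<open>simp add: mult.commute\<close>)+
    have 2: "norm ((?S m \<bullet> v) *\<^sub>R ?n) \<le> C * K * norm v" "norm ((?n \<bullet> v) *\<^sub>R ?S m) \<le> C * K * norm v"
      "norm ((?F \<bullet> v) *\<^sub>R e2) \<le> 4 * C * K * norm v" "norm ((e2 \<bullet> v) *\<^sub>R ?F) \<le> 4 * C * K * norm v"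
      by (rule b, use orth Sm e2 in simp)+
    have "norm ((m \<bullet> v) *\<^sub>R ?u - (?u \<bullet> v) *\<^sub>R m) \<le> 2 * C * K * norm v"
      using 1(1,2) norm_triangle_ineq4[of "(m \<bullet> v) *\<^sub>R ?u" "(?u \<bullet> v) *\<^sub>R m"] by linarith
    then have 3: "norm (- \<eta> *\<^sub>R ((m \<bullet> v) *\<^sub>R ?u - (?u \<bullet> v) *\<^sub>R m)) \<le> 2 * C * K * norm v"
      using etaK[of "norm ((m \<bullet> v) *\<^sub>R ?u - (?u \<bullet> v) *\<^sub>R m)"] by (simp add: abs_mult)
    have "norm e3 \<le> norm (- \<eta> *\<^sub>R ((m \<bullet> v) *\<^sub>R ?u - (?u \<bullet> v) *\<^sub>R m))
      + (norm ((?S m \<bullet> v) *\<^sub>R ?n) + norm ((?n \<bullet> v) *\<^sub>R ?S m)) + (norm ((l \<bullet> v) *\<^sub>R ?W) + norm ((?W \<bullet> v) *\<^sub>R l))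
      + (norm ((?F \<bullet> v) *\<^sub>R e2) + norm ((e2 \<bullet> v) *\<^sub>R ?F))"
    proof -
      have "norm (a + (b - c) - (d - e) - (f - g)) \<le> norm a + (norm b + norm c) + (norm d + norm e)
        + (norm f + norm g)" for a b c d e f g :: 'b by norm
      then show ?thesis unfolding e3_def .
    qed
    then show ?thesis using 1 2 3 by linarith
  qed
  ultimately show "\<exists>D. ((\<lambda>\<tau>. S \<tau> v - ((F \<tau> \<bullet> v) *\<^sub>R W \<tau> - (W \<tau> \<bullet> v) *\<^sub>R F \<tau>)) has_vector_derivative D) (at t)
      \<and> norm D \<le> 14 * C * K * norm v" by blast
qed

section \<open>A single crossing of the edge\<close>

lemma norm_of_fst_le: "norm (fst z) \<le> norm z"
  using norm_fst_le[of "fst z" "snd z"] by simp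

text \<open>One crossing of the edge by a ball of small radius. The ball starts on the side \<open>\<sigma>\<close> of the plate; \<open>n\<close>, \<open>S\<close> and \<open>y\<close>
  are the normal, the tangential spin and the contact point along the motion. \<open>C\<close> bounds velocity and spin,
  \<open>K\<close> bounds the errors in the adapted frame, \<open>\<beta>\<close> is a lower bound for the initial speed towards the edge, and
  \<open>d\<close> will bound the duration: at half that speed, a turn through \<open>\<pi>\<close> on a circle of radius \<open>r\<close> takes time
  \<open>2 * \<pi> * r / \<beta>\<close>, and twice that time leaves room for a contradiction. By \<open>slow\<close> the speed towards the edge
  changes by at most \<open>\<beta> / 2\<close> during this time, and by \<open>near\<close> the contact point stays in the ball of
  radius \<open>\<delta> / 2\<close>, whose closure lies in the domain of the normal field.\<close>

locale edge_crossing =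
  fixes P :: "'a::euclidean_space set" and r \<eta> :: real and \<nu> T a u U and t0 t1 \<sigma> :: real
    and x :: 'a and \<delta> L :: real and g :: "'a \<Rightarrow> 'a" and A \<beta> :: real
  fixes n S y C K d
  defines "n \<equiv> \<lambda>\<tau>. \<nu> (a \<tau>)"
    and "S \<equiv> \<lambda>\<tau>. tangential_spin r \<eta> (n \<tau>) (U \<tau>)"
    and "y \<equiv> \<lambda>\<tau>. fst (a \<tau> - r *\<^sub>R n \<tau>)"
    and "C \<equiv> 2 * real DIM('a \<times> real) * A"
    and "K \<equiv> 2 * L * C"
    and "d \<equiv> 4 * pi * r / \<beta>"
  assumes P: "closed P" "P \<noteq> {}"
    and r: "0 < r" "r * L \<le> 1 / 2" and L: "0 \<le> L" and eta: "0 \<le> \<eta>" "\<eta> \<le> 1"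
    and nu: "piecewise_smooth_normal_field P r \<nu>"
    and roll: "rolling_motion P r \<eta> \<nu> T a u U"
    and T: "{t0..t1} \<subseteq> T" and t01: "t0 < t1"
    and sigma: "\<sigma> \<in> {1, -1}" and start: "a t0 \<in> P \<times> {\<sigma> * r}" and finish: "a t1 \<in> P \<times> {- \<sigma> * r}"
    and curved: "\<And>\<tau>. \<tau> \<in> {t0<..<t1} \<Longrightarrow> a \<tau> \<in> curved_part P r"
    and g: "normal_field_near P x \<delta> L g" and delta: "0 < \<delta>"
    and A: "0 \<le> A" "energy (u t0) (S t0) \<le> A\<^sup>2"
    and beta: "0 < \<beta>" "\<beta> \<le> fst (u t0) \<bullet> g (y t0)"
    and slow: "2 * C * K * d \<le> \<beta> / 2"
    and near: "norm (y t0 - x) + C * d + 2 * r < \<delta> / 2"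
begin

lemma inT: "\<tau> \<in> {t0..t1} \<Longrightarrow> \<tau> \<in> T"
  using T by blast

lemma on_surface: "\<tau> \<in> T \<Longrightarrow> a \<tau> \<in> center_surface P r"
  using roll by (simp add: rolling_motion_def)

lemma outward: "p \<in> center_surface P r \<Longrightarrow> outward_unit_normal (plate_nbhd P r) p (\<nu> p)"
  using nu by (simp add: piecewise_smooth_normal_field_def)

lemma norm_n: "\<tau> \<in> T \<Longrightarrow> norm (n \<tau>) = 1"
  using outward[OF on_surface] by (simp add: n_def outward_unit_normal_def unit_normal_def)

lemma foot: assumes "\<tau> \<in> T" shows "y \<tau> \<in> P" "a \<tau> = (y \<tau>, 0) + r *\<^sub>R n \<tau>"
proof -
  obtain z where z: "z \<in> P" "a \<tau> - r *\<^sub>R n \<tau> = (z, 0)"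
    using outward_normal_foot[OF P on_surface[OF assms] r(1) outward[OF on_surface[OF assms]]]
    unfolding n_def .
  then have "y \<tau> = z" by (simp only: y_def fst_conv)
  with z show "y \<tau> \<in> P" "a \<tau> = (y \<tau>, 0) + r *\<^sub>R n \<tau>" by (auto simp: algebra_simps)
qed

lemma cont_a: "continuous_on T a"
  using roll has_vector_derivative_continuous unfolding rolling_motion_def continuous_on_eq_continuous_within
  by blast

lemma cont_u: "continuous_on T u"
  using roll by (simp add: rolling_motion_def)

lemma cont_n: "continuous_on T n"
  unfolding n_def
  by (rule continuous_on_compose2[OF _ cont_a])
    (use nu on_surface in \<open>auto simp: piecewise_smooth_normal_field_def\<close>)

lemma cont_S: "continuous_on T S"
  unfolding S_def
  by (rule continuous_on_tangential_spin[OF cont_n]) (use roll in \<open>simp add: rolling_motion_def\<close>)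

lemma cont_y: "continuous_on T y"
  unfolding y_def by (intro continuous_intros cont_a cont_n)

lemma velocity_tangent: "\<tau> \<in> T \<Longrightarrow> u \<tau> \<bullet> n \<tau> = 0"
  unfolding n_def by (rule rolling_motion_center_normal[OF roll])

lemma skew_S: "\<tau> \<in> T \<Longrightarrow> skew (S \<tau>)"
  using roll by (simp add: S_def rolling_motion_def skew_tangential_spin)

lemma spin_normal: "\<tau> \<in> T \<Longrightarrow> S \<tau> (n \<tau>) = 0"
  using tangential_spin_normal[OF norm_n] by (simp add: S_def)

lemma n_start: "n t0 = (0, \<sigma>)"
proof -
  obtain z where z: "a t0 = (z, \<sigma> * r)" "z \<in> P" using start by auto
  have "\<bar>\<sigma>\<bar> = 1" using sigma by auto
  with flat_normal[OF on_surface r(1) outward z] inT t01 on_surface show ?thesis by (simp add: n_def)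
qed

lemma n_finish: "n t1 = (0, - \<sigma>)"
proof -
  obtain z where z: "a t1 = (z, - \<sigma> * r)" "z \<in> P" using finish by auto
  have "\<bar>- \<sigma>\<bar> = 1" using sigma by auto
  with flat_normal[OF on_surface r(1) outward z] inT t01 on_surface show ?thesis by (simp add: n_def)
qed

lemma fst_n_nonzero: "\<tau> \<in> {t0<..<t1} \<Longrightarrow> fst (n \<tau>) \<noteq> 0"
  using curved_part_normal_not_vertical[OF P curved r(1) outward] on_surface inT by (simp add: n_def)

lemma C_nonneg: "0 \<le> C" and K_nonneg: "0 \<le> K" and d_pos: "0 < d" and A_le_C: "A \<le> C"
proof -
  show C: "0 \<le> C" using A(1) by (simp add: C_def)
  show "0 \<le> K" using C L by (simp add: K_def)
  show "0 < d" using r beta by (simp add: d_def)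
  have "1 * A \<le> (2 * real DIM('a \<times> real)) * A" using A(1) by (intro mult_right_mono) auto
  then show "A \<le> C" by (simp add: C_def)
qed

text \<open>The angle of the normal above the plane of the plate, with the starting side counted as positive; it
  runs from \<open>\<pi> / 2\<close> to \<open>- \<pi> / 2\<close>.\<close>

definition \<phi> :: "real \<Rightarrow> real" where "\<phi> \<tau> = arcsin (\<sigma> * snd (n \<tau>))"

lemma sigma2: "\<sigma> * \<sigma> = 1" "\<sigma>\<^sup>2 = 1" "\<bar>\<sigma>\<bar> = 1"
  using sigma by auto

lemma norm_n_parts:
  assumes "\<tau> \<in> T" shows "(norm (fst (n \<tau>)))\<^sup>2 + (snd (n \<tau>))\<^sup>2 = 1" "\<bar>\<sigma> * snd (n \<tau>)\<bar> \<le> 1"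
proof -
  have "n \<tau> \<bullet> n \<tau> = 1" using norm_n[OF assms] by (simp add: dot_square_norm)
  then show 1: "(norm (fst (n \<tau>)))\<^sup>2 + (snd (n \<tau>))\<^sup>2 = 1"
    unfolding power2_norm_eq_inner inner_prod_def by (simp add: power2_eq_square)
  have "(snd (n \<tau>))\<^sup>2 \<le> 1" using 1 zero_le_power2[of "norm (fst (n \<tau>))"] by linarith
  then have "\<bar>snd (n \<tau>)\<bar> \<le> 1" by (simp add: abs_square_le_1)
  then show "\<bar>\<sigma> * snd (n \<tau>)\<bar> \<le> 1" using sigma by auto
qed

lemma \<phi>_props:
  assumes "\<tau> \<in> T"
  shows "\<phi> \<tau> \<in> {- pi / 2..pi / 2}" "sin (\<phi> \<tau>) = \<sigma> * snd (n \<tau>)" "cos (\<phi> \<tau>) = norm (fst (n \<tau>))"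
proof -
  have le: "- 1 \<le> \<sigma> * snd (n \<tau>)" "\<sigma> * snd (n \<tau>) \<le> 1" using norm_n_parts(2)[OF assms] by linarith+
  show "\<phi> \<tau> \<in> {- pi / 2..pi / 2}" "sin (\<phi> \<tau>) = \<sigma> * snd (n \<tau>)"
    unfolding \<phi>_def using arcsin_bounded[OF le] sin_arcsin[OF le] by auto
  have "cos (\<phi> \<tau>) = sqrt (1 - (snd (n \<tau>))\<^sup>2)"
    unfolding \<phi>_def using cos_arcsin[OF le] sigma2 by (simp add: power_mult_distrib)
  also have "\<dots> = norm (fst (n \<tau>))"
    using norm_n_parts(1)[OF assms] by (intro real_sqrt_unique) auto
  finally show "cos (\<phi> \<tau>) = norm (fst (n \<tau>))" .
qed

lemma \<phi>_start: "\<phi> t0 = pi / 2" and \<phi>_finish: "\<phi> t1 = - pi / 2"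
  using sigma2 by (simp_all add: \<phi>_def n_start n_finish arcsin_minus)

lemma cont_\<phi>: "continuous_on T \<phi>"
  unfolding \<phi>_def
  using norm_n_parts(2) by (intro continuous_intros cont_n) (auto simp: abs_le_iff)

text \<open>The unit tangent of the half circle traced by the normal when the contact point is held fixed. For the
  right sign \<open>\<epsilon>\<close> the vector \<open>\<epsilon> * g\<close> is the horizontal direction of the normal.\<close>

definition F :: "real \<Rightarrow> real \<Rightarrow> 'a \<times> real" where
  "F \<epsilon> \<tau> = (- (sin (\<phi> \<tau>) * \<epsilon>) *\<^sub>R g (y \<tau>), \<sigma> * cos (\<phi> \<tau>))"

lemma g_norm: "y \<tau> \<in> ball x \<delta> \<Longrightarrow> norm (g (y \<tau>)) = 1"
  by (rule normal_field_near_norm[OF g])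

lemma cont_gy:
  assumes "I \<subseteq> T" "\<And>\<tau>. \<tau> \<in> I \<Longrightarrow> y \<tau> \<in> ball x \<delta>"
  shows "continuous_on I (\<lambda>\<tau>. g (y \<tau>))"
proof (rule continuous_on_compose2[of "ball x \<delta>" g])
  show "continuous_on (ball x \<delta>) g"
    using normal_field_near_deriv[OF g] has_derivative_continuous
    by (intro continuous_at_imp_continuous_on) blast
qed (use assms continuous_on_subset[OF cont_y] in auto)

text \<open>The horizontal part of the normal is a nonzero multiple of \<open>g\<close> at the contact point throughout the crossing, so by
  continuity its sign cannot change.\<close>

lemma normal_sign:
  assumes s: "s \<le> t1" and y: "\<And>\<tau>. \<tau> \<in> {t0<..<s} \<Longrightarrow> y \<tau> \<in> ball x \<delta>"
  obtains \<epsilon> where "\<epsilon> \<in> {1, -1}"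
    "\<And>\<tau>. \<tau> \<in> {t0<..<s} \<Longrightarrow> fst (n \<tau>) = (cos (\<phi> \<tau>) * \<epsilon>) *\<^sub>R g (y \<tau>)"
proof -
  let ?h = "\<lambda>\<tau>. fst (n \<tau>) \<bullet> g (y \<tau>)"
  have IT: "{t0<..<s} \<subseteq> T" using s T by force
  have val: "fst (n \<tau>) = (cos (\<phi> \<tau>) * sgn (?h \<tau>)) *\<^sub>R g (y \<tau>)" "?h \<tau> \<noteq> 0" if \<tau>: "\<tau> \<in> {t0<..<s}" for \<tau>
  proof -
    have \<tau>T: "\<tau> \<in> T" using IT \<tau> by blast
    have c: "cos (\<phi> \<tau>) = norm (fst (n \<tau>))" by (rule \<phi>_props(3)[OF \<tau>T])
    have nz: "fst (n \<tau>) \<noteq> 0" using \<tau> s by (intro fst_n_nonzero) auto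
    have gg: "g (y \<tau>) \<bullet> g (y \<tau>) = 1" using g_norm[OF y[OF \<tau>]] by (simp add: dot_square_norm)
    have pos: "0 < norm (fst (n \<tau>))" using nz by simp
    have "fst (n \<tau>) = norm (fst (n \<tau>)) *\<^sub>R g (y \<tau>) \<or> fst (n \<tau>) = - norm (fst (n \<tau>)) *\<^sub>R g (y \<tau>)"
      using foot_normal[OF P r(1) on_surface[OF \<tau>T] outward[OF on_surface[OF \<tau>T]] _ g] nz y[OF \<tau>]
      by (simp add: n_def y_def)
    then obtain k where k: "fst (n \<tau>) = k *\<^sub>R g (y \<tau>)"
      "k = norm (fst (n \<tau>)) \<or> k = - norm (fst (n \<tau>))" by blast
    have h: "?h \<tau> = k" unfolding k(1) using gg by simp
    have "k = norm (fst (n \<tau>)) * sgn k" using k(2) pos by (elim disjE; simp add: sgn_if)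
    then have e: "cos (\<phi> \<tau>) * sgn (?h \<tau>) = k" unfolding h c by (rule sym)
    show "fst (n \<tau>) = (cos (\<phi> \<tau>) * sgn (?h \<tau>)) *\<^sub>R g (y \<tau>)" unfolding e by (rule k(1))
    show "?h \<tau> \<noteq> 0" using h k(2) pos by auto
  qed
  have ch: "continuous_on {t0<..<s} ?h"
    by (intro continuous_intros cont_gy[OF IT y] continuous_on_subset[OF cont_n IT])
  have "(\<forall>\<tau>\<in>{t0<..<s}. 0 < ?h \<tau>) \<or> (\<forall>\<tau>\<in>{t0<..<s}. ?h \<tau> < 0)"
    by (rule connected_nonzero_sign[OF connected_Ioo ch val(2)])
  then show ?thesis
  proof
    assume "\<forall>\<tau>\<in>{t0<..<s}. 0 < ?h \<tau>"
    then show ?thesis using val(1) by (intro that[of 1]) auto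
  next
    assume "\<forall>\<tau>\<in>{t0<..<s}. ?h \<tau> < 0"
    then show ?thesis using val(1) by (intro that[of "-1"]) auto
  qed
qed

lemma velocity_deriv: "\<tau> \<in> {t0<..<t1} \<Longrightarrow> (a has_vector_derivative u \<tau>) (at \<tau>)"
  using roll T has_vector_derivative_at_interior[of \<tau> t0 t1 T a "u \<tau>"] inT[of \<tau>]
  by (force simp: rolling_motion_def)

text \<open>During the crossing the center lies on the curved part, where the normal is differentiable.\<close>

lemma motion_driven:
  assumes t: "t \<in> {t0<..<t1}" and y: "y t \<in> ball x \<delta>"
  obtains n' u' S' where "(n has_vector_derivative n') (at t)" "(u has_vector_derivative u') (at t)"
    "(S has_vector_derivative S') (at t)" "normal_driven \<eta> (n t) (u t) (S t) n' u' S'"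
proof -
  have d: "\<nu> differentiable (at (a t) within center_surface P r)"
    using normal_differentiable_on_curved_part[OF P r(1) _ nu g curved[OF t]] y r
    by (simp add: y_def n_def)
  have sub: "{t0<..<t1} \<subseteq> T" using T by force
  have n1: "norm (\<nu> p) = 1" if "p \<in> center_surface P r" for p
    using outward[OF that] by (simp add: outward_unit_normal_def unit_normal_def)
  obtain n' u' S' where "((\<lambda>\<tau>. \<nu> (a \<tau>)) has_vector_derivative n') (at t)"
    "(u has_vector_derivative u') (at t)"
    "((\<lambda>\<tau>. tangential_spin r \<eta> (\<nu> (a \<tau>)) (U \<tau>)) has_vector_derivative S') (at t)"
    "normal_driven \<eta> (\<nu> (a t)) (u t) (tangential_spin r \<eta> (\<nu> (a t)) (U t)) n' u' S'"
    by (rule rolling_motion_normal_driven[OF roll n1 sub t d])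
  then show ?thesis by (rule that[unfolded n_def S_def])
qed

text \<open>The energy is constant up to the endpoints by continuity, although the equations of motion hold only
  strictly between them.\<close>

lemma energy_conserved:
  assumes s: "t0 < s" "s \<le> t1" and y: "\<And>\<tau>. \<tau> \<in> {t0<..<s} \<Longrightarrow> y \<tau> \<in> ball x \<delta>" and t: "t \<in> {t0..s}"
  shows "norm (u t) \<le> C" "norm (S t) \<le> C"
proof -
  have "norm (energy (u t) (S t) - energy (u t0) (S t0)) \<le> 0 * (t - t0)"
  proof (rule norm_increment_le)
    have sub: "{t0..t} \<subseteq> T" using t s T by force
    show "continuous_on {t0..t} (\<lambda>\<tau>. energy (u \<tau>) (S \<tau>))"
      unfolding energy_def
      by (intro continuous_intros continuous_on_subset[OF cont_u sub] continuous_on_subset[OF cont_S sub]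
        ) auto
    fix \<tau> assume \<tau>: "\<tau> \<in> {t0<..<t}"
    then have \<tau>1: "\<tau> \<in> {t0<..<t1}" "y \<tau> \<in> ball x \<delta>" "\<tau> \<in> T" using t s y sub by auto
    from motion_driven[OF \<tau>1(1,2)] obtain n' u' S' where
      "(u has_vector_derivative u') (at \<tau>)" "(S has_vector_derivative S') (at \<tau>)"
      "normal_driven \<eta> (n \<tau>) (u \<tau>) (S \<tau>) n' u' S'" by metis
    from energy_derivative_zero[OF this skew_S spin_normal velocity_tangent] \<tau>1
    show "\<exists>D. ((\<lambda>\<tau>. energy (u \<tau>) (S \<tau>)) has_vector_derivative D) (at \<tau>) \<and> norm D \<le> 0" by auto
  qed (use t in auto)
  then have "energy (u t) (S t) \<le> A\<^sup>2" using A by simp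
  from energy_bounds[OF this A(1)] show "norm (u t) \<le> C" "norm (S t) \<le> C"
    using A_le_C by (auto simp: C_def)
qed

text \<open>The contact point moves orthogonally to the normal, because it is the plate point nearest to the
  center; so the component of \<open>u = y' + r n'\<close> along \<open>F\<close> is \<open>r \<phi>'\<close>. The errors \<open>m\<close> and \<open>l\<close> come from the
  turning of the horizontal direction \<open>N\<close>, which is bounded by the curvature bound \<open>L\<close> times the speed of the
  contact point; for \<open>r * L \<le> 1 / 2\<close> that speed is at most twice the speed of the center.\<close>

lemma frame_derivatives:
  assumes s: "s \<le> t1" and y: "\<And>\<tau>. \<tau> \<in> {t0<..<s} \<Longrightarrow> y \<tau> \<in> ball x \<delta>"
    and e: "\<epsilon> \<in> {1, -1}"
    and sgn: "\<And>\<tau>. \<tau> \<in> {t0<..<s} \<Longrightarrow> fst (n \<tau>) = (cos (\<phi> \<tau>) * \<epsilon>) *\<^sub>R g (y \<tau>)"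
    and t: "t \<in> {t0<..<s}" and n': "(n has_vector_derivative n') (at t)"
  obtains m l where "(\<phi> has_real_derivative (u t \<bullet> F \<epsilon> t) / r) (at t)"
    "n' = ((u t \<bullet> F \<epsilon> t) / r) *\<^sub>R F \<epsilon> t + m"
    "(F \<epsilon> has_vector_derivative (- ((u t \<bullet> F \<epsilon> t) / r)) *\<^sub>R n t + l) (at t)"
    "norm m \<le> 2 * L * norm (u t)" "norm l \<le> 2 * L * norm (u t)"
proof -
  have t1: "t \<in> {t0<..<t1}" and tT: "t \<in> T" using t s T by force+
  have IT: "{t0<..<s} \<subseteq> T" using s T by force
  define N where "N = (\<lambda>\<tau>. \<epsilon> *\<^sub>R g (y \<tau>))"
  have N1: "N \<tau> \<bullet> N \<tau> = 1" if "\<tau> \<in> {t0<..<s}" for \<tau>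
    using g_norm[OF y[OF that]] e by (auto simp: N_def dot_square_norm)
  have nN: "n \<tau> = (cos (\<phi> \<tau>) *\<^sub>R N \<tau>, \<sigma> * sin (\<phi> \<tau>))" if "\<tau> \<in> {t0<..<s}" for \<tau>
    using sgn[OF that] \<phi>_props(2)[of \<tau>] that IT sigma2
    by (auto simp: prod_eq_iff N_def simp flip: mult.assoc)
  have FN: "F \<epsilon> \<tau> = (- sin (\<phi> \<tau>) *\<^sub>R N \<tau>, \<sigma> * cos (\<phi> \<tau>))" for \<tau>
    by (simp add: F_def N_def)
  let ?c = "cos (\<phi> t)" and ?s = "sin (\<phi> t)"
  have cpos: "0 < ?c" using \<phi>_props(3)[OF tT] fst_n_nonzero[OF t1] by simp
  have cs: "?c * ?c + ?s * ?s = 1" using sin_cos_squared_add3[of "\<phi> t"] by simp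
  have "\<exists>\<phi>'. (\<phi> has_real_derivative \<phi>') (at t)"
  proof -
    have "(\<sigma> * snd (n t))\<^sup>2 < 1"
      unfolding \<phi>_props(2)[OF tT, symmetric] power2_eq_square
      using cs mult_pos_pos[OF cpos cpos] by linarith
    then have "\<bar>\<sigma> * snd (n t)\<bar> < 1" by (simp add: abs_square_less_1)
    then have b: "- 1 < \<sigma> * snd (n t)" "\<sigma> * snd (n t) < 1" by linarith+
    have "((\<lambda>\<tau>. \<sigma> * snd (n \<tau>)) has_real_derivative \<sigma> * snd n') (at t)"
      unfolding has_real_derivative_iff_has_vector_derivative
      by (intro has_vector_derivative_mult_right bounded_linear.has_vector_derivative[OF bounded_linear_snd n'])
    from DERIV_chain2[OF DERIV_arcsin[OF b] this] show ?thesis unfolding \<phi>_def by blast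
  qed
  then obtain \<phi>' where \<phi>': "(\<phi> has_real_derivative \<phi>') (at t)" by blast
  define y' where "y' = fst (u t - r *\<^sub>R n')"
  have y': "(y has_vector_derivative y') (at t)"
    unfolding y_def y'_def
    by (intro bounded_linear.has_vector_derivative[OF bounded_linear_fst] has_vector_derivative_diff
        velocity_deriv[OF t1] bounded_linear.has_vector_derivative[OF bounded_linear_scaleR_right] n')
  obtain g' where g': "(g has_derivative g') (at (y t))" "\<And>v. norm (g' v) \<le> L * norm v"
    using normal_field_near_deriv[OF g y[OF t]] by blast
  define N' where "N' = \<epsilon> *\<^sub>R g' y'"
  have N': "(N has_vector_derivative N') (at t)"
  proof -
    have "((\<lambda>\<tau>. g (y \<tau>)) has_vector_derivative g' y') (at t)"
      using has_derivative_compose[OF y'[unfolded has_vector_derivative_def] g'(1)]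
        linear_scale[OF has_derivative_linear[OF g'(1)]] by (simp add: has_vector_derivative_def)
    then show ?thesis
      unfolding N_def N'_def by (rule bounded_linear.has_vector_derivative[OF bounded_linear_scaleR_right])
  qed
  have N'_le: "norm N' \<le> L * norm y'" using g'(2)[of y'] e by (auto simp: N'_def)
  have NN': "N t \<bullet> N' = 0"
  proof -
    have "((\<lambda>\<tau>. N \<tau> \<bullet> N \<tau>) has_vector_derivative N t \<bullet> N' + N' \<bullet> N t) (at t)"
      by (rule bounded_bilinear.has_vector_derivative[OF bounded_bilinear_inner N' N'])
    then have "((\<lambda>\<tau>. 1::real) has_vector_derivative N t \<bullet> N' + N' \<bullet> N t) (at t)"
      by (rule has_vector_derivative_transform_within_open[OF _ open_greaterThanLessThan t])
        (rule N1)
    then have "N t \<bullet> N' + N' \<bullet> N t = 0"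
      using vector_derivative_unique_at has_vector_derivative_const by blast
    then show ?thesis by (simp add: inner_commute)
  qed
  (* First-order condition: the distance from the center at time t to the contact points is minimal at t. *)
  have yN: "y' \<bullet> N t = 0"
  proof -
    let ?h = "\<lambda>\<tau>. (a t - (y \<tau>, 0)) \<bullet> (a t - (y \<tau>, 0))"
    have d0: "((\<lambda>\<tau>. a t - (y \<tau>, 0)) has_vector_derivative (0 - (y', 0))) (at t)"
      by (intro has_vector_derivative_diff has_vector_derivative_const has_vector_derivative_Pair y')
    have at: "a t - (y t, 0) = r *\<^sub>R n t" using foot(2)[OF tT] by simp
    from bounded_bilinear.has_vector_derivative[OF bounded_bilinear_inner d0 d0]
    have "(?h has_derivative (\<lambda>s. s *\<^sub>R (- 2 * (r * (?c * (N t \<bullet> y')))))) (at t)"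
      unfolding has_vector_derivative_def at
      by (simp add: nN[OF t] inner_commute mult.commute)
    moreover have "?h t \<le> ?h \<tau>" if "\<tau> \<in> {t0<..<s}" for \<tau>
    proof -
      have \<tau>T: "\<tau> \<in> T" using that IT by blast
      have "r \<le> norm (a t - (y \<tau>, 0))"
        using dist_plate_point_ge[OF on_surface[OF tT] foot(1)[OF \<tau>T]] by (simp add: dist_norm)
      then have "r\<^sup>2 \<le> (norm (a t - (y \<tau>, 0)))\<^sup>2" using r by (intro power_mono) auto
      moreover have "?h t = r\<^sup>2" unfolding at using norm_n[OF tT] by (simp add: dot_square_norm power2_eq_square)
      ultimately show ?thesis by (simp add: power2_norm_eq_inner)
    qed
    ultimately have "(\<lambda>s. s *\<^sub>R (- 2 * (r * (?c * (N t \<bullet> y'))))) = (\<lambda>s. 0)"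
      by (intro differential_zero_maxmin[of t "{t0<..<s}" ?h]) (use t in auto)
    from fun_cong[OF this, of 1] have "- 2 * (r * (?c * (N t \<bullet> y'))) = 0" by simp
    then show ?thesis using r cpos by (simp add: inner_commute)
  qed
  have dsin: "((\<lambda>\<tau>. sin (\<phi> \<tau>)) has_real_derivative ?c * \<phi>') (at t)"
    and dcos: "((\<lambda>\<tau>. cos (\<phi> \<tau>)) has_real_derivative - ?s * \<phi>') (at t)"
    by (auto intro!: derivative_eq_intros \<phi>')
  note dsin = dsin[unfolded has_real_derivative_iff_has_vector_derivative]
    and dcos = dcos[unfolded has_real_derivative_iff_has_vector_derivative]
  note sc = bounded_bilinear.has_vector_derivative[OF bounded_bilinear_scaleR]
  define m where "m = (?c *\<^sub>R N', 0::real)"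
  define l where "l = (- ?s *\<^sub>R N', 0::real)"
  have n'_eq: "n' = \<phi>' *\<^sub>R F \<epsilon> t + m"
  proof -
    have "((\<lambda>\<tau>. (cos (\<phi> \<tau>) *\<^sub>R N \<tau>, \<sigma> * sin (\<phi> \<tau>))) has_vector_derivative \<phi>' *\<^sub>R F \<epsilon> t + m) (at t)"
      by (rule has_vector_derivative_eq_rhs[OF has_vector_derivative_Pair[OF sc[OF dcos N']
            has_vector_derivative_mult_right[OF dsin]]]) (simp add: FN m_def algebra_simps)
    then have "(n has_vector_derivative \<phi>' *\<^sub>R F \<epsilon> t + m) (at t)"
      by (rule has_vector_derivative_transform_within_open[OF _ open_greaterThanLessThan t])
        (simp add: nN)
    then show ?thesis using n' vector_derivative_unique_at by blast
  qed
  have F': "(F \<epsilon> has_vector_derivative (- \<phi>') *\<^sub>R n t + l) (at t)"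
  proof -
    have "((\<lambda>\<tau>. (- sin (\<phi> \<tau>) *\<^sub>R N \<tau>, \<sigma> * cos (\<phi> \<tau>))) has_vector_derivative (- \<phi>') *\<^sub>R n t + l) (at t)"
      by (rule has_vector_derivative_eq_rhs[OF has_vector_derivative_Pair[OF
            sc[OF has_vector_derivative_minus[OF dsin] N']
            has_vector_derivative_mult_right[OF dcos]]]) (simp add: nN[OF t] l_def algebra_simps)
    then show ?thesis using FN by presburger
  qed
  have u_eq: "u t = (y', 0) + r *\<^sub>R n'"
  proof -
    have "(a has_vector_derivative (y', 0) + r *\<^sub>R n') (at t)"
    proof (rule has_vector_derivative_transform_within_open[OF _ open_greaterThanLessThan t])
      show "((\<lambda>\<tau>. (y \<tau>, 0) + r *\<^sub>R n \<tau>) has_vector_derivative (y', 0) + r *\<^sub>R n') (at t)"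
        by (intro has_vector_derivative_add has_vector_derivative_Pair y' has_vector_derivative_const
            bounded_linear.has_vector_derivative[OF bounded_linear_scaleR_right] n')
    qed (use foot(2) IT in force)
    then show ?thesis using velocity_deriv[OF t1] vector_derivative_unique_at by blast
  qed
  have FF: "F \<epsilon> t \<bullet> F \<epsilon> t = 1"
  proof -
    have "F \<epsilon> t \<bullet> F \<epsilon> t = ?s * ?s * (N t \<bullet> N t) + (\<sigma> * \<sigma>) * (?c * ?c)"
      by (simp add: FN algebra_simps)
    then show ?thesis using cs unfolding N1[OF t] sigma2 by linarith
  qed
  have "u t \<bullet> F \<epsilon> t = r * \<phi>'"
    unfolding u_eq n'_eq using FF yN NN' by (simp add: inner_add_left) (simp add: m_def FN inner_commute)
  then have \<phi>'_eq: "\<phi>' = (u t \<bullet> F \<epsilon> t) / r" using r by simp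
  have y'_le: "norm y' \<le> 2 * norm (u t)"
  proof -
    (* The part of the horizontal velocity orthogonal to N. *)
    define p where "p = y' + (r * ?c) *\<^sub>R N'"
    have "fst (u t) = p - (r * \<phi>' * ?s) *\<^sub>R N t"
      unfolding u_eq n'_eq by (simp add: p_def FN m_def algebra_simps)
    moreover have "p \<bullet> N t = 0"
      using yN NN' inner_commute[of "N t" N'] by (simp add: p_def inner_add_left)
    ultimately have "fst (u t) \<bullet> fst (u t) = p \<bullet> p + (r * \<phi>' * ?s)\<^sup>2"
      using N1[OF t] by (simp add: inner_diff_left inner_diff_right inner_commute power2_eq_square)
    then have "p \<bullet> p \<le> fst (u t) \<bullet> fst (u t)" by simp
    then have "norm p \<le> norm (fst (u t))" by (simp add: norm_le)
    also have "\<dots> \<le> norm (u t)" by (rule norm_of_fst_le)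
    finally have p: "norm p \<le> norm (u t)" .
    have "norm y' \<le> norm p + norm ((r * ?c) *\<^sub>R N')"
      using norm_triangle_ineq4[of p "(r * ?c) *\<^sub>R N'"] by (simp add: p_def)
    moreover have "norm ((r * ?c) *\<^sub>R N') \<le> (r * 1) * (L * norm y')"
      unfolding norm_scaleR using r cpos N'_le by (intro mult_mono) (auto simp: abs_mult)
    moreover have "(r * 1) * (L * norm y') \<le> 1 / 2 * norm y'"
      using mult_right_mono[OF r(2) norm_ge_zero[of y']] by simp
    ultimately show ?thesis using p by linarith
  qed
  have N'2: "norm N' \<le> 2 * L * norm (u t)"
    using N'_le mult_left_mono[OF y'_le L] by linarith
  have "norm (k *\<^sub>R N') \<le> 2 * L * norm (u t)" if "\<bar>k\<bar> \<le> 1" for k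
    using mult_right_mono[OF that norm_ge_zero[of N']] N'2 by simp
  from this[of ?c] this[of "- ?s"] have "norm m \<le> 2 * L * norm (u t)" "norm l \<le> 2 * L * norm (u t)"
    by (simp_all add: m_def l_def norm_Pair)
  then show ?thesis using that \<phi>' n'_eq F' unfolding \<phi>'_eq by blast
qed

lemma F_start: "F \<epsilon> t0 = (- \<epsilon> *\<^sub>R g (y t0), 0)" and F_finish: "F \<epsilon> t1 = (\<epsilon> *\<^sub>R g (y t1), 0)"
  by (simp_all add: F_def \<phi>_start \<phi>_finish)

lemma cont_F:
  assumes "I \<subseteq> T" "\<And>\<tau>. \<tau> \<in> I \<Longrightarrow> y \<tau> \<in> ball x \<delta>"
  shows "continuous_on I (F \<epsilon>)"
  unfolding F_def
  by (intro continuous_intros cont_gy[OF assms] continuous_on_subset[OF cont_\<phi> assms(1)])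

lemma frame_orthonormal:
  assumes "\<tau> \<in> T" "y \<tau> \<in> ball x \<delta>" "\<epsilon> \<in> {1, -1}"
    and "fst (n \<tau>) = (cos (\<phi> \<tau>) * \<epsilon>) *\<^sub>R g (y \<tau>)"
  shows "norm (F \<epsilon> \<tau>) = 1" "n \<tau> \<bullet> F \<epsilon> \<tau> = 0"
proof -
  have gg: "g (y \<tau>) \<bullet> g (y \<tau>) = 1" using g_norm[OF assms(2)] by (simp add: dot_square_norm)
  have ee: "\<epsilon> * \<epsilon> = 1" using assms(3) by auto
  have sn: "snd (n \<tau>) = \<sigma> * sin (\<phi> \<tau>)"
    using \<phi>_props(2)[OF assms(1)] sigma2 by (simp flip: mult.assoc)
  have "F \<epsilon> \<tau> \<bullet> F \<epsilon> \<tau> = (\<epsilon> * \<epsilon>) * (sin (\<phi> \<tau>))\<^sup>2 + (\<sigma> * \<sigma>) * (cos (\<phi> \<tau>))\<^sup>2"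
    by (simp add: F_def inner_prod_def gg power2_eq_square algebra_simps)
  then show "norm (F \<epsilon> \<tau>) = 1" unfolding ee sigma2 by (simp add: norm_eq_1)
  have "n \<tau> \<bullet> F \<epsilon> \<tau> = - (\<epsilon> * \<epsilon>) * (sin (\<phi> \<tau>) * cos (\<phi> \<tau>)) + (\<sigma> * \<sigma>) * (sin (\<phi> \<tau>) * cos (\<phi> \<tau>))"
    unfolding inner_prod_def assms(4) sn by (simp add: F_def gg algebra_simps)
  then show "n \<tau> \<bullet> F \<epsilon> \<tau> = 0" unfolding ee sigma2 by simp
qed

definition \<rho> where "\<rho> \<epsilon> \<tau> = u \<tau> \<bullet> F \<epsilon> \<tau>"
definition ub where "ub \<epsilon> \<tau> = u \<tau> - \<rho> \<epsilon> \<tau> *\<^sub>R F \<epsilon> \<tau>"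
definition W where "W \<epsilon> \<tau> = blinfun_apply (S \<tau>) (F \<epsilon> \<tau>)"

text \<open>The four bounded derivatives, integrated over time.\<close>

lemma frame_increments:
  assumes s: "t0 < s" "s \<le> t1" and y: "\<And>\<tau>. \<tau> \<in> {t0..s} \<Longrightarrow> y \<tau> \<in> ball x \<delta>"
    and e: "\<epsilon> \<in> {1, -1}"
    and sgn: "\<And>\<tau>. \<tau> \<in> {t0<..<s} \<Longrightarrow> fst (n \<tau>) = (cos (\<phi> \<tau>) * \<epsilon>) *\<^sub>R g (y \<tau>)"
    and t: "t \<in> {t0..s}"
  shows "\<bar>\<rho> \<epsilon> t - \<rho> \<epsilon> t0\<bar> \<le> 2 * C * K * (t - t0)"
    and "norm ((cos (\<eta> * \<phi> t) *\<^sub>R ub \<epsilon> t - sin (\<eta> * \<phi> t) *\<^sub>R W \<epsilon> t)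
      - (cos (\<eta> * \<phi> t0) *\<^sub>R ub \<epsilon> t0 - sin (\<eta> * \<phi> t0) *\<^sub>R W \<epsilon> t0)) \<le> 9 * C * K * (t - t0)"
    and "norm ((sin (\<eta> * \<phi> t) *\<^sub>R ub \<epsilon> t + cos (\<eta> * \<phi> t) *\<^sub>R W \<epsilon> t)
      - (sin (\<eta> * \<phi> t0) *\<^sub>R ub \<epsilon> t0 + cos (\<eta> * \<phi> t0) *\<^sub>R W \<epsilon> t0)) \<le> 9 * C * K * (t - t0)"
    and "norm ((S t v - ((F \<epsilon> t \<bullet> v) *\<^sub>R W \<epsilon> t - (W \<epsilon> t \<bullet> v) *\<^sub>R F \<epsilon> t))
      - (S t0 v - ((F \<epsilon> t0 \<bullet> v) *\<^sub>R W \<epsilon> t0 - (W \<epsilon> t0 \<bullet> v) *\<^sub>R F \<epsilon> t0))) \<le> 14 * C * K * norm v * (t - t0)"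
proof -
  have IT: "{t0..t} \<subseteq> T" using t s T by force
  have yt: "y \<tau> \<in> ball x \<delta>" if "\<tau> \<in> {t0..t}" for \<tau> using y that t by auto
  have yo: "y \<tau> \<in> ball x \<delta>" if "\<tau> \<in> {t0<..<s}" for \<tau> using y that by auto
  have cF: "continuous_on {t0..t} (F \<epsilon>)" by (rule cont_F[OF IT yt])
  have cu: "continuous_on {t0..t} u" and cS: "continuous_on {t0..t} S" and c\<phi>: "continuous_on {t0..t} \<phi>"
    by (rule continuous_on_subset[OF _ IT], rule cont_u cont_S cont_\<phi>)+
  have c\<rho>: "continuous_on {t0..t} (\<rho> \<epsilon>)" unfolding \<rho>_def by (intro continuous_intros cu cF)
  have cub: "continuous_on {t0..t} (ub \<epsilon>)" unfolding ub_def by (intro continuous_intros cu cF c\<rho>)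
  have cW: "continuous_on {t0..t} (W \<epsilon>)" unfolding W_def
    by (rule bounded_bilinear.continuous_on[OF bounded_bilinear_blinfun_apply cS cF])
  have tt: "t0 \<le> t" using t by simp
  have main: "(\<exists>D. (\<rho> \<epsilon> has_vector_derivative D) (at \<tau>) \<and> norm D \<le> 2 * C * K)
    \<and> (\<exists>D. ((\<lambda>\<tau>. cos (\<eta> * \<phi> \<tau>) *\<^sub>R ub \<epsilon> \<tau> - sin (\<eta> * \<phi> \<tau>) *\<^sub>R W \<epsilon> \<tau>) has_vector_derivative D) (at \<tau>)
      \<and> norm D \<le> 9 * C * K)
    \<and> (\<exists>D. ((\<lambda>\<tau>. sin (\<eta> * \<phi> \<tau>) *\<^sub>R ub \<epsilon> \<tau> + cos (\<eta> * \<phi> \<tau>) *\<^sub>R W \<epsilon> \<tau>) has_vector_derivative D) (at \<tau>)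
      \<and> norm D \<le> 9 * C * K)
    \<and> (\<exists>D. ((\<lambda>\<tau>. S \<tau> v - ((F \<epsilon> \<tau> \<bullet> v) *\<^sub>R W \<epsilon> \<tau> - (W \<epsilon> \<tau> \<bullet> v) *\<^sub>R F \<epsilon> \<tau>)) has_vector_derivative D) (at \<tau>)
      \<and> norm D \<le> 14 * C * K * norm v)" if \<tau>t: "\<tau> \<in> {t0<..<t}" for \<tau>
  proof -
    have \<tau>: "\<tau> \<in> {t0<..<s}" "\<tau> \<in> {t0<..<t1}" "\<tau> \<in> {t0..s}" "\<tau> \<in> T" using \<tau>t t s IT by auto
    obtain n' u' S' where D: "(n has_vector_derivative n') (at \<tau>)" "(u has_vector_derivative u') (at \<tau>)"
      "(S has_vector_derivative S') (at \<tau>)" "normal_driven \<eta> (n \<tau>) (u \<tau>) (S \<tau>) n' u' S'"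
      by (rule motion_driven[OF \<tau>(2) yo[OF \<tau>(1)]])
    obtain m l where ml: "(\<phi> has_real_derivative (u \<tau> \<bullet> F \<epsilon> \<tau>) / r) (at \<tau>)"
      "n' = ((u \<tau> \<bullet> F \<epsilon> \<tau>) / r) *\<^sub>R F \<epsilon> \<tau> + m"
      "(F \<epsilon> has_vector_derivative (- ((u \<tau> \<bullet> F \<epsilon> \<tau>) / r)) *\<^sub>R n \<tau> + l) (at \<tau>)"
      "norm m \<le> 2 * L * norm (u \<tau>)" "norm l \<le> 2 * L * norm (u \<tau>)"
      by (rule frame_derivatives[OF s(2) yo e sgn \<tau>(1) D(1)])
    have bd: "norm (u \<tau>) \<le> C" "norm (S \<tau>) \<le> C"
      using energy_conserved[OF s yo \<tau>(3)] by auto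
    have "2 * L * norm (u \<tau>) \<le> K" unfolding K_def using bd(1) L by (intro mult_left_mono) auto
    then have mlK: "norm m \<le> K" "norm l \<le> K" using ml by linarith+
    note fo = frame_orthonormal[OF \<tau>(4) yo[OF \<tau>(1)] e sgn[OF \<tau>(1)]]
    note afd = adapted_frame_derivatives[where n = n and F = "F \<epsilon>" and u = u and S = S
      and \<phi> = \<phi> and t = \<tau>, OF ml(3) D(2,3) ml(1) D(4)[unfolded ml(2)]
      norm_n[OF \<tau>(4)] fo velocity_tangent[OF \<tau>(4)] spin_normal[OF \<tau>(4)] skew_S[OF \<tau>(4)] bd mlK eta]
    show ?thesis
      unfolding ub_def[abs_def] W_def[abs_def] \<rho>_def[abs_def]
      using afd by blast
  qed
  show "\<bar>\<rho> \<epsilon> t - \<rho> \<epsilon> t0\<bar> \<le> 2 * C * K * (t - t0)"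
    using norm_increment_le[OF tt c\<rho>, of "2 * C * K"] main by simp
  show "norm ((cos (\<eta> * \<phi> t) *\<^sub>R ub \<epsilon> t - sin (\<eta> * \<phi> t) *\<^sub>R W \<epsilon> t)
      - (cos (\<eta> * \<phi> t0) *\<^sub>R ub \<epsilon> t0 - sin (\<eta> * \<phi> t0) *\<^sub>R W \<epsilon> t0)) \<le> 9 * C * K * (t - t0)"
    by (rule norm_increment_le[OF tt]) (intro continuous_intros cub cW c\<phi>, use main in blast)
  show "norm ((sin (\<eta> * \<phi> t) *\<^sub>R ub \<epsilon> t + cos (\<eta> * \<phi> t) *\<^sub>R W \<epsilon> t)
      - (sin (\<eta> * \<phi> t0) *\<^sub>R ub \<epsilon> t0 + cos (\<eta> * \<phi> t0) *\<^sub>R W \<epsilon> t0)) \<le> 9 * C * K * (t - t0)"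
    by (rule norm_increment_le[OF tt]) (intro continuous_intros cub cW c\<phi>, use main in blast)
  show "norm ((S t v - ((F \<epsilon> t \<bullet> v) *\<^sub>R W \<epsilon> t - (W \<epsilon> t \<bullet> v) *\<^sub>R F \<epsilon> t))
      - (S t0 v - ((F \<epsilon> t0 \<bullet> v) *\<^sub>R W \<epsilon> t0 - (W \<epsilon> t0 \<bullet> v) *\<^sub>R F \<epsilon> t0))) \<le> 14 * C * K * norm v * (t - t0)"
    by (rule norm_increment_le[OF tt])
      (intro continuous_intros cub cW cF bounded_linear.continuous_on[OF blinfun.bounded_linear_left cS],
       use main in blast)
qed

text \<open>At the start \<open>\<phi>\<close> has its maximal value \<open>\<pi> / 2\<close> and \<open>\<rho> = - \<epsilon> * b\<close> with \<open>b = fst u \<bullet> g \<ge> \<beta>\<close>, and \<open>\<phi>' = \<rho> / r\<close>. If \<open>\<epsilon>\<close> were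
  \<open>-1\<close>, then \<open>\<phi>\<close> would increase beyond its maximum; so \<open>g\<close> points to the side of the curved part. With \<open>\<epsilon> = 1\<close>
  the angle decreases at least at rate \<open>\<beta> / (2 r)\<close> as long as the time elapsed is at most \<open>d\<close>; since the
  total decrease is at most \<open>\<pi>\<close>, time \<open>d\<close> is not reached, and the center travels at most \<open>C * d\<close>.\<close>

lemma foot_stays_near:
  assumes s: "t0 < s" "s \<le> t1" and y: "\<And>\<tau>. \<tau> \<in> {t0..s} \<Longrightarrow> y \<tau> \<in> ball x \<delta>"
  shows "\<And>\<tau>. \<tau> \<in> {t0<..<s} \<Longrightarrow> fst (n \<tau>) = cos (\<phi> \<tau>) *\<^sub>R g (y \<tau>)"
    and "s - t0 < d" and "norm (y s - x) < \<delta> / 2"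
proof -
  have yo: "y \<tau> \<in> ball x \<delta>" if "\<tau> \<in> {t0<..<s}" for \<tau> using y that by auto
  have IT: "{t0..s} \<subseteq> T" using s T by force
  obtain \<epsilon> where e: "\<epsilon> \<in> {1, -1}"
    and sgn: "\<And>\<tau>. \<tau> \<in> {t0<..<s} \<Longrightarrow> fst (n \<tau>) = (cos (\<phi> \<tau>) * \<epsilon>) *\<^sub>R g (y \<tau>)"
    by (rule normal_sign[OF s(2) yo]) (assumption, rule that, assumption, blast)
  have d\<phi>: "(\<phi> has_real_derivative \<rho> \<epsilon> t / r) (at t)" if t: "t \<in> {t0<..<s}" for t
  proof -
    have "t \<in> {t0<..<t1}" using t s by auto
    then obtain n' where "(n has_vector_derivative n') (at t)"
      using motion_driven[OF _ yo[OF t]] by metis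
    from frame_derivatives[OF s(2) yo e sgn t this] show ?thesis unfolding \<rho>_def by metis
  qed
  have \<rho>0: "\<rho> \<epsilon> t0 = - \<epsilon> * (fst (u t0) \<bullet> g (y t0))"
    by (simp add: \<rho>_def F_start inner_prod_def)
  have \<rho>_near: "\<bar>\<rho> \<epsilon> t - \<rho> \<epsilon> t0\<bar> \<le> \<beta> / 2" if t: "t \<in> {t0..s}" "t \<le> t0 + d" for t
  proof -
    have "2 * C * K * (t - t0) \<le> 2 * C * K * d"
      using t C_nonneg K_nonneg by (intro mult_left_mono) auto
    then show ?thesis using frame_increments(1)[OF s y e sgn t(1)] slow by linarith
  qed
  have \<phi>_range: "- pi / 2 \<le> \<phi> t" "\<phi> t \<le> pi / 2" if "t \<in> {t0..s}" for t
    using \<phi>_props(1)[of t] IT that by auto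
  have c\<phi>: "continuous_on {t0..t} \<phi>" if "t \<le> s" for t
    by (rule continuous_on_subset[OF cont_\<phi>]) (use IT that in force)
  have "\<epsilon> \<noteq> -1"
  proof
    assume m: "\<epsilon> = -1"
    define q where "q = min s (t0 + d)"
    have q: "t0 < q" "q \<le> s" "q \<le> t0 + d" using s d_pos by (auto simp: q_def)
    have "\<phi> t0 < \<phi> q"
    proof (rule DERIV_pos_imp_increasing_open[OF q(1) _ c\<phi>[OF q(2)]])
      fix t assume t: "t0 < t" "t < q"
      then have "\<bar>\<rho> \<epsilon> t - \<rho> \<epsilon> t0\<bar> \<le> \<beta> / 2" using q by (intro \<rho>_near) auto
      moreover have "\<beta> \<le> \<rho> \<epsilon> t0" using \<rho>0 m beta by simp
      ultimately have "\<beta> / 2 \<le> \<rho> \<epsilon> t" by linarith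
      then have "0 < \<rho> \<epsilon> t / r" using beta r by simp
      moreover have "(\<phi> has_real_derivative \<rho> \<epsilon> t / r) (at t)" using d\<phi> t q by auto
      ultimately show "\<exists>l. (\<phi> has_real_derivative l) (at t) \<and> 0 < l" by blast
    qed
    then show False using \<phi>_range(2)[of q] q by (simp add: \<phi>_start)
  qed
  then have e1: "\<epsilon> = 1" using e by auto
  show "\<And>\<tau>. \<tau> \<in> {t0<..<s} \<Longrightarrow> fst (n \<tau>) = cos (\<phi> \<tau>) *\<^sub>R g (y \<tau>)"
    using sgn e1 by simp
  show sd: "s - t0 < d"
  proof (rule ccontr)
    assume "\<not> ?thesis"
    then have ds: "t0 + d \<le> s" by simp
    have "t0 < t0 + d" using d_pos by simp
    from MVT[OF this c\<phi>[OF ds]] obtain l z where z: "t0 < z" "z < t0 + d"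
      "(\<phi> has_real_derivative l) (at z)" "\<phi> (t0 + d) - \<phi> t0 = d * l"
      using d\<phi> ds by (auto simp: real_differentiable_def) (metis greaterThanLessThan_iff less_le_trans)
    have l: "l = \<rho> \<epsilon> z / r" using DERIV_unique[OF z(3) d\<phi>] z ds by simp
    have "\<bar>\<rho> \<epsilon> z - \<rho> \<epsilon> t0\<bar> \<le> \<beta> / 2" using z ds by (intro \<rho>_near) auto
    moreover have "\<rho> \<epsilon> t0 \<le> - \<beta>" using \<rho>0 e1 beta by simp
    ultimately have "\<rho> \<epsilon> z \<le> - \<beta> / 2" by linarith
    then have "d * l \<le> d * ((- \<beta> / 2) / r)" unfolding l
      using d_pos r by (intro mult_left_mono divide_right_mono) auto
    also have "\<dots> = - 2 * pi" using r beta by (simp add: d_def)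
    finally have "\<phi> (t0 + d) \<le> pi / 2 - 2 * pi" using z(4) by (simp add: \<phi>_start)
    then show False using \<phi>_range(1)[of "t0 + d"] ds d_pos pi_gt_zero by simp
  qed
  have "norm (a s - a t0) \<le> C * (s - t0)"
  proof (rule norm_increment_le)
    show "continuous_on {t0..s} a" using cont_a IT by (rule continuous_on_subset)
    fix t assume t: "t \<in> {t0<..<s}"
    then have "(a has_vector_derivative u t) (at t)" "norm (u t) \<le> C"
      using velocity_deriv[of t] energy_conserved(1)[OF s yo, of t] s by auto
    then show "\<exists>D. (a has_vector_derivative D) (at t) \<and> norm D \<le> C" by blast
  qed (use s in simp)
  moreover have "C * (s - t0) \<le> C * d" using sd C_nonneg by (intro mult_left_mono) auto
  ultimately have aa: "norm (fst (a s - a t0)) \<le> C * d" using norm_of_fst_le[of "a s - a t0"] by linarith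
  have tri: "norm (p + q - v + w) \<le> norm p + norm q + norm v + norm w" for p q v w :: 'a by norm
  have yx: "y s - x = (y t0 - x) + fst (a s - a t0) - r *\<^sub>R fst (n s) + r *\<^sub>R fst (n t0)"
    by (simp add: y_def algebra_simps)
  have "norm (y s - x) \<le> norm (y t0 - x) + norm (fst (a s - a t0)) + norm (r *\<^sub>R fst (n s)) + norm (r *\<^sub>R fst (n t0))"
    unfolding yx by (rule tri)
  moreover have "norm (r *\<^sub>R fst (n t)) \<le> r" if "t \<in> {t0..s}" for t
    using norm_of_fst_le[of "n t"] norm_n[of t] that IT r by (auto simp: subset_iff)
  ultimately show "norm (y s - x) < \<delta> / 2" using aa near s
    by (smt (verit) atLeastAtMost_iff)
qed

text \<open>Continuity argument: the estimates require the contact point to be near \<open>x\<close>, and imply that it is even nearer, so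
  there is no first time at which it leaves the smaller ball.\<close>

lemma foot_in_ball:
  assumes "t \<in> {t0..t1}"
  shows "norm (y t - x) < \<delta> / 2"
proof (rule ccontr)
  assume neg: "\<not> ?thesis"
  have cy: "continuous_on {t0..t1} y" using cont_y T by (rule continuous_on_subset)
  define X where "X = {t \<in> {t0..t1}. \<delta> / 2 \<le> norm (y t - x)}"
  have "X \<noteq> {}" using neg assms by (auto simp: X_def)
  have "closed ({t0..t1} \<inter> (\<lambda>t. norm (y t - x)) -` {\<delta> / 2..})"
    by (intro continuous_closed_preimage continuous_intros cy)
  moreover have "{t0..t1} \<inter> (\<lambda>t. norm (y t - x)) -` {\<delta> / 2..} = X" by (auto simp: X_def)
  ultimately have "closed X" by simp
  moreover have "bounded X" by (rule bounded_subset[of "{t0..t1}"]) (auto simp: X_def)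
  ultimately have "compact X" by (simp add: compact_eq_bounded_closed)
  then obtain s where s: "s \<in> X" "\<And>t. t \<in> X \<Longrightarrow> s \<le> t"
    using compact_attains_inf[OF _ \<open>X \<noteq> {}\<close>] by blast
  have "norm (y t0 - x) < \<delta> / 2"
    using near d_pos C_nonneg r mult_nonneg_nonneg[of C d] by linarith
  then have s0: "t0 < s" "s \<le> t1" using s(1) by (auto simp: X_def order.order_iff_strict)
  have lt: "norm (y t - x) < \<delta> / 2" if "t \<in> {t0..<s}" for t
    using s(2)[of t] that s0 by (force simp: X_def)
  have "norm (y s - x) \<le> \<delta> / 2"
  proof (rule tendsto_upperbound)
    have "continuous_on {t0..s} (\<lambda>t. norm (y t - x))"
      using cy s0 by (intro continuous_intros) (auto elim: continuous_on_subset)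
    then show "((\<lambda>t. norm (y t - x)) \<longlongrightarrow> norm (y s - x)) (at_left s)"
      by (rule continuous_on_Icc_at_leftD[OF _ s0(1)])
    show "\<forall>\<^sub>F t in at_left s. norm (y t - x) \<le> \<delta> / 2"
      using eventually_at_left_real[OF s0(1)] by eventually_elim (use lt in \<open>simp add: less_imp_le\<close>)
  qed simp
  then have "y t \<in> ball x \<delta>" if "t \<in> {t0..s}" for t
    using lt[of t] that delta by (cases "t = s") (auto simp: dist_norm norm_minus_commute)
  from foot_stays_near(3)[OF s0 this] s(1) show False by (simp add: X_def)
qed

text \<open>The increments over the whole crossing, during which \<open>\<phi>\<close> falls from \<open>\<pi> / 2\<close> to \<open>- \<pi> / 2\<close> and \<open>F\<close> turns from
  \<open>f0\<close>, pointing into the plate, to \<open>f1\<close>, pointing out of it.\<close>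

lemma crossing_estimates:
  fixes f0 f1 c s
  defines "f0 \<equiv> (- g (y t0), 0::real)" and "f1 \<equiv> (g (y t1), 0::real)"
    and "c \<equiv> cos (\<eta> * (pi / 2))" and "s \<equiv> sin (\<eta> * (pi / 2))"
  shows "norm (y t1 - y t0) \<le> C * d"
    and "\<bar>u t1 \<bullet> f1 - u t0 \<bullet> f0\<bar> \<le> 2 * C * K * d"
    and "norm ((c *\<^sub>R (u t1 - (u t1 \<bullet> f1) *\<^sub>R f1) + s *\<^sub>R S t1 f1)
      - (c *\<^sub>R (u t0 - (u t0 \<bullet> f0) *\<^sub>R f0) - s *\<^sub>R S t0 f0)) \<le> 9 * C * K * d"
    and "norm ((- s *\<^sub>R (u t1 - (u t1 \<bullet> f1) *\<^sub>R f1) + c *\<^sub>R S t1 f1)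
      - (s *\<^sub>R (u t0 - (u t0 \<bullet> f0) *\<^sub>R f0) + c *\<^sub>R S t0 f0)) \<le> 9 * C * K * d"
    and "norm ((S t1 v - ((f1 \<bullet> v) *\<^sub>R S t1 f1 - (S t1 f1 \<bullet> v) *\<^sub>R f1))
      - (S t0 v - ((f0 \<bullet> v) *\<^sub>R S t0 f0 - (S t0 f0 \<bullet> v) *\<^sub>R f0))) \<le> 14 * C * K * norm v * d"
proof -
  have y: "y t \<in> ball x \<delta>" if "t \<in> {t0..t1}" for t
    using foot_in_ball[OF that] delta by (simp add: dist_norm norm_minus_commute)
  have yo: "y t \<in> ball x \<delta>" if "t \<in> {t0<..<t1}" for t using y that by auto
  note st = foot_stays_near[OF t01 order_refl y]
  have one: "(1::real) \<in> {1, -1}" by simp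
  have sgn: "\<And>\<tau>. \<tau> \<in> {t0<..<t1} \<Longrightarrow> fst (n \<tau>) = (cos (\<phi> \<tau>) * 1) *\<^sub>R g (y \<tau>)" using st(1) by simp
  have tt: "t1 \<in> {t0..t1}" using t01 by simp
  have grow: "k * (t1 - t0) \<le> k * d" if "0 \<le> k" for k using st(2) that by (intro mult_left_mono) auto
  have pos: "0 \<le> 2 * C * K" "0 \<le> 9 * C * K" "0 \<le> 14 * C * K * norm v"
    using C_nonneg K_nonneg by auto
  have f: "F 1 t0 = f0" "F 1 t1 = f1" by (simp_all add: F_start F_finish f0_def f1_def)
  note inc = frame_increments[OF t01 order_refl y one sgn tt, unfolded ub_def W_def \<rho>_def f
      \<phi>_start \<phi>_finish]
  have cs: "cos (\<eta> * (- pi / 2)) = c" "sin (\<eta> * (- pi / 2)) = - s" "cos (\<eta> * (pi / 2)) = c" "sin (\<eta> * (pi / 2)) = s"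
    by (simp_all add: c_def s_def)
  show "\<bar>u t1 \<bullet> f1 - u t0 \<bullet> f0\<bar> \<le> 2 * C * K * d"
    using inc(1) grow[OF pos(1)] by linarith
  show "norm ((c *\<^sub>R (u t1 - (u t1 \<bullet> f1) *\<^sub>R f1) + s *\<^sub>R S t1 f1)
      - (c *\<^sub>R (u t0 - (u t0 \<bullet> f0) *\<^sub>R f0) - s *\<^sub>R S t0 f0)) \<le> 9 * C * K * d"
    using order_trans[OF inc(2) grow[OF pos(2)]] unfolding cs by simp
  show "norm ((- s *\<^sub>R (u t1 - (u t1 \<bullet> f1) *\<^sub>R f1) + c *\<^sub>R S t1 f1)
      - (s *\<^sub>R (u t0 - (u t0 \<bullet> f0) *\<^sub>R f0) + c *\<^sub>R S t0 f0)) \<le> 9 * C * K * d"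
    using order_trans[OF inc(3) grow[OF pos(2)]] unfolding cs by simp
  show "norm ((S t1 v - ((f1 \<bullet> v) *\<^sub>R S t1 f1 - (S t1 f1 \<bullet> v) *\<^sub>R f1))
      - (S t0 v - ((f0 \<bullet> v) *\<^sub>R S t0 f0 - (S t0 f0 \<bullet> v) *\<^sub>R f0))) \<le> 14 * C * K * norm v * d"
    using order_trans[OF inc(4) grow[OF pos(3)]] .
  have "norm (a t1 - a t0) \<le> C * (t1 - t0)"
  proof (rule norm_increment_le)
    show "continuous_on {t0..t1} a" using cont_a T by (rule continuous_on_subset)
    fix t assume t: "t \<in> {t0<..<t1}"
    then have "(a has_vector_derivative u t) (at t)" "norm (u t) \<le> C"
      using velocity_deriv[of t] energy_conserved(1)[OF t01 order_refl yo, of t] by auto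
    then show "\<exists>D. (a has_vector_derivative D) (at t) \<and> norm D \<le> C" by blast
  qed (use t01 in simp)
  then have "norm (a t1 - a t0) \<le> C * d" using grow[OF C_nonneg] by linarith
  moreover have "y t1 - y t0 = fst (a t1 - a t0)" by (simp add: y_def n_start n_finish)
  ultimately show "norm (y t1 - y t0) \<le> C * d" using norm_of_fst_le[of "a t1 - a t0"] by simp
qed

end

section \<open>Limit of vanishing radius\<close>

lemma tendsto_perturb:
  fixes f h :: "'i \<Rightarrow> 'b::real_normed_vector"
  assumes f: "(f \<longlongrightarrow> l) G" and b: "\<forall>\<^sub>F n in G. norm (h n - f n) \<le> b n" "(b \<longlongrightarrow> 0) G"
  shows "(h \<longlongrightarrow> l) G"
  using tendsto_add[OF f Lim_null_comparison[OF b]] by simp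

text \<open>Errors that tend to \<open>0\<close> leave exact conservation in the limit. Undoing the rotations by \<open>\<plusminus> \<eta> * \<pi> / 2\<close> at the two
  ends composes to a rotation by \<open>\<pi> * \<eta>\<close>, and the reversal of \<open>f\<close> reflects the component \<open>u \<bullet> f\<close>.\<close>

lemma half_turn_limits:
  fixes u0 u1 f0 f1 :: "nat \<Rightarrow> 'b::euclidean_space" and S0 S1 :: "nat \<Rightarrow> 'b \<Rightarrow>\<^sub>L 'b"
  assumes e: "e \<longlonglongrightarrow> (0::real)" and u0: "u0 \<longlonglongrightarrow> u" and f0: "f0 \<longlonglongrightarrow> - f" and f1: "f1 \<longlonglongrightarrow> f"
    and S0: "(\<lambda>n. S0 n v) \<longlonglongrightarrow> Sv" and w: "(\<lambda>n. S0 n (f0 n)) \<longlonglongrightarrow> w"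
    and c: "c = cos (\<eta> * (pi / 2))" and s: "s = sin (\<eta> * (pi / 2))"
    and est: "\<forall>\<^sub>F n in sequentially. \<bar>u1 n \<bullet> f1 n - u0 n \<bullet> f0 n\<bar> \<le> e n"
      "\<forall>\<^sub>F n in sequentially.
        norm ((c *\<^sub>R (u1 n - (u1 n \<bullet> f1 n) *\<^sub>R f1 n) + s *\<^sub>R S1 n (f1 n))
          - (c *\<^sub>R (u0 n - (u0 n \<bullet> f0 n) *\<^sub>R f0 n) - s *\<^sub>R S0 n (f0 n))) \<le> e n"
      "\<forall>\<^sub>F n in sequentially.
        norm ((- s *\<^sub>R (u1 n - (u1 n \<bullet> f1 n) *\<^sub>R f1 n) + c *\<^sub>R S1 n (f1 n))
          - (s *\<^sub>R (u0 n - (u0 n \<bullet> f0 n) *\<^sub>R f0 n) + c *\<^sub>R S0 n (f0 n))) \<le> e n"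
      "\<forall>\<^sub>F n in sequentially.
        norm ((S1 n v - ((f1 n \<bullet> v) *\<^sub>R S1 n (f1 n) - (S1 n (f1 n) \<bullet> v) *\<^sub>R f1 n))
          - (S0 n v - ((f0 n \<bullet> v) *\<^sub>R S0 n (f0 n) - (S0 n (f0 n) \<bullet> v) *\<^sub>R f0 n))) \<le> e n"
  defines "ub \<equiv> u - (u \<bullet> f) *\<^sub>R f"
  defines "B \<equiv> sin (pi * \<eta>) *\<^sub>R ub + cos (pi * \<eta>) *\<^sub>R w"
  shows "u1 \<longlonglongrightarrow> cos (pi * \<eta>) *\<^sub>R ub - sin (pi * \<eta>) *\<^sub>R w - (u \<bullet> f) *\<^sub>R f"
    and "(\<lambda>n. S1 n v) \<longlonglongrightarrow>
      Sv + ((f \<bullet> v) *\<^sub>R w - (w \<bullet> v) *\<^sub>R f) + ((f \<bullet> v) *\<^sub>R B - (B \<bullet> v) *\<^sub>R f)"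
proof -
  let ?b0 = "\<lambda>n. u0 n - (u0 n \<bullet> f0 n) *\<^sub>R f0 n" and ?b1 = "\<lambda>n. u1 n - (u1 n \<bullet> f1 n) *\<^sub>R f1 n"
  let ?X1 = "\<lambda>n. c *\<^sub>R ?b1 n + s *\<^sub>R S1 n (f1 n)" and ?Y1 = "\<lambda>n. - s *\<^sub>R ?b1 n + c *\<^sub>R S1 n (f1 n)"
  have "pi * \<eta> = 2 * (\<eta> * (pi / 2))" by simp
  then have cs: "cos (pi * \<eta>) = c * c - s * s" "sin (pi * \<eta>) = 2 * s * c"
    by (simp_all only: cos_double sin_double c s power2_eq_square)
  have one: "c * c + s * s = 1"
    using sin_cos_squared_add3[of "\<eta> * (pi / 2)"] by (simp add: c s)
  have \<rho>0: "(\<lambda>n. u0 n \<bullet> f0 n) \<longlonglongrightarrow> u \<bullet> (- f)" by (intro tendsto_intros u0 f0)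
  have \<rho>1: "(\<lambda>n. u1 n \<bullet> f1 n) \<longlonglongrightarrow> - (u \<bullet> f)"
    using tendsto_perturb[OF \<rho>0 _ e, of "\<lambda>n. u1 n \<bullet> f1 n"] est(1) by simp
  have "?b0 \<longlonglongrightarrow> u - (u \<bullet> (- f)) *\<^sub>R (- f)" by (intro tendsto_intros u0 f0 \<rho>0)
  then have b0: "?b0 \<longlonglongrightarrow> ub" by (simp add: ub_def)
  have X1: "?X1 \<longlonglongrightarrow> c *\<^sub>R ub - s *\<^sub>R w"
    by (rule tendsto_perturb[OF _ est(2) e]) (intro tendsto_intros b0 w)
  have Y1: "?Y1 \<longlonglongrightarrow> s *\<^sub>R ub + c *\<^sub>R w"
    by (rule tendsto_perturb[OF _ est(3) e]) (intro tendsto_intros b0 w)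
  (* Solve the rotation at the end of the crossing for the velocity and the spin. *)
  have inv: "c *\<^sub>R ?X1 n - s *\<^sub>R ?Y1 n = ?b1 n" "s *\<^sub>R ?X1 n + c *\<^sub>R ?Y1 n = S1 n (f1 n)" for n
  proof -
    have "c *\<^sub>R (c *\<^sub>R p + s *\<^sub>R q) - s *\<^sub>R (- s *\<^sub>R p + c *\<^sub>R q) = (c * c + s * s) *\<^sub>R p"
      "s *\<^sub>R (c *\<^sub>R p + s *\<^sub>R q) + c *\<^sub>R (- s *\<^sub>R p + c *\<^sub>R q) = (c * c + s * s) *\<^sub>R q" for p q :: 'b
      by (simp_all add: algebra_simps)
    then show "c *\<^sub>R ?X1 n - s *\<^sub>R ?Y1 n = ?b1 n" "s *\<^sub>R ?X1 n + c *\<^sub>R ?Y1 n = S1 n (f1 n)"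
      unfolding one by simp_all
  qed
  have "(\<lambda>n. c *\<^sub>R ?X1 n - s *\<^sub>R ?Y1 n) \<longlonglongrightarrow> c *\<^sub>R (c *\<^sub>R ub - s *\<^sub>R w) - s *\<^sub>R (s *\<^sub>R ub + c *\<^sub>R w)"
    by (intro tendsto_intros X1 Y1)
  moreover have "c *\<^sub>R (c *\<^sub>R ub - s *\<^sub>R w) - s *\<^sub>R (s *\<^sub>R ub + c *\<^sub>R w) =
      cos (pi * \<eta>) *\<^sub>R ub - sin (pi * \<eta>) *\<^sub>R w"
    by (simp add: cs algebra_simps scaleR_2 flip: scaleR_add_left)
  ultimately have b1: "?b1 \<longlonglongrightarrow> cos (pi * \<eta>) *\<^sub>R ub - sin (pi * \<eta>) *\<^sub>R w"
    unfolding inv by simp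
  have "(\<lambda>n. s *\<^sub>R ?X1 n + c *\<^sub>R ?Y1 n) \<longlonglongrightarrow> s *\<^sub>R (c *\<^sub>R ub - s *\<^sub>R w) + c *\<^sub>R (s *\<^sub>R ub + c *\<^sub>R w)"
    by (intro tendsto_intros X1 Y1)
  moreover have "s *\<^sub>R (c *\<^sub>R ub - s *\<^sub>R w) + c *\<^sub>R (s *\<^sub>R ub + c *\<^sub>R w) = B"
    by (simp add: B_def cs algebra_simps scaleR_2 flip: scaleR_add_left)
  ultimately have w1: "(\<lambda>n. S1 n (f1 n)) \<longlonglongrightarrow> B" unfolding inv by simp
  have "(\<lambda>n. ?b1 n + (u1 n \<bullet> f1 n) *\<^sub>R f1 n) \<longlonglongrightarrow>
      (cos (pi * \<eta>) *\<^sub>R ub - sin (pi * \<eta>) *\<^sub>R w) + (- (u \<bullet> f)) *\<^sub>R f"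
    by (intro tendsto_add[OF b1] tendsto_scaleR \<rho>1 f1)
  then show "u1 \<longlonglongrightarrow> cos (pi * \<eta>) *\<^sub>R ub - sin (pi * \<eta>) *\<^sub>R w - (u \<bullet> f) *\<^sub>R f" by simp
  have "(\<lambda>n. S1 n v - ((f1 n \<bullet> v) *\<^sub>R S1 n (f1 n) - (S1 n (f1 n) \<bullet> v) *\<^sub>R f1 n)) \<longlonglongrightarrow>
      Sv - ((- f \<bullet> v) *\<^sub>R w - (w \<bullet> v) *\<^sub>R (- f))"
    by (rule tendsto_perturb[OF _ est(4) e]) (intro tendsto_intros S0 w f0)
  from tendsto_add[OF this, of "\<lambda>n. (f1 n \<bullet> v) *\<^sub>R S1 n (f1 n) - (S1 n (f1 n) \<bullet> v) *\<^sub>R f1 n"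
      "(f \<bullet> v) *\<^sub>R B - (B \<bullet> v) *\<^sub>R f"]
  have "(\<lambda>n. S1 n v) \<longlonglongrightarrow> Sv - ((- f \<bullet> v) *\<^sub>R w - (w \<bullet> v) *\<^sub>R (- f)) + ((f \<bullet> v) *\<^sub>R B - (B \<bullet> v) *\<^sub>R f)"
    by (simp add: tendsto_intros w1 f1)
  then show "(\<lambda>n. S1 n v) \<longlonglongrightarrow>
      Sv + ((f \<bullet> v) *\<^sub>R w - (w \<bullet> v) *\<^sub>R f) + ((f \<bullet> v) *\<^sub>R B - (B \<bullet> v) *\<^sub>R f)"
    by (simp add: algebra_simps)
qed

lemma skew_wedge: "skew (wedge p q)"
  by (simp add: skew_def wedge_apply inner_diff_left inner_diff_right inner_commute)

lemma skew_add: "skew A \<Longrightarrow> skew B \<Longrightarrow> skew (A + B)"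
  by (simp add: skew_def blinfun.bilinear_simps inner_add_left inner_add_right)

lemma skew_diff: "skew A \<Longrightarrow> skew B \<Longrightarrow> skew (A - B)"
  by (simp add: skew_def blinfun.bilinear_simps inner_diff_left inner_diff_right)

text \<open>The part of the spin orthogonal to \<open>N\<close> is kept by first removing and then adding a wedge product with \<open>N\<close>, and
  wedge products with \<open>N\<close> are exactly what the two-sided projection annihilates.\<close>

lemma velocity_map_explicit:
  fixes N u :: "'a::euclidean_space" and \<eta> :: real
  assumes N: "norm N = 1" and S: "skew S"
  defines "c \<equiv> cos (pi * \<eta>)" and "s \<equiv> sin (pi * \<eta>)" and "v \<equiv> proj_perp N u"
  shows "velocity_map \<eta> N u S (c *\<^sub>R v + s *\<^sub>R S N - (u \<bullet> N) *\<^sub>R N)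
    (S - wedge N (S N) + wedge N (s *\<^sub>R v - c *\<^sub>R S N))"
proof -
  have NN: "N \<bullet> N = 1" using N by (simp add: dot_square_norm)
  have M: "S N \<bullet> N = 0" "N \<bullet> S N = 0" using blinfun_skew_self[OF S, of N] by (simp_all add: inner_commute)
  have v: "v \<bullet> N = 0" "N \<bullet> v = 0"
    using NN by (simp_all add: v_def proj_perp_apply inner_diff_left inner_diff_right inner_commute)
  define B where "B = s *\<^sub>R v - c *\<^sub>R S N"
  have B: "B \<bullet> N = 0" "N \<bullet> B = 0" by (simp_all add: B_def inner_diff_left inner_diff_right M v)
  have wedge_N: "wedge N b N = b" if "b \<bullet> N = 0" for b using that NN by (simp add: wedge_apply)
  have PwP: "proj_perp N (wedge N b (proj_perp N z)) = 0" if "b \<bullet> N = 0" for b z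
    using NN by (simp add: wedge_apply proj_perp_apply inner_diff_left inner_diff_right that inner_commute
        algebra_simps)
  show ?thesis
    unfolding velocity_map_def Let_def c_def[symmetric] s_def[symmetric] B_def[symmetric] v_def[symmetric]
  proof (intro conjI)
    show "skew (S - wedge N (S N) + wedge N B)" by (intro skew_add skew_diff S skew_wedge)
    show "proj_perp N o\<^sub>L (S - wedge N (S N) + wedge N B) o\<^sub>L proj_perp N = proj_perp N o\<^sub>L S o\<^sub>L proj_perp N"
      by (rule blinfun_eqI) (simp add: blinfun.bilinear_simps PwP B M)
    show "(c *\<^sub>R v + s *\<^sub>R S N - (u \<bullet> N) *\<^sub>R N) \<bullet> N = - (u \<bullet> N)"
      by (simp add: inner_add_left inner_diff_left v M NN)
    show "proj_perp N (c *\<^sub>R v + s *\<^sub>R S N - (u \<bullet> N) *\<^sub>R N) = c *\<^sub>R v + s *\<^sub>R S N"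
      by (simp add: proj_perp_apply inner_add_left inner_diff_left v M NN)
    show "(S - wedge N (S N) + wedge N B) N = B"
      by (simp add: blinfun.bilinear_simps wedge_N B M)
  qed
qed

text \<open>On a flat sheet the full tangential spin is recovered from its restriction to the plate.\<close>

lemma tangential_spin_vertical:
  assumes "\<bar>\<sigma>\<bar> = 1"
  shows "tangential_spin r \<eta> (0, \<sigma>) U z = (plate_restrict (tangential_spin r \<eta> (0, \<sigma>) U) (fst z), 0)"
proof -
  have ss: "\<sigma> * \<sigma> = 1" using assms by (metis abs_mult_self_eq mult_1)
  have P: "proj_perp (0, \<sigma>) w = (fst w, 0)" for w :: "'a \<times> real"
    using ss by (simp add: proj_perp_apply prod_eq_iff inner_prod_def mult.assoc)
  show ?thesis by (simp add: plate_restrict_apply tangential_spin_def blinfun.bilinear_simps P)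
qed

theorem theorem1:
  fixes D P :: "(real ^ 'k) set"
    and x N :: "real ^ 'k"
    and \<gamma> \<eta> :: real
    and r :: "nat \<Rightarrow> real"
    and \<nu> :: "nat \<Rightarrow> (real ^ 'k) \<times> real \<Rightarrow> (real ^ 'k) \<times> real"
    and T :: "nat \<Rightarrow> real set"
    and t0 t1 :: "nat \<Rightarrow> real"
    and a u :: "nat \<Rightarrow> real \<Rightarrow> (real ^ 'k) \<times> real"
    and U :: "nat \<Rightarrow> real \<Rightarrow> ((real ^ 'k) \<times> real) \<Rightarrow>\<^sub>L ((real ^ 'k) \<times> real)"
    and u_in :: "real ^ 'k"
    and S_in :: "(real ^ 'k) \<Rightarrow>\<^sub>L (real ^ 'k)"
  assumes domain: "open D" "connected D" "D \<noteq> {}"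
    and plate: "P = closure D" "piecewise_smooth_boundary P"
    and curvatures: "bounded_principal_curvatures (frontier P)"
    and boundary_point: "x \<in> smooth_part (frontier P)" "outward_unit_normal P x N"
    and inertia: "0 \<le> \<gamma>" "\<eta> = \<gamma> / sqrt (1 + \<gamma>\<^sup>2)"
    and radii: "\<And>n. 0 < r n" "r \<longlonglongrightarrow> 0"
    and normals: "\<And>n. piecewise_smooth_normal_field P (r n) (\<nu> n)"
    and rolling: "\<And>n. rolling_motion P (r n) \<eta> (\<nu> n) (T n) (a n) (u n) (U n)"
    and rounding: "\<And>n. {t0 n..t1 n} \<subseteq> T n" "\<And>n. rounds_edge P (r n) (a n) (t0 n) (t1 n)"
    and before_position: "(\<lambda>n. a n (t0 n)) \<longlonglongrightarrow> (x, 0)"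
    and before_velocity: "(\<lambda>n. u n (t0 n)) \<longlonglongrightarrow> (u_in, 0)" "0 < u_in \<bullet> N"
    and before_spin:
      "(\<lambda>n. plate_restrict (tangential_spin (r n) \<eta> (\<nu> n (a n (t0 n))) (U n (t0 n)))) \<longlonglongrightarrow> S_in"
  shows "\<exists>u_out S_out.
    (\<lambda>n. u n (t1 n)) \<longlonglongrightarrow> (u_out, 0) \<and>
    (\<lambda>n. plate_restrict (tangential_spin (r n) \<eta> (\<nu> n (a n (t1 n))) (U n (t1 n)))) \<longlonglongrightarrow> S_out \<and>
    velocity_map \<eta> N u_in S_in u_out S_out"
proof -
  have P: "closed P" "P \<noteq> {}" using plate(1) domain(3) by simp_all
  have eta: "0 \<le> \<eta>" "\<eta> \<le> 1"
  proof -
    have "\<gamma> = sqrt (\<gamma>\<^sup>2)" using inertia(1) by simp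
    also have "\<dots> \<le> sqrt (1 + \<gamma>\<^sup>2)" by (intro real_sqrt_le_mono) simp
    finally show "\<eta> \<le> 1" unfolding inertia(2) by (intro divide_le_eq_1[THEN iffD2]) (auto intro: add_pos_nonneg)
    show "0 \<le> \<eta>" unfolding inertia(2) using inertia(1) by simp
  qed
  have un: "unit_normal (frontier P) x N" using boundary_point(2) by (simp add: outward_unit_normal_def)
  then have N1: "norm N = 1" by (simp add: unit_normal_def)
  obtain \<delta> L g where delta: "0 < \<delta>" and L: "0 \<le> L" and gx: "g x = N"
    and g: "normal_field_near P x \<delta> L g"
    by (rule smooth_part_normal_field[OF P(1) boundary_point(1) un])
  have "x \<in> ball x \<delta>" using delta by simp
  then obtain g' where "(g has_derivative g') (at x)" using normal_field_near_deriv[OF g] by blast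
  then have cg: "isCont g x" by (rule has_derivative_continuous)
  have re: "\<And>n. t0 n < t1 n"
    "\<And>n. \<exists>\<sigma>\<in>{1, -1}. a n (t0 n) \<in> P \<times> {\<sigma> * r n} \<and> a n (t1 n) \<in> P \<times> {- \<sigma> * r n}"
    "\<And>n t. t \<in> {t0 n<..<t1 n} \<Longrightarrow> a n t \<in> curved_part P (r n)"
    using rounding(2) by (auto simp: rounds_edge_def)
  then obtain \<sigma> where sg: "\<And>n. \<sigma> n \<in> {1, -1}" "\<And>n. a n (t0 n) \<in> P \<times> {\<sigma> n * r n}"
    "\<And>n. a n (t1 n) \<in> P \<times> {- \<sigma> n * r n}" by metis
  have sg1: "\<bar>\<sigma> n\<bar> = 1" for n using sg(1)[of n] by auto
  have surf: "a n t \<in> center_surface P (r n)" if "t \<in> {t0 n..t1 n}" for n t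
    using rolling[of n] rounding(1)[of n] that by (auto simp: rolling_motion_def)
  have out: "outward_unit_normal (plate_nbhd P (r n)) p (\<nu> n p)" if "p \<in> center_surface P (r n)" for n p
    using normals[of n] that by (simp add: piecewise_smooth_normal_field_def)
  have nu0: "\<nu> n (a n (t0 n)) = (0, \<sigma> n)" for n
  proof -
    obtain z where z: "a n (t0 n) = (z, \<sigma> n * r n)" "z \<in> P" using sg(2)[of n] by auto
    have "a n (t0 n) \<in> center_surface P (r n)" using surf[of "t0 n" n] re(1)[of n] by simp
    from flat_normal[OF this radii(1) out[OF this] z sg1] show ?thesis .
  qed
  define y where "y = (\<lambda>n t. fst (a n t - r n *\<^sub>R \<nu> n (a n t)))"
  define S where "S = (\<lambda>n t. tangential_spin (r n) \<eta> (\<nu> n (a n t)) (U n t))"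
  define R where "R = (\<lambda>n. plate_restrict (S n (t0 n)))"
  have R: "R \<longlonglongrightarrow> S_in" using before_spin by (simp add: R_def S_def)
  \<comment> \<open>The hypothesis controls the restriction to the plate only; the initial center lies on a flat sheet.\<close>
  have S0: "S n (t0 n) z = (R n (fst z), 0)" for n z
    unfolding S_def R_def nu0 by (rule tangential_spin_vertical[OF sg1])
  have y0: "(\<lambda>n. y n (t0 n)) \<longlonglongrightarrow> x"
  proof -
    have "y n (t0 n) = fst (a n (t0 n))" for n by (simp add: y_def nu0)
    then show ?thesis using tendsto_fst[OF before_position] by simp
  qed
  have u0: "(\<lambda>n. fst (u n (t0 n))) \<longlonglongrightarrow> u_in" using tendsto_fst[OF before_velocity(1)] by simp
  have g0: "(\<lambda>n. g (y n (t0 n))) \<longlonglongrightarrow> N" using isCont_tendsto_compose[OF cg y0] gx by simp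
  have S_in: "skew S_in"
    unfolding skew_def
  proof (intro allI)
    fix v w
    have "R n v \<bullet> w = - (v \<bullet> R n w)" for n
    proof -
      have "t0 n \<in> T n" using rounding(1)[of n] re(1)[of n] by force
      then have "skew (U n (t0 n))" using rolling[of n] by (simp add: rolling_motion_def)
      then have "skew (S n (t0 n))" unfolding S_def by (rule skew_tangential_spin)
      then have "S n (t0 n) (v, 0) \<bullet> (w, 0) = - ((v, 0) \<bullet> S n (t0 n) (w, 0))" unfolding skew_def by blast
      then show ?thesis by (simp add: S0)
    qed
    moreover have "(\<lambda>n. R n v \<bullet> w) \<longlonglongrightarrow> S_in v \<bullet> w" "(\<lambda>n. - (v \<bullet> R n w)) \<longlonglongrightarrow> - (v \<bullet> S_in w)"
      by (intro tendsto_intros R blinfun.tendsto)+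
    ultimately show "S_in v \<bullet> w = - (v \<bullet> S_in w)" by (simp add: LIMSEQ_unique)
  qed

  \<comment> \<open>Convergent initial data are bounded, so one energy bound serves all radii.\<close>
  obtain k1 where k1: "\<And>n. norm (u n (t0 n)) \<le> k1"
    using Bseq_def convergentI[OF before_velocity(1)] convergent_imp_Bseq by (metis (no_types, lifting))
  obtain k2 where k2: "\<And>n. norm (R n) \<le> k2"
    using Bseq_def convergentI[OF R] convergent_imp_Bseq by (metis (no_types, lifting))
  define k where "k = max k1 k2"
  have k0: "0 \<le> k" using k1[of 0] norm_ge_zero[of "u 0 (t0 0)"] unfolding k_def by linarith
  have "norm (S n (t0 n)) \<le> k" for n
  proof (rule norm_blinfun_bound[OF k0])
    fix z
    have "norm (S n (t0 n) z) = norm (R n (fst z))" by (simp add: S0)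
    also have "\<dots> \<le> norm (R n) * norm (fst z)" by (rule norm_blinfun)
    also have "\<dots> \<le> k * norm z" using k2[of n] k0 norm_of_fst_le[of z] by (intro mult_mono) (auto simp: k_def)
    finally show "norm (S n (t0 n) z) \<le> k * norm z" .
  qed
  moreover have "norm (u n (t0 n)) \<le> k" for n using k1[of n] by (simp add: k_def)
  ultimately have E: "energy (u n (t0 n)) (S n (t0 n)) \<le> ((1 + real DIM((real ^ 'k) \<times> real)) * k)\<^sup>2" for n
    by (intro energy_le)
  define A where "A = (1 + real DIM((real ^ 'k) \<times> real)) * k"
  have A: "0 \<le> A" "\<And>n. energy (u n (t0 n)) (S n (t0 n)) \<le> A\<^sup>2"
    using E k0 by (simp_all add: A_def)
  define C where "C = 2 * real DIM((real ^ 'k) \<times> real) * A"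
  define K where "K = 2 * L * C"
  \<comment> \<open>Half of the limiting speed towards the edge, so that the initial speeds eventually exceed it.\<close>
  define \<beta> where "\<beta> = (u_in \<bullet> N) / 2"
  define d where "d = (\<lambda>n. 4 * pi * r n / \<beta>)"
  have beta: "0 < \<beta>" using before_velocity(2) by (simp add: \<beta>_def)
  have "d \<longlonglongrightarrow> 4 * pi * 0 / \<beta>" unfolding d_def using beta by (intro tendsto_intros radii(2)) auto
  then have d: "d \<longlonglongrightarrow> 0" by simp
  have "\<forall>\<^sub>F n in sequentially. r n * L < 1 / 2"
    using tendsto_mult[OF radii(2) tendsto_const[of L]] by (intro order_tendstoD(2)) auto
  moreover have "\<forall>\<^sub>F n in sequentially. \<beta> < fst (u n (t0 n)) \<bullet> g (y n (t0 n))"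
    using tendsto_inner[OF u0 g0] before_velocity(2) by (intro order_tendstoD(1)) (auto simp: \<beta>_def)
  moreover have "\<forall>\<^sub>F n in sequentially. 2 * C * K * d n < \<beta> / 2"
    using tendsto_mult[OF tendsto_const[of "2 * C * K"] d] beta by (intro order_tendstoD(2)) auto
  moreover have "\<forall>\<^sub>F n in sequentially. norm (y n (t0 n) - x) + C * d n + 2 * r n < \<delta> / 2"
  proof -
    have "(\<lambda>n. norm (y n (t0 n) - x) + C * d n + 2 * r n) \<longlonglongrightarrow> norm (x - x) + C * 0 + 2 * 0"
      by (intro tendsto_intros y0 d radii(2))
    then show ?thesis using delta by (intro order_tendstoD(2)) auto
  qed
  ultimately have cross: "\<forall>\<^sub>F n in sequentially. edge_crossing P (r n) \<eta> (\<nu> n) (T n) (a n) (u n) (U n)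
      (t0 n) (t1 n) (\<sigma> n) x \<delta> L g A \<beta>"
  proof eventually_elim
    case (elim n)
    show ?case
      using P radii(1)[of n] L eta normals[of n] rolling[of n] rounding(1)[of n] re(1)[of n]
        sg(1-3)[of n] re(3)[of _ n] g delta A(1) A(2)[of n] beta elim
      unfolding edge_crossing_def y_def S_def C_def K_def d_def by simp
  qed
  define f0 where "f0 = (\<lambda>n. (- g (y n (t0 n)), 0::real))"
  define f1 where "f1 = (\<lambda>n. (g (y n (t1 n)), 0::real))"
  note defs = y_def S_def C_def K_def d_def f0_def f1_def
  have e1: "\<forall>\<^sub>F n in sequentially. norm (y n (t1 n) - y n (t0 n)) \<le> C * d n"
    using cross by eventually_elim (unfold defs, rule edge_crossing.crossing_estimates(1))
  have "(\<lambda>n. C * d n) \<longlonglongrightarrow> C * 0" by (intro tendsto_intros d)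
  then have y1: "(\<lambda>n. y n (t1 n)) \<longlonglongrightarrow> x" using tendsto_perturb[OF y0 e1] by simp
  have f0: "f0 \<longlonglongrightarrow> - (N, 0)" unfolding f0_def using g0 by (auto intro!: tendsto_eq_intros)
  have f1: "f1 \<longlonglongrightarrow> (N, 0)"
    unfolding f1_def using isCont_tendsto_compose[OF cg y1] gx by (auto intro!: tendsto_eq_intros)
  define W where "W = (- S_in N, 0::real)"
  have W: "(\<lambda>n. S n (t0 n) (f0 n)) \<longlonglongrightarrow> W"
  proof -
    have "(\<lambda>n. (R n (- g (y n (t0 n))), 0::real)) \<longlonglongrightarrow> (S_in (- N), 0)"
      by (intro tendsto_intros blinfun.tendsto R g0)
    then show ?thesis by (simp add: S0 f0_def W_def blinfun.bilinear_simps)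
  qed
  define c where "c = cos (pi * \<eta>)"
  define s where "s = sin (pi * \<eta>)"
  define p where "p = proj_perp N u_in"
  define u_out where "u_out = c *\<^sub>R p + s *\<^sub>R S_in N - (u_in \<bullet> N) *\<^sub>R N"
  define S_out where "S_out = S_in - wedge N (S_in N) + wedge N (s *\<^sub>R p - c *\<^sub>R S_in N)"
  have lims: "(\<lambda>n. u n (t1 n)) \<longlonglongrightarrow> (u_out, 0)" "(\<lambda>n. S n (t1 n) (v, 0)) \<longlonglongrightarrow> (S_out v, 0)" for v
  proof -
    let ?z = "(v, 0::real)"
    \<comment> \<open>A common bound for the four increments.\<close>
    define e where "e = (\<lambda>n. (2 + 9 + 14 * norm ?z) * C * K * d n)"
    have "e \<longlonglongrightarrow> (2 + 9 + 14 * norm ?z) * C * K * 0" unfolding e_def by (intro tendsto_intros d)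
    then have e: "e \<longlonglongrightarrow> 0" by simp
    have e_ge: "2 * C * K * d n \<le> e n" "9 * C * K * d n \<le> e n" "14 * C * K * norm ?z * d n \<le> e n" for n
    proof -
      have "0 \<le> C" using A by (simp add: C_def)
      then have "0 \<le> C * K * d n" using L beta radii(1)[of n] by (simp add: K_def d_def)
      then have "m * (C * K * d n) \<le> (2 + 9 + 14 * norm ?z) * (C * K * d n)"
        if "m \<le> 2 + 9 + 14 * norm ?z" for m using that by (rule mult_right_mono[rotated])
      from this[of 2] this[of 9] this[of "14 * norm ?z"]
      show "2 * C * K * d n \<le> e n" "9 * C * K * d n \<le> e n" "14 * C * K * norm ?z * d n \<le> e n"
        by (simp_all add: e_def algebra_simps)
    qed
    have Sv: "(\<lambda>n. S n (t0 n) ?z) \<longlonglongrightarrow> (S_in v, 0)"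
      unfolding S0 fst_conv by (intro tendsto_intros blinfun.tendsto R)
    have E1: "\<forall>\<^sub>F n in sequentially. \<bar>u n (t1 n) \<bullet> f1 n - u n (t0 n) \<bullet> f0 n\<bar> \<le> e n"
      using cross
      by eventually_elim (rule order_trans[OF _ e_ge(1)], unfold defs, rule edge_crossing.crossing_estimates(2))
    let ?c = "cos (\<eta> * (pi / 2))" and ?s = "sin (\<eta> * (pi / 2))"
    have E2: "\<forall>\<^sub>F n in sequentially.
        norm ((?c *\<^sub>R (u n (t1 n) - (u n (t1 n) \<bullet> f1 n) *\<^sub>R f1 n) + ?s *\<^sub>R S n (t1 n) (f1 n))
          - (?c *\<^sub>R (u n (t0 n) - (u n (t0 n) \<bullet> f0 n) *\<^sub>R f0 n) - ?s *\<^sub>R S n (t0 n) (f0 n))) \<le> e n"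
      using cross
      by eventually_elim (rule order_trans[OF _ e_ge(2)], unfold defs, rule edge_crossing.crossing_estimates(3))
    have E3: "\<forall>\<^sub>F n in sequentially.
        norm ((- ?s *\<^sub>R (u n (t1 n) - (u n (t1 n) \<bullet> f1 n) *\<^sub>R f1 n) + ?c *\<^sub>R S n (t1 n) (f1 n))
          - (?s *\<^sub>R (u n (t0 n) - (u n (t0 n) \<bullet> f0 n) *\<^sub>R f0 n) + ?c *\<^sub>R S n (t0 n) (f0 n))) \<le> e n"
      using cross
      by eventually_elim (rule order_trans[OF _ e_ge(2)], unfold defs, rule edge_crossing.crossing_estimates(4))
    have E4: "\<forall>\<^sub>F n in sequentially.
        norm ((S n (t1 n) ?z - ((f1 n \<bullet> ?z) *\<^sub>R S n (t1 n) (f1 n) - (S n (t1 n) (f1 n) \<bullet> ?z) *\<^sub>R f1 n))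
          - (S n (t0 n) ?z - ((f0 n \<bullet> ?z) *\<^sub>R S n (t0 n) (f0 n) - (S n (t0 n) (f0 n) \<bullet> ?z) *\<^sub>R f0 n))) \<le> e n"
      using cross
      by eventually_elim (rule order_trans[OF _ e_ge(3)], unfold defs, rule edge_crossing.crossing_estimates(5))
    note lim = half_turn_limits[OF e before_velocity(1) f0 f1 Sv W refl refl E1 E2 E3 E4]
    have ub: "(u_in, 0) - ((u_in, 0) \<bullet> (N, 0::real)) *\<^sub>R (N, 0) = (p, 0::real)"
      by (simp add: p_def proj_perp_apply)
    show "(\<lambda>n. u n (t1 n)) \<longlonglongrightarrow> (u_out, 0)"
      using lim(1) unfolding ub by (simp add: u_out_def W_def c_def s_def)
    have "(S_in v, 0) + (((N, 0) \<bullet> ?z) *\<^sub>R W - (W \<bullet> ?z) *\<^sub>R (N, 0))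
        + (((N, 0) \<bullet> ?z) *\<^sub>R (s *\<^sub>R (p, 0) + c *\<^sub>R W) - ((s *\<^sub>R (p, 0) + c *\<^sub>R W) \<bullet> ?z) *\<^sub>R (N, 0))
        = (S_out v, 0::real)"
      by (simp add: S_out_def W_def blinfun.bilinear_simps wedge_apply inner_simps algebra_simps)
    then show "(\<lambda>n. S n (t1 n) (v, 0)) \<longlonglongrightarrow> (S_out v, 0)"
      using lim(2) unfolding ub c_def[symmetric] s_def[symmetric] by simp
  qed
  have "(\<lambda>n. plate_restrict (S n (t1 n))) \<longlonglongrightarrow> S_out"
    by (rule tendsto_componentwise1)
      (use tendsto_fst[OF lims(2)] in \<open>simp add: plate_restrict_apply\<close>)
  moreover have "velocity_map \<eta> N u_in S_in u_out S_out"
    unfolding u_out_def S_out_def c_def s_def p_def by (rule velocity_map_explicit[OF N1 S_in])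
  ultimately show ?thesis using lims(1) unfolding S_def by blast
qed

end
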